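(* Let $n\ge1$, $a\in\mathbb{R}^n$, fix $\beta\in(0,1)$ and put $q=1+\frac{1}{n+\beta}$. There is $\varepsilon>0$ such that for each $u_0\in\mathcal{B}_1^{-\beta,\infty}$ satisfying $\|u_0\|_{\mathcal{B}_1^{-\beta,\infty}}<\varepsilon$ there exists a solution of $$u_t-\Delta u+a\cdot\nabla(u|u|^{q-1})=0,\qquad u(\cdot,0)=u_0,$$ for all $t\ge0$ in the space $$\mathcal{X}=\mathcal{C}([0,\infty):\mathcal{B}_1^{-\beta,\infty})\cap\Big\{u:(0,\infty)\to L^q(\mathbb{R}^n)\;:\;\sup_{t>0}t^{(n/2)(1-1/q)+\beta/2}\|u(t)\|_q<\infty\Big\}.$$ This is the unique solution satisfying the condition $$\sup_{t>0}t^{(n/2)(1-1/q)+\beta/2}\|u(t)\|_q\le2\varepsilon.$$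
   Context: $\|\cdot\|_p$ is the norm of $L^p(\mathbb{R}^n)$; $e^{t\Delta}v=G(\cdot,t)*v$ with $G(x,t)=(4\pi t)^{-n/2}\exp(-|x|^2/(4t))$, for tempered distributions $v$. The homogeneous Besov space is $\mathcal{B}_1^{-\beta,\infty}=\{v\in\mathcal{S}'(\mathbb{R}^n):\|v\|_{\mathcal{B}_1^{-\beta,\infty}}<\infty\}$ with norm $\|v\|_{\mathcal{B}_1^{-\beta,\infty}}=\sup_{s>0}s^{\beta/2}\|e^{s\Delta}v\|_1$. $\mathcal{C}([0,\infty):\mathcal{B}_1^{-\beta,\infty})$ is the space of continuous functions on $[0,\infty)$ with values in $\mathcal{B}_1^{-\beta,\infty}$. A solution is understood as a solution of the integral equation $u(t)=e^{t\Delta}u_0-\int_0^t a\cdot\nabla e^{(t-\tau)\Delta}(u|u|^{q-1})(\tau)\,d\tau$.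
   Formalization: Continuity in C([0,∞):B) is norm continuity at every t>0, but at t=0 it means convergence in S' with the B-norm bounded on each [0,T]; norm continuity at t=0 fails, e.g. for a=0 and u_0 = c(-Δ)^{β/2}δ. *)

theory Defs
  imports "HOL-Analysis.Analysis"
begin

subsection \<open>Tempered distributions on \<open>\<real>\<^sup>n\<close>\<close>

text \<open>\<open>dir_deriv a f\<close> is \<open>a \<cdot> \<nabla>f\<close>; iterated partial derivatives are indexed by lists of coordinates.\<close>

definition dir_deriv :: "real ^ 'n \<Rightarrow> (real ^ 'n \<Rightarrow> real) \<Rightarrow> real ^ 'n \<Rightarrow> real" where
  "dir_deriv a f x = frechet_derivative f (at x) a"

definition partials :: "'n list \<Rightarrow> (real ^ 'n \<Rightarrow> real) \<Rightarrow> real ^ 'n \<Rightarrow> real" where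
  "partials is f = foldr (\<lambda>i. dir_deriv (axis i 1)) is f"

definition schwartz :: "(real ^ 'n \<Rightarrow> real) set" where
  "schwartz = {\<phi>. (\<forall>is x. partials is \<phi> differentiable (at x)) \<and>
                  (\<forall>is (k::nat). bounded (range (\<lambda>x. (1 + norm x) ^ k * partials is \<phi> x)))}"

definition schwartz_seminorm :: "nat \<Rightarrow> (real ^ 'n \<Rightarrow> real) \<Rightarrow> real" where
  "schwartz_seminorm N \<phi> =
     (\<Sum>is | length is \<le> N. SUP x. (1 + norm x) ^ N * \<bar>partials is \<phi> x\<bar>)"

type_synonym 'n distr = "(real ^ 'n \<Rightarrow> real) \<Rightarrow> real"

text \<open>A tempered distribution is a continuous linear functional on the Schwartz functions. It is
  given the value 0 off \<^const>\<open>schwartz\<close>, so that equality of distributions is equality in HOL.\<close>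

definition tempered :: "'n::finite distr \<Rightarrow> bool" where
  "tempered T \<longleftrightarrow>
     (\<forall>\<phi>\<in>schwartz. \<forall>\<psi>\<in>schwartz. T (\<lambda>x. \<phi> x + \<psi> x) = T \<phi> + T \<psi>) \<and>
     (\<forall>c. \<forall>\<phi>\<in>schwartz. T (\<lambda>x. c * \<phi> x) = c * T \<phi>) \<and>
     (\<exists>C N. \<forall>\<phi>\<in>schwartz. \<bar>T \<phi>\<bar> \<le> C * schwartz_seminorm N \<phi>) \<and>
     (\<forall>\<phi>. \<phi> \<notin> schwartz \<longrightarrow> T \<phi> = 0)"

definition distr_of :: "(real ^ 'n \<Rightarrow> real) \<Rightarrow> 'n::finite distr" where
  "distr_of f = (\<lambda>\<phi>. if \<phi> \<in> schwartz then (LINT x|lborel. f x * \<phi> x) else 0)"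

definition represents :: "(real ^ 'n \<Rightarrow> real) \<Rightarrow> 'n::finite distr \<Rightarrow> bool" where
  "represents f T \<longleftrightarrow> f \<in> borel_measurable lborel \<and>
     (\<forall>\<phi>\<in>schwartz. integrable lborel (\<lambda>x. f x * \<phi> x)) \<and> T = distr_of f"

text \<open>A representing function is unique up to null sets; nothing below depends on the choice.\<close>

definition fun_of :: "'n::finite distr \<Rightarrow> real ^ 'n \<Rightarrow> real" where
  "fun_of T = (SOME f. represents f T)"

definition Lp_norm :: "real \<Rightarrow> (real ^ 'n \<Rightarrow> real) \<Rightarrow> ennreal" where
  "Lp_norm p f = (let I = (\<integral>\<^sup>+ x. ennreal (\<bar>f x\<bar> powr p) \<partial>lborel)
                  in if I = \<infinity> then \<infinity> else ennreal (enn2real I powr (1 / p)))"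

text \<open>The infimum is over the almost everywhere equal representatives of \<open>T\<close>, and is \<open>\<infinity>\<close> if
  there is none; thus \<open>distr_Lp_norm p T < \<infinity>\<close> expresses \<open>T \<in> L\<^sup>p\<close>.\<close>

definition distr_Lp_norm :: "real \<Rightarrow> 'n::finite distr \<Rightarrow> ennreal" where
  "distr_Lp_norm p T = (INF f\<in>{f. represents f T}. Lp_norm p f)"

subsection \<open>Heat semigroup and homogeneous Besov space\<close>

definition heat_kernel :: "real \<Rightarrow> real ^ 'n \<Rightarrow> real" where
  "heat_kernel t x =
     (4 * pi * t) powr (- real CARD('n) / 2) * exp (- (norm x)\<^sup>2 / (4 * t))"

text \<open>The smooth function \<open>G(\<cdot>,t) * v\<close>, only used for \<open>t > 0\<close>.\<close>

definition heat :: "real \<Rightarrow> 'n::finite distr \<Rightarrow> real ^ 'n \<Rightarrow> real" where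
  "heat t v x = v (\<lambda>y. heat_kernel t (x - y))"

definition besov_norm :: "real \<Rightarrow> 'n::finite distr \<Rightarrow> ennreal" where
  "besov_norm \<beta> v = (SUP s\<in>{0<..}. ennreal (s powr (\<beta> / 2)) * Lp_norm 1 (heat s v))"

definition besov :: "real \<Rightarrow> 'n::finite distr set" where
  "besov \<beta> = {v. tempered v \<and> besov_norm \<beta> v < \<infinity>}"

text \<open>Continuity of \<open>u : [0,\<infinity>) \<rightarrow> \<B>\<close>. The heat semigroup is not strongly continuous on this
  Besov space at \<open>t = 0\<close> (if \<open>s\<^bsup>\<beta>/2\<^esup> \<parallel>e\<^bsup>s\<Delta>\<^esup>v\<parallel>\<^sub>1\<close> is constant in \<open>s\<close>, as for the fractional
  derivative \<open>(-\<Delta>)\<^bsup>\<beta>/2\<^esup>\<delta>\<close>, then \<open>\<parallel>e\<^bsup>t\<Delta>\<^esup>v - v\<parallel>\<close> does not tend to 0). As usual for such spaces,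
  continuity is therefore with respect to the norm at every \<open>t > 0\<close>, and in the sense of bounded
  convergence in \<open>\<S>'\<close> at \<open>t = 0\<close>.\<close>

definition cont_besov :: "real \<Rightarrow> (real \<Rightarrow> 'n::finite distr) set" where
  "cont_besov \<beta> = {u.
     (\<forall>t\<ge>0. u t \<in> besov \<beta>) \<and>
     (\<forall>t>0. ((\<lambda>s. besov_norm \<beta> (\<lambda>\<phi>. u s \<phi> - u t \<phi>)) \<longlongrightarrow> 0) (at t)) \<and>
     (\<forall>\<phi>\<in>schwartz. ((\<lambda>s. u s \<phi>) \<longlongrightarrow> u 0 \<phi>) (at_right 0)) \<and>
     (\<forall>T>0. (SUP t\<in>{0..T}. besov_norm \<beta> (u t)) < \<infinity>)}"

definition weighted_norm :: "real \<Rightarrow> real \<Rightarrow> (real \<Rightarrow> 'n::finite distr) \<Rightarrow> ennreal" where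
  "weighted_norm \<beta> q u =
     (SUP t\<in>{0<..}. ennreal (t powr (real CARD('n) / 2 * (1 - 1 / q) + \<beta> / 2))
                     * distr_Lp_norm q (u t))"

definition space_X :: "real \<Rightarrow> real \<Rightarrow> (real \<Rightarrow> 'n::finite distr) set" where
  "space_X \<beta> q = cont_besov \<beta> \<inter>
     {u. (\<forall>t>0. distr_Lp_norm q (u t) < \<infinity>) \<and> weighted_norm \<beta> q u < \<infinity>}"

subsection \<open>Solutions of the integral equation\<close>

definition nonlin :: "real \<Rightarrow> 'n::finite distr \<Rightarrow> real ^ 'n \<Rightarrow> real" where
  "nonlin q T = (\<lambda>x. fun_of T x * \<bar>fun_of T x\<bar> powr (q - 1))"

definition duhamel_integrand ::
    "real ^ 'n \<Rightarrow> real \<Rightarrow> (real \<Rightarrow> 'n::finite distr) \<Rightarrow> real \<Rightarrow> real \<Rightarrow> 'n::finite distr" where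
  "duhamel_integrand a q u t \<tau> =
     distr_of (dir_deriv a (heat (t - \<tau>) (distr_of (nonlin q (u \<tau>)))))"

text \<open>For \<open>t > 0\<close> the integral equation is an identity of tempered distributions, the integral over
  \<open>(0,t)\<close> being taken after pairing with a test function. The condition \<open>u(t) \<in> L\<^sup>q\<close> makes
  \<open>u|u|\<^bsup>q-1\<^esup>\<close> a well-defined element of \<open>L\<^sup>1\<close>. At \<open>t = 0\<close> the equation reads \<open>u(0) = u\<^sub>0\<close>.\<close>

definition mild_solution ::
    "real ^ 'n \<Rightarrow> real \<Rightarrow> 'n::finite distr \<Rightarrow> (real \<Rightarrow> 'n::finite distr) \<Rightarrow> bool" where
  "mild_solution a q u0 u \<longleftrightarrow>
     (\<forall>t\<ge>0. tempered (u t)) \<and> u 0 = u0 \<and>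
     (\<forall>t>0. distr_Lp_norm q (u t) < \<infinity> \<and>
       (\<forall>\<phi>\<in>schwartz.
          set_integrable lborel {0<..<t} (\<lambda>\<tau>. duhamel_integrand a q u t \<tau> \<phi>) \<and>
          u t \<phi> = distr_of (heat t u0) \<phi>
                   - (LINT \<tau>:{0<..<t}|lborel. duhamel_integrand a q u t \<tau> \<phi>)))"

end

theory Submission
  imports Defs "HOL-Probability.Distributions" "HOL-Probability.Sinc_Integral"
begin

text \<open>The weight \<open>t\<^bsup>\<gamma>\<^esup>\<close> with \<open>\<gamma> = (n/2)(1-1/q) + \<beta>/2\<close> is invariant under the Duhamel map: if
  \<open>\<parallel>u(t)\<parallel>\<^sub>q \<le> M t\<^bsup>-\<gamma>\<^esup>\<close>, then Minkowski's inequality and \<open>\<parallel>a\<cdot>\<nabla>e\<^bsup>s\<Delta>\<^esup>f\<parallel>\<^sub>q \<le> C s\<^bsup>-1/2-(n/2)(1-1/q)\<^esup>\<parallel>f\<parallel>\<^sub>1\<close> give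
  a bound \<open>C' M\<^sup>q t\<^bsup>-\<gamma>\<^esup>\<close> for the Duhamel term, and Hoelder's inequality gives a Lipschitz constant of order
  \<open>M\<^bsup>q-1\<^esup>\<close>. As \<open>\<parallel>e\<^bsup>t\<Delta>\<^esup>u\<^sub>0\<parallel>\<^sub>q \<le> (3/2) \<parallel>u\<^sub>0\<parallel> t\<^bsup>-\<gamma>\<^esup>\<close>, the map is a contraction of the ball of radius
  \<open>2\<epsilon>\<close> for small \<open>\<epsilon>\<close>. The iteration is carried out with functions jointly measurable in \<open>(t,x)\<close>.
  Distributions enter through \<open>\<langle>e\<^bsup>t\<Delta>\<^esup>u\<^sub>0,\<phi>\<rangle> = \<langle>u\<^sub>0, G(\<cdot>,t)*\<phi>\<rangle>\<close>, which yields the semigroup property and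
  the initial condition, and through duality between \<open>L\<^sup>q\<close> and the Schwartz functions, which yields
  uniqueness.\<close>

subsection \<open>Integral inequalities\<close>

text \<open>How the exponents fit. Put \<nu> = (n/2)(1-1/q). The Duhamel integrand is singular like
  (t-\<tau>)^(-\<alpha>) with \<alpha> = 1/2 + \<nu> < 1 and like \<tau>^(-\<sigma>) with \<sigma> =
  \<gamma> q. The choice of q makes \<sigma> = (1+\<beta>)/2 < 1, and then 1 - \<alpha> - \<sigma> =
  -\<gamma>. The Besov bound has a different balance: the L^1 norm (t+s-\<tau>)^(-1/2) of the
  gradient kernel is split into s^(-\<beta>/2), the Besov weight, and (t-\<tau>)^(-(1-\<beta>)/2).
  As (1-\<beta>)/2 + \<sigma> = 1, the remaining time integral does not depend on t. Smallness is
  the single condition 2qK M^(q-1) \<le> 1/2 on the radius M = 2\<epsilon>. It gives the Lipschitz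
  constant 1/2 and also K M^q \<le> M/4, which together with the share (3/2)(M/2) = 3M/4 of the data
  keeps the ball invariant. Two features shape the text. A tempered distribution is a bare
  functional, so every exchange of it with an integral has to be derived from its seminorm bound.
  And norm estimates are kept as bounds by real constants (\<open>Lq_le\<close>), so that they can
  be combined without arithmetic in \<open>ennreal\<close>.\<close>

lemma young_powr:
  fixes x y q :: real
  assumes "1 \<le> q" "0 \<le> x" "0 \<le> y"
  shows "x * y powr (q - 1) \<le> x powr q / q + (1 - 1 / q) * y powr q"
proof (cases "x = 0 \<or> y = 0")
  case True
  then show ?thesis using assms by auto
next
  case False
  with assms have xy: "x > 0" "y > 0" by auto
  \<comment> \<open>The weighted mean inequality with weights 1/q and 1 - 1/q. The dual exponent is
    never formed, so q = 1 is covered; the \<open>L^1\<close> estimates in Besov norm rely on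
    that.\<close>
  have "(x powr q) powr (1/q) * (y powr q) powr (1 - 1/q) \<le> (1/q) * x powr q + (1 - 1/q) * y powr q"
    using assms xy by (intro Youngs_inequality_0) auto
  moreover have "q * (1 - 1/q) = q - 1" using assms by (simp add: field_simps)
  ultimately show ?thesis using assms xy by (simp add: powr_powr)
qed

text \<open>For 0 \<le> y \<le> x, Young's inequality applied to y x^(q-1) gives x^q - y^q \<le> q
  (x-y) x^(q-1) without differentiating. For opposite signs the two moduli add up, and so do |x| and
  |y| inside |x-y|. The remaining cases follow by symmetry and oddness.\<close>

lemma signed_power_diff:
  fixes x y q :: real
  assumes q: "1 \<le> q"
  shows "\<bar>x * \<bar>x\<bar> powr (q - 1) - y * \<bar>y\<bar> powr (q - 1)\<bar>
    \<le> q * (\<bar>x - y\<bar> * (\<bar>x\<bar> powr (q - 1) + \<bar>y\<bar> powr (q - 1)))"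
proof -
  have pw: "z * z powr (q - 1) = z powr q" if "z \<ge> 0" for z :: real
    using that q by (cases "z = 0") (auto simp: powr_mult_base)
  have pos: "x powr q - y powr q \<le> q * ((x - y) * (x powr (q-1) + y powr (q-1)))"
    if "0 \<le> y" "y \<le> x" for x y :: real
  proof -
    have "y * x powr (q - 1) \<le> y powr q / q + (1 - 1 / q) * x powr q"
      using young_powr[of q y x] q that by auto
    then have "q * (y * x powr (q - 1)) \<le> q * (y powr q / q + (1 - 1 / q) * x powr q)"
      using q by (intro mult_left_mono) auto
    also have "\<dots> = y powr q + (q - 1) * x powr q" using q by (simp add: field_simps)
    finally have "x powr q - y powr q \<le> q * x powr q - q * (y * x powr (q - 1))"
      by (simp add: algebra_simps)
    also have "\<dots> = q * ((x - y) * x powr (q - 1))"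
      using pw[of x] that by (simp add: algebra_simps)
    also have "\<dots> \<le> q * ((x - y) * (x powr (q-1) + y powr (q-1)))"
      using that q by (intro mult_left_mono) auto
    finally show ?thesis .
  qed
  have same: "\<bar>x * \<bar>x\<bar> powr (q - 1) - y * \<bar>y\<bar> powr (q - 1)\<bar>
    \<le> q * (\<bar>x - y\<bar> * (\<bar>x\<bar> powr (q - 1) + \<bar>y\<bar> powr (q - 1)))" if "0 \<le> y" "y \<le> x" for x y :: real
  proof -
    have "y powr q \<le> x powr q" using that q by (intro powr_mono2) auto
    then show ?thesis using pos[OF that] pw[of x] pw[of y] that by auto
  qed
  have opp: "\<bar>x * \<bar>x\<bar> powr (q - 1) - y * \<bar>y\<bar> powr (q - 1)\<bar>
    \<le> q * (\<bar>x - y\<bar> * (\<bar>x\<bar> powr (q - 1) + \<bar>y\<bar> powr (q - 1)))" if "y \<le> 0" "0 \<le> x" for x y :: real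
  proof -
    have "\<bar>x * \<bar>x\<bar> powr (q - 1) - y * \<bar>y\<bar> powr (q - 1)\<bar> = x * x powr (q - 1) + (- y) * (-y) powr (q - 1)"
    proof -
      have "y * \<bar>y\<bar> powr (q - 1) \<le> 0" "0 \<le> x * \<bar>x\<bar> powr (q - 1)"
        "0 \<le> x * \<bar>x\<bar> powr (q - 1) - y * \<bar>y\<bar> powr (q - 1)"
        using that by (auto simp: mult_nonpos_nonneg intro: order_trans[of _ 0])
      then show ?thesis using that by (simp add: abs_of_nonpos abs_of_nonneg)
    qed
    also have "\<dots> \<le> (x - y) * (x powr (q-1) + (-y) powr (q-1))"
    proof -
      have "0 \<le> x * (-y) powr (q - 1)" "0 \<le> (-y) * x powr (q - 1)"
        using that by (auto intro!: mult_nonpos_nonneg)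
      then show ?thesis by (simp add: algebra_simps)
    qed
    also have "\<dots> \<le> q * ((x - y) * (x powr (q-1) + (-y) powr (q-1)))"
    proof -
      have "0 \<le> (x - y) * (x powr (q-1) + (-y) powr (q-1))" using that by (intro mult_nonneg_nonneg) auto
      from mult_right_mono[OF q this] show ?thesis by simp
    qed
    finally show ?thesis using that by (simp add: abs_of_nonpos abs_of_nonneg)
  qed
  consider "0 \<le> y" "y \<le> x" | "0 \<le> x" "x \<le> y" | "y \<le> 0" "0 \<le> x" | "x \<le> 0" "0 \<le> y"
    | "x \<le> y" "y \<le> 0" | "y \<le> x" "x \<le> 0" by linarith
  then show ?thesis
  proof cases
    case 1 then show ?thesis using same by blast
  next
    case 2 then show ?thesis using same[of x y] by (simp add: abs_minus_commute add.commute)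
  next
    case 3 then show ?thesis using opp by blast
  next
    case 4 then show ?thesis using opp[of x y] by (simp add: abs_minus_commute add.commute)
  next
    case 5 then show ?thesis using same[of "-y" "-x"] by (simp add: abs_minus_commute add.commute)
  next
    case 6 then show ?thesis using same[of "-x" "-y"] by (simp add: abs_minus_commute add.commute)
  qed
qed

text \<open>A norm bound instead of a norm: measurability travels with the bound, and no root of an
  extended number is ever taken.\<close>

definition Lq_le :: "real \<Rightarrow> ('b::euclidean_space \<Rightarrow> real) \<Rightarrow> real \<Rightarrow> bool" where
  "Lq_le q f A \<longleftrightarrow> f \<in> borel_measurable borel \<and>
     (\<integral>\<^sup>+x. ennreal (\<bar>f x\<bar> powr q) \<partial>lborel) \<le> ennreal (A powr q)"

lemma Lq_le_measurable: "Lq_le q f A \<Longrightarrow> f \<in> borel_measurable borel"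
  by (simp add: Lq_le_def)

lemma Lq_le_mono: "Lq_le q f A \<Longrightarrow> 0 \<le> A \<Longrightarrow> A \<le> B \<Longrightarrow> 0 \<le> q \<Longrightarrow> Lq_le q f B"
  unfolding Lq_le_def using powr_mono2[of q A B] by (auto intro: order_trans[OF _ ennreal_leI])

lemma Lq_le_dominated:
  assumes "Lq_le q f A" "g \<in> borel_measurable borel" "AE x in lborel. \<bar>g x\<bar> \<le> \<bar>f x\<bar>" "0 \<le> q"
  shows "Lq_le q g A"
  unfolding Lq_le_def
proof
  have "(\<integral>\<^sup>+x. ennreal (\<bar>g x\<bar> powr q) \<partial>lborel) \<le> (\<integral>\<^sup>+x. ennreal (\<bar>f x\<bar> powr q) \<partial>lborel)"
  proof (rule nn_integral_mono_AE, use assms(3) in eventually_elim)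
    case (elim x)
    then show ?case using assms(4) by (intro ennreal_leI powr_mono2) auto
  qed
  with assms(1) show "(\<integral>\<^sup>+x. ennreal (\<bar>g x\<bar> powr q) \<partial>lborel) \<le> ennreal (A powr q)"
    by (auto simp: Lq_le_def)
qed fact

lemma Lq_le_cong:
  assumes "Lq_le q f A" "g \<in> borel_measurable borel" "AE x in lborel. g x = f x" "0 \<le> q"
  shows "Lq_le q g A"
proof (rule Lq_le_dominated[OF assms(1,2) _ assms(4)])
  show "AE x in lborel. \<bar>g x\<bar> \<le> \<bar>f x\<bar>" using assms(3) by eventually_elim simp
qed

text \<open>The power is continuous from the right at A. This removes the slack wherever an estimate
  is available only for every larger constant: in Minkowski's inequality and at the end of the two
  iterations.\<close>

lemma Lq_le_limit:
  assumes q: "0 < q" and A: "0 \<le> A" and "\<And>B. A < B \<Longrightarrow> Lq_le q f B"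
  shows "Lq_le q f A"
  unfolding Lq_le_def
proof
  show "f \<in> borel_measurable borel" using assms(3)[of "A + 1"] by (auto simp: Lq_le_def)
  have "((\<lambda>e. ennreal ((A + e) powr q)) \<longlongrightarrow> ennreal ((A + 0) powr q)) (at_right 0)"
    using q A by (intro tendsto_ennrealI tendsto_intros) (auto simp: eventually_at_filter)
  moreover have "\<forall>\<^sub>F e in at_right 0. (\<integral>\<^sup>+x. ennreal (\<bar>f x\<bar> powr q) \<partial>lborel) \<le> ennreal ((A + e) powr q)"
    using assms(3) by (auto simp: Lq_le_def eventually_at_filter)
  ultimately show "(\<integral>\<^sup>+x. ennreal (\<bar>f x\<bar> powr q) \<partial>lborel) \<le> ennreal (A powr q)"
    by (auto intro: tendsto_lowerbound)
qed

lemma Lq_le_zeroD: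
  assumes "Lq_le q f 0" "0 < q"
  shows "AE x in lborel. f x = 0"
proof -
  have [measurable]: "f \<in> borel_measurable borel" and "(\<integral>\<^sup>+x. ennreal (\<bar>f x\<bar> powr q) \<partial>lborel) = 0"
    using assms by (auto simp: Lq_le_def)
  then have "AE x in lborel. ennreal (\<bar>f x\<bar> powr q) = 0"
    by (subst (asm) nn_integral_0_iff_AE) auto
  then show ?thesis by (elim eventually_mono) simp
qed

lemma ennreal_le_comb:
  assumes "a \<le> b * c + d * e" "0 \<le> b" "0 \<le> c" "0 \<le> d" "0 \<le> e"
  shows "ennreal a \<le> ennreal b * ennreal c + ennreal d * ennreal e"
proof -
  have "ennreal a \<le> ennreal (b * c + d * e)" using assms by (intro ennreal_leI)
  also have "\<dots> = ennreal b * ennreal c + ennreal d * ennreal e"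
    using assms by (simp add: ennreal_mult)
  finally show ?thesis .
qed

text \<open>Hoelder's inequality with the second factor already in the form |g|^(q-1), as the
  nonlinearity produces it. After dividing f by A and g by B, Young's inequality holds pointwise,
  and its two terms integrate to the shares 1/q and 1 - 1/q of the right-hand side. Vanishing A or B
  must be treated apart.\<close>

lemma nn_integral_holder:
  assumes f: "Lq_le q f A" and g: "Lq_le q g B" and AB: "0 \<le> A" "0 \<le> B" and q: "1 \<le> q"
  shows "(\<integral>\<^sup>+x. ennreal (\<bar>f x\<bar> * \<bar>g x\<bar> powr (q - 1)) \<partial>lborel) \<le> ennreal (A * B powr (q - 1))"
proof (cases "A = 0")
  case True
  then have "AE x in lborel. f x = 0"
    using Lq_le_zeroD[of q f] f q by auto
  then have "AE x in lborel. ennreal (\<bar>f x\<bar> * \<bar>g x\<bar> powr (q - 1)) = 0" by eventually_elim auto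
  then have "(\<integral>\<^sup>+x. ennreal (\<bar>f x\<bar> * \<bar>g x\<bar> powr (q - 1)) \<partial>lborel) = (\<integral>\<^sup>+(x::'a). 0 \<partial>lborel)"
    by (intro nn_integral_cong_AE) auto
  then show ?thesis by simp
next
  case False
  show ?thesis
  proof (cases "B = 0")
    case B: True
    \<comment> \<open>This is true also for q = 1, because \<open>0 powr 0 = 0\<close>.\<close>
    have "AE x in lborel. ennreal (\<bar>f x\<bar> * \<bar>g x\<bar> powr (q - 1)) = 0"
      using Lq_le_zeroD[of q g] g q B by (auto elim!: eventually_mono)
    then have "(\<integral>\<^sup>+x. ennreal (\<bar>f x\<bar> * \<bar>g x\<bar> powr (q - 1)) \<partial>lborel) = (\<integral>\<^sup>+(x::'a). 0 \<partial>lborel)"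
      by (intro nn_integral_cong_AE) auto
    then show ?thesis by simp
  next
    case q1: False
    with False AB have AB: "A > 0" "B > 0" by auto
    have [measurable]: "f \<in> borel_measurable borel" "g \<in> borel_measurable borel"
      using f g by (auto simp: Lq_le_def)
    define c where "c = A * B powr (q - 1)"
    have c: "c > 0" using AB by (simp add: c_def)
    have "(\<integral>\<^sup>+x. ennreal (\<bar>f x\<bar> * \<bar>g x\<bar> powr (q - 1)) \<partial>lborel)
      \<le> (\<integral>\<^sup>+x. ennreal (c / (q * A powr q)) * ennreal (\<bar>f x\<bar> powr q)
            + ennreal (c * (1 - 1/q) / B powr q) * ennreal (\<bar>g x\<bar> powr q) \<partial>lborel)"
    proof (intro nn_integral_mono)
      fix x
      have "\<bar>f x\<bar> / A * (\<bar>g x\<bar> / B) powr (q - 1) \<le> (\<bar>f x\<bar> / A) powr q / q + (1 - 1 / q) * (\<bar>g x\<bar> / B) powr q"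
        using q AB by (intro young_powr) auto
      then have "c * (\<bar>f x\<bar> / A * (\<bar>g x\<bar> / B) powr (q - 1)) \<le> c * ((\<bar>f x\<bar> / A) powr q / q + (1 - 1 / q) * (\<bar>g x\<bar> / B) powr q)"
        using c by (intro mult_left_mono) auto
      moreover have "c * (\<bar>f x\<bar> / A * (\<bar>g x\<bar> / B) powr (q - 1)) = \<bar>f x\<bar> * \<bar>g x\<bar> powr (q - 1)"
        using AB by (simp add: c_def powr_divide)
      moreover have "c * ((\<bar>f x\<bar> / A) powr q / q + (1 - 1 / q) * (\<bar>g x\<bar> / B) powr q)
         = c / (q * A powr q) * \<bar>f x\<bar> powr q + c * (1 - 1/q) / B powr q * \<bar>g x\<bar> powr q"
        using AB by (simp add: powr_divide field_simps)
      ultimately have "\<bar>f x\<bar> * \<bar>g x\<bar> powr (q - 1)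
         \<le> c / (q * A powr q) * \<bar>f x\<bar> powr q + c * (1 - 1/q) / B powr q * \<bar>g x\<bar> powr q" by simp
      moreover have "0 \<le> c / (q * A powr q)" "0 \<le> c * (1 - 1/q) / B powr q"
        using c q by (auto simp: field_simps)
      ultimately show "ennreal (\<bar>f x\<bar> * \<bar>g x\<bar> powr (q - 1)) \<le> ennreal (c / (q * A powr q)) * ennreal (\<bar>f x\<bar> powr q)
            + ennreal (c * (1 - 1/q) / B powr q) * ennreal (\<bar>g x\<bar> powr q)"
        by (intro ennreal_le_comb) auto
    qed
    also have "\<dots> = ennreal (c / (q * A powr q)) * (\<integral>\<^sup>+x. ennreal (\<bar>f x\<bar> powr q) \<partial>lborel)
            + ennreal (c * (1 - 1/q) / B powr q) * (\<integral>\<^sup>+x. ennreal (\<bar>g x\<bar> powr q) \<partial>lborel)"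
      by (simp add: nn_integral_add nn_integral_cmult)
    also have "\<dots> \<le> ennreal (c / (q * A powr q)) * ennreal (A powr q)
            + ennreal (c * (1 - 1/q) / B powr q) * ennreal (B powr q)"
      using f g by (intro add_mono mult_left_mono) (auto simp: Lq_le_def)
    also have "\<dots> = ennreal (c / (q * A powr q) * A powr q + c * (1 - 1/q) / B powr q * B powr q)"
      using c q AB by (subst ennreal_plus) (auto simp: ennreal_mult[symmetric] field_simps)
    also have "c / (q * A powr q) * A powr q + c * (1 - 1/q) / B powr q * B powr q = c"
      using AB q by (simp add: field_simps)
    finally show ?thesis by (simp add: c_def)
  qed
qed

text \<open>Weighting the Jensen inequality in \<open>m\<close> by \<open>\<kappa>\<close> makes Tonelli give exactly the bound
  \<open>(\<integral>\<kappa>)\<^sup>q\<close>.\<close>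

lemma minkowski_integral:
  fixes K :: "'m \<Rightarrow> 'b::euclidean_space \<Rightarrow> real" and \<kappa> :: "'m \<Rightarrow> real"
  assumes M: "sigma_finite_measure M" and q: "1 \<le> q"
    and K[measurable]: "(\<lambda>(m, x). K m x) \<in> borel_measurable (M \<Otimes>\<^sub>M borel)"
    and \<kappa>[measurable]: "\<kappa> \<in> borel_measurable M" and \<kappa>0: "\<And>m. 0 \<le> \<kappa> m"
    and A: "0 \<le> A" and int\<kappa>: "(\<integral>\<^sup>+m. ennreal (\<kappa> m) \<partial>M) \<le> ennreal A"
    and bound: "AE m in M. (\<integral>\<^sup>+x. ennreal (\<bar>K m x\<bar> powr q) \<partial>lborel) \<le> ennreal (\<kappa> m powr q)"
  shows "AE x in lborel. integrable M (\<lambda>m. K m x)"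
    and "Lq_le q (\<lambda>x. LINT m|M. \<bar>K m x\<bar>) A"
    and "Lq_le q (\<lambda>x. LINT m|M. K m x) A"
proof -
  interpret M: sigma_finite_measure M by fact
  interpret P: pair_sigma_finite M "lborel :: 'b measure" ..
  have Kl[measurable]: "(\<lambda>(m, x). K m x) \<in> borel_measurable (M \<Otimes>\<^sub>M lborel)"
    using K by (simp cong: measurable_cong_sets sets_pair_measure_cong)
  have K2: "(\<lambda>p. K (snd p) (fst p)) \<in> borel_measurable (lborel \<Otimes>\<^sub>M M)"
    "(\<lambda>p. K (snd p) (fst p)) \<in> borel_measurable (borel \<Otimes>\<^sub>M M)"
    by measurable
  have Kx[measurable]: "(\<lambda>m. K m x) \<in> borel_measurable M" for x by measurable
  have mI[measurable]: "(\<lambda>x. LINT m|M. \<bar>K m x\<bar>) \<in> borel_measurable borel"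
      "(\<lambda>x. LINT m|M. K m x) \<in> borel_measurable borel"
    using K2 by (auto intro!: M.borel_measurable_lebesgue_integral simp: split_beta')
  define I where "I x = (\<integral>\<^sup>+m. ennreal (\<bar>K m x\<bar> powr q * \<kappa> m powr (1 - q)) \<partial>M)" for x
  have I_meas[measurable]: "I \<in> borel_measurable borel"
  proof -
    have "(\<lambda>x. \<integral>\<^sup>+m. ennreal (\<bar>K m x\<bar> powr q * \<kappa> m powr (1 - q)) \<partial>M) \<in> borel_measurable lborel"
      by (rule M.borel_measurable_nn_integral) (use K2 in measurable)
    then show ?thesis by (simp add: I_def[abs_def])
  qed
  \<comment> \<open>Where \<kappa> vanishes, the weight \<kappa>^(1-q) is 0 as well, so the integral
    I does not see K there. Hence K must be shown to vanish at such m; the order of the two null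
    sets is then exchanged, since I is used at fixed x.\<close>
  have "AE m in M. AE x in lborel. \<kappa> m = 0 \<longrightarrow> K m x = 0"
    using bound AE_space
  proof eventually_elim
    case (elim m)
    have "K m \<in> borel_measurable borel" using measurable_Pair2[OF K elim(2)] by simp
    then have "Lq_le q (K m) 0" if "\<kappa> m = 0" using elim that by (simp add: Lq_le_def)
    then show ?case using Lq_le_zeroD[of q "K m"] q by (cases "\<kappa> m = 0") auto
  qed
  then have ae0: "AE x in lborel. AE m in M. \<kappa> m = 0 \<longrightarrow> K m x = 0"
  proof (subst (asm) P.AE_commute)
    have "Measurable.pred (M \<Otimes>\<^sub>M lborel) (\<lambda>p. \<kappa> (fst p) = 0 \<longrightarrow> K (fst p) (snd p) = 0)"
      using Kl by (simp add: split_beta')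
    then show "{x \<in> space (M \<Otimes>\<^sub>M lborel). \<kappa> (fst x) = 0 \<longrightarrow> K (fst x) (snd x) = 0} \<in> sets (M \<Otimes>\<^sub>M lborel)"
      by (rule predE)
  qed
  have "(\<integral>\<^sup>+x. I x \<partial>lborel) = (\<integral>\<^sup>+m. \<integral>\<^sup>+x. ennreal (\<bar>K m x\<bar> powr q * \<kappa> m powr (1 - q)) \<partial>lborel \<partial>M)"
    unfolding I_def by (rule P.Fubini') measurable
  also have "\<dots> \<le> (\<integral>\<^sup>+m. ennreal (\<kappa> m) \<partial>M)"
  proof (rule nn_integral_mono_AE)
    show "AE m in M. (\<integral>\<^sup>+x. ennreal (\<bar>K m x\<bar> powr q * \<kappa> m powr (1 - q)) \<partial>lborel) \<le> ennreal (\<kappa> m)"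
      using bound AE_space
    proof eventually_elim
      case (elim m)
      have [measurable]: "K m \<in> borel_measurable borel" using measurable_Pair2[OF K elim(2)] by simp
      have "(\<integral>\<^sup>+x. ennreal (\<bar>K m x\<bar> powr q * \<kappa> m powr (1 - q)) \<partial>lborel)
         = (\<integral>\<^sup>+x. ennreal (\<bar>K m x\<bar> powr q) \<partial>lborel) * ennreal (\<kappa> m powr (1 - q))"
        by (simp add: nn_integral_multc ennreal_mult)
      also have "\<dots> \<le> ennreal (\<kappa> m powr q) * ennreal (\<kappa> m powr (1 - q))"
        using elim by (intro mult_right_mono) auto
      also have "\<dots> = ennreal (\<kappa> m)" using \<kappa>0[of m]
        by (cases "\<kappa> m = 0") (auto simp: ennreal_mult[symmetric] powr_add[symmetric])
      finally show ?case .
    qed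
  qed
  also have "\<dots> \<le> ennreal A" by fact
  finally have II: "(\<integral>\<^sup>+x. I x \<partial>lborel) \<le> ennreal A" .
  then have Ifin: "AE x in lborel. I x \<noteq> \<infinity>"
    by (intro nn_integral_noteq_infinite) (auto simp: top_unique)
  have key: "integrable M (\<lambda>m. K m x) \<and>
      (\<forall>B>A. (LINT m|M. \<bar>K m x\<bar>) powr q \<le> B powr (q - 1) * enn2real (I x))"
    if fin: "I x \<noteq> \<infinity>" and ae: "AE m in M. \<kappa> m = 0 \<longrightarrow> K m x = 0" for x
  proof -
    \<comment> \<open>Young's inequality for |K|/\<kappa> against a free constant l, integrated with
      weight \<kappa>. The choice l = 1 yields integrability; the choice l = J/B, with J the
      integral of |K|, yields the Jensen bound. Taking B above A allows division by B even if A =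
      0.\<close>
    have ineq: "ennreal (l powr (q - 1)) * (\<integral>\<^sup>+m. ennreal \<bar>K m x\<bar> \<partial>M)
        \<le> ennreal (enn2real (I x) / q + (1 - 1/q) * l powr q * B)" if l: "l > 0" and B: "B > A" for l B
    proof -
      have "ennreal (l powr (q - 1)) * (\<integral>\<^sup>+m. ennreal \<bar>K m x\<bar> \<partial>M) = (\<integral>\<^sup>+m. ennreal (l powr (q - 1) * \<bar>K m x\<bar>) \<partial>M)"
        by (simp add: nn_integral_cmult ennreal_mult)
      also have "\<dots> \<le> (\<integral>\<^sup>+m. ennreal (1/q) * ennreal (\<bar>K m x\<bar> powr q * \<kappa> m powr (1 - q)) + ennreal ((1 - 1/q) * l powr q) * ennreal (\<kappa> m) \<partial>M)"
      proof (rule nn_integral_mono_AE, use ae in eventually_elim)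
        case (elim m)
        show ?case
        proof (cases "\<kappa> m = 0")
          case True
          then show ?thesis using elim by simp
        next
          case False
          then have k: "\<kappa> m > 0" using \<kappa>0[of m] by simp
          have "\<bar>K m x\<bar> / \<kappa> m * l powr (q - 1) \<le> (\<bar>K m x\<bar> / \<kappa> m) powr q / q + (1 - 1 / q) * l powr q"
            using q k l by (intro young_powr) auto
          then have "\<kappa> m * (\<bar>K m x\<bar> / \<kappa> m * l powr (q - 1)) \<le> \<kappa> m * ((\<bar>K m x\<bar> / \<kappa> m) powr q / q + (1 - 1 / q) * l powr q)"
            using k by (intro mult_left_mono) auto
          also have "\<dots> = 1/q * (\<bar>K m x\<bar> powr q * \<kappa> m powr (1 - q)) + ((1 - 1/q) * l powr q) * \<kappa> m"
            using k by (simp add: powr_divide powr_diff field_simps)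
          finally have "l powr (q - 1) * \<bar>K m x\<bar> \<le> 1/q * (\<bar>K m x\<bar> powr q * \<kappa> m powr (1 - q)) + ((1 - 1/q) * l powr q) * \<kappa> m"
            using k by (simp add: mult.commute)
          then show ?thesis using q \<kappa>0[of m] by (intro ennreal_le_comb) auto
        qed
      qed
      also have "\<dots> = ennreal (1/q) * I x + ennreal ((1 - 1/q) * l powr q) * (\<integral>\<^sup>+m. ennreal (\<kappa> m) \<partial>M)"
        by (simp add: nn_integral_add nn_integral_cmult I_def)
      also have "\<dots> \<le> ennreal (1/q) * ennreal (enn2real (I x)) + ennreal ((1 - 1/q) * l powr q) * ennreal B"
        using fin int\<kappa> B A by (intro add_mono mult_left_mono order_trans[OF int\<kappa>])
          (auto simp: less_top ennreal_leI)
      also have "\<dots> = ennreal (enn2real (I x) / q + (1 - 1/q) * l powr q * B)"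
        using q A B by (subst ennreal_plus) (auto simp: ennreal_mult[symmetric])
      finally show ?thesis .
    qed
    have int: "integrable M (\<lambda>m. K m x)"
      using ineq[of 1 "A + 1"] by (intro integrableI_bounded) (auto simp: less_top[symmetric] top_unique)
    moreover have "(LINT m|M. \<bar>K m x\<bar>) powr q \<le> B powr (q - 1) * enn2real (I x)" if B: "B > A" for B
    proof (cases "(LINT m|M. \<bar>K m x\<bar>) = 0")
      case True
      then show ?thesis using q by simp
    next
      case False
      define J where "J = (LINT m|M. \<bar>K m x\<bar>)"
      have J: "J > 0" using False by (auto simp: J_def less_le)
      have "(\<integral>\<^sup>+m. ennreal \<bar>K m x\<bar> \<partial>M) = ennreal J"
        unfolding J_def using int by (intro nn_integral_eq_integral) auto
      with ineq[of "J / B" B] B A J have "ennreal ((J / B) powr (q - 1) * J) \<le> ennreal (enn2real (I x) / q + (1 - 1/q) * (J / B) powr q * B)"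
        by (simp add: ennreal_mult)
      then have "(J / B) powr (q - 1) * J \<le> enn2real (I x) / q + (1 - 1/q) * (J / B) powr q * B"
        using q B A by (subst (asm) ennreal_le_iff) auto
      moreover have "(J / B) powr (q - 1) * J = J powr q / B powr (q - 1)"
        using J B A by (simp add: powr_divide powr_diff)
      moreover have "(J / B) powr q * B = J powr q / B powr (q - 1)"
        using J B A by (simp add: powr_divide powr_diff)
      ultimately have "J powr q / B powr (q - 1) \<le> enn2real (I x) / q + (1 - 1/q) * (J powr q / B powr (q - 1))"
        by (simp add: mult.assoc)
      then have "J powr q / B powr (q - 1) \<le> enn2real (I x)"
      proof -
        have "r \<le> i" if "r \<le> i / q + (1 - 1/q) * r" for r i :: real
        proof -
          from that have "r / q \<le> i / q" by (simp add: left_diff_distrib)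
          then show "r \<le> i" using q by (simp add: divide_le_cancel)
        qed
        from this[OF \<open>J powr q / B powr (q - 1) \<le> enn2real (I x) / q + _\<close>] show ?thesis .
      qed
      then show ?thesis unfolding J_def[symmetric] using A B by (simp add: field_simps)
    qed
    ultimately show ?thesis by blast
  qed
  have ae: "AE x in lborel. integrable M (\<lambda>m. K m x) \<and>
      (\<forall>B>A. ennreal ((LINT m|M. \<bar>K m x\<bar>) powr q) \<le> ennreal (B powr (q - 1)) * I x)"
    using Ifin ae0
  proof eventually_elim
    case (elim x)
    have Ix: "ennreal (enn2real (I x)) = I x" using elim by (simp add: less_top)
    have "ennreal ((LINT m|M. \<bar>K m x\<bar>) powr q) \<le> ennreal (B powr (q - 1)) * I x" if "B > A" for B
      by (subst Ix[symmetric]) (use key[OF elim] that in \<open>simp add: ennreal_mult[symmetric] ennreal_leI\<close>)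
    then show ?case using key[OF elim] by auto
  qed
  then show "AE x in lborel. integrable M (\<lambda>m. K m x)" by eventually_elim auto
  show L: "Lq_le q (\<lambda>x. LINT m|M. \<bar>K m x\<bar>) A"
  proof (rule Lq_le_limit)
    fix B assume B: "A < B"
    have "(\<integral>\<^sup>+x. ennreal (\<bar>LINT m|M. \<bar>K m x\<bar>\<bar> powr q) \<partial>lborel) \<le> (\<integral>\<^sup>+x. ennreal (B powr (q - 1)) * I x \<partial>lborel)"
    proof (rule nn_integral_mono_AE, use ae in eventually_elim)
      case (elim x)
      then show ?case using B by simp
    qed
    also have "\<dots> = ennreal (B powr (q - 1)) * (\<integral>\<^sup>+x. I x \<partial>lborel)"
      by (simp add: nn_integral_cmult)
    also have "\<dots> \<le> ennreal (B powr (q - 1)) * ennreal B"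
      using B by (intro mult_left_mono order_trans[OF II]) (auto intro: ennreal_leI)
    also have "\<dots> = ennreal (B powr q)" using A B
      by (simp add: ennreal_mult[symmetric] powr_diff)
    finally show "Lq_le q (\<lambda>x. LINT m|M. \<bar>K m x\<bar>) B" unfolding Lq_le_def by simp
  qed (use q A in auto)
  show "Lq_le q (\<lambda>x. LINT m|M. K m x) A"
    using L q by (intro Lq_le_dominated[OF L]) (auto intro!: always_eventually order_trans[OF integral_abs_bound])
qed

text \<open>Minkowski's integral inequality over a space of two points.\<close>

lemma Lq_le_add:
  assumes f: "Lq_le q f A" and g: "Lq_le q g B" and "0 \<le> A" "0 \<le> B" "1 \<le> q"
  shows "Lq_le q (\<lambda>x. f x + g x) (A + B)"
proof -
  note [measurable] = Lq_le_measurable[OF f] Lq_le_measurable[OF g]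
  have "Lq_le q (\<lambda>x. LINT m|count_space UNIV. (if m then f x else g x)) (A + B)"
  proof (rule minkowski_integral(3)[where \<kappa> = "\<lambda>m. if m then A else B"])
    show "sigma_finite_measure (count_space (UNIV :: bool set))"
      by (simp add: sigma_finite_measure_count_space_finite)
    show "(\<lambda>(m, x). if m then f x else g x) \<in> borel_measurable (count_space UNIV \<Otimes>\<^sub>M borel)"
      by measurable
    show "(\<integral>\<^sup>+m. ennreal (if m then A else B) \<partial>count_space UNIV) \<le> ennreal (A + B)"
      using assms by (simp add: nn_integral_count_space_finite UNIV_bool add.commute)
  qed (use assms in \<open>auto simp: Lq_le_def\<close>)
  then show ?thesis
    by (simp add: lebesgue_integral_count_space_finite UNIV_bool add.commute)
qed

lemma Lq_le_cmult:
  assumes "Lq_le q f A" "0 \<le> A"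
  shows "Lq_le q (\<lambda>x. c * f x) (\<bar>c\<bar> * A)"
proof -
  have [measurable]: "f \<in> borel_measurable borel" using assms by (simp add: Lq_le_def)
  have "(\<integral>\<^sup>+x. ennreal (\<bar>c * f x\<bar> powr q) \<partial>lborel) = ennreal (\<bar>c\<bar> powr q) * (\<integral>\<^sup>+x. ennreal (\<bar>f x\<bar> powr q) \<partial>lborel)"
    by (simp add: nn_integral_cmult[symmetric] abs_mult powr_mult ennreal_mult)
  also have "\<dots> \<le> ennreal (\<bar>c\<bar> powr q) * ennreal (A powr q)"
    using assms by (intro mult_left_mono) (auto simp: Lq_le_def)
  also have "\<dots> = ennreal ((\<bar>c\<bar> * A) powr q)"
    using assms by (simp add: powr_mult ennreal_mult)
  finally show ?thesis by (simp add: Lq_le_def)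
qed

lemma Lq_le_diff:
  assumes f: "Lq_le q f A" and g: "Lq_le q g B" and "0 \<le> A" "0 \<le> B" "1 \<le> q"
  shows "Lq_le q (\<lambda>x. f x - g x) (A + B)"
  using Lq_le_add[OF f Lq_le_cmult[OF g, of "-1"]] assms by simp

text \<open>Minkowski's integral inequality over the counting measure. It takes the place of
  completeness of L^q: the series of increments of the Picard iteration converges almost everywhere,
  and its tails are controlled in norm.\<close>

lemma Lq_le_suminf:
  assumes d: "\<And>k. Lq_le q (d k) (a k)" and a: "\<And>k. 0 \<le> a k" "summable a" and q: "1 \<le> q"
  shows "AE x in lborel. summable (\<lambda>k. \<bar>d k x\<bar>)"
    and "Lq_le q (\<lambda>x. \<Sum>k. \<bar>d k x\<bar>) (suminf a)"
proof -
  note [measurable] = Lq_le_measurable[OF d]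
  have *: "sigma_finite_measure (count_space (UNIV :: nat set))"
     "(\<lambda>(m, x). d m x) \<in> borel_measurable (count_space UNIV \<Otimes>\<^sub>M borel)"
     "0 \<le> suminf a" "(\<integral>\<^sup>+m. ennreal (a m) \<partial>count_space UNIV) \<le> ennreal (suminf a)"
     "AE m in count_space UNIV. (\<integral>\<^sup>+x. ennreal (\<bar>d m x\<bar> powr q) \<partial>lborel) \<le> ennreal (a m powr q)"
    using a d suminf_ennreal_eq[OF a(1) summable_sums[OF a(2)]]
    by (auto simp: sigma_finite_measure_count_space Lq_le_def nn_integral_count_space_nat suminf_nonneg)
  have ae: "AE x in lborel. integrable (count_space UNIV) (\<lambda>m. d m x)"
    by (rule minkowski_integral(1)[where \<kappa> = a, OF *(1) q *(2) _ a(1) *(3-5)]) auto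
  then show "AE x in lborel. summable (\<lambda>k. \<bar>d k x\<bar>)"
    by (simp add: integrable_count_space_nat_iff)
  have "Lq_le q (\<lambda>x. LINT m|count_space UNIV. \<bar>d m x\<bar>) (suminf a)"
    by (rule minkowski_integral(2)[where \<kappa> = a, OF *(1) q *(2) _ a(1) *(3-5)]) auto
  moreover have "(\<lambda>x. \<Sum>k. \<bar>d k x\<bar>) \<in> borel_measurable borel" by measurable
  moreover have "AE x in lborel. (\<Sum>k. \<bar>d k x\<bar>) = (LINT m|count_space UNIV. \<bar>d m x\<bar>)"
    using ae by eventually_elim (rule integral_count_space_nat[symmetric], simp)
  ultimately show "Lq_le q (\<lambda>x. \<Sum>k. \<bar>d k x\<bar>) (suminf a)"
    by (rule Lq_le_cong) (use q in auto)
qed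

section \<open>Singular integrals in time\<close>

lemma nn_integral_powr_left:
  assumes "b < 1" "0 \<le> t"
  shows "(\<integral>\<^sup>+s. ennreal (s powr (- b)) * indicator {0<..<t} s \<partial>lborel) \<le> ennreal (t powr (1 - b) / (1 - b))"
proof -
  have "((\<lambda>s. s powr (- b)) has_integral (t powr (- b + 1) / (- b + 1))) {0..t}"
    using assms by (intro has_integral_powr_from_0) auto
  then have "(\<integral>\<^sup>+s. ennreal (s powr (- b)) * indicator {0..t} s \<partial>lborel) = ennreal (t powr (- b + 1) / (- b + 1))"
    by (intro nn_integral_has_integral_lebesgue') auto
  moreover have "(\<integral>\<^sup>+s. ennreal (s powr (- b)) * indicator {0<..<t} s \<partial>lborel)
      \<le> (\<integral>\<^sup>+s. ennreal (s powr (- b)) * indicator {0..t} s \<partial>lborel)"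
    by (intro nn_integral_mono) (auto simp: indicator_def)
  ultimately show ?thesis by (simp add: add.commute)
qed

lemma nn_integral_powr_right:
  assumes "a < 1" "c \<le> t"
  shows "(\<integral>\<^sup>+s. ennreal ((t - s) powr (- a)) * indicator {c<..<t} s \<partial>lborel) \<le> ennreal ((t - c) powr (1 - a) / (1 - a))"
proof -
  have "(\<integral>\<^sup>+s. ennreal ((t - s) powr (- a)) * indicator {c<..<t} s \<partial>lborel)
     = (\<integral>\<^sup>+s. ennreal ((t - (t + (-1) * s)) powr (- a)) * indicator {c<..<t} (t + (-1) * s) \<partial>lborel)"
    by (subst nn_integral_real_affine[where c = "-1" and t = t]) auto
  also have "\<dots> = (\<integral>\<^sup>+s. ennreal (s powr (- a)) * indicator {0<..<t - c} s \<partial>lborel)"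
    by (intro nn_integral_cong) (auto simp: indicator_def)
  also have "\<dots> \<le> ennreal ((t - c) powr (1 - a) / (1 - a))"
    using assms by (intro nn_integral_powr_left) auto
  finally show ?thesis .
qed

text \<open>An upper bound for Euler's beta integral with parameters 1-a and 1-b; only its
  finiteness and the power of t beside it matter.\<close>

definition beta_bound :: "real \<Rightarrow> real \<Rightarrow> real" where
  "beta_bound a b = 2 powr a / (1 - b) + 2 powr b / (1 - a)"

lemma beta_bound_pos: "a < 1 \<Longrightarrow> b < 1 \<Longrightarrow> 0 < beta_bound a b"
  by (simp add: beta_bound_def add_pos_pos)

text \<open>On each half of (0,t) one factor is at most its value at t/2, and the other one is
  integrated over the whole interval.\<close>

lemma nn_integral_beta_bound:
  assumes ab: "0 \<le> a" "a < 1" "0 \<le> b" "b < 1" and t: "0 < t"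
  shows "(\<integral>\<^sup>+s. ennreal ((t - s) powr (- a) * s powr (- b)) * indicator {0<..<t} s \<partial>lborel)
    \<le> ennreal (beta_bound a b * t powr (1 - a - b))"
proof -
  have "(\<integral>\<^sup>+s. ennreal ((t - s) powr (- a) * s powr (- b)) * indicator {0<..<t} s \<partial>lborel)
    \<le> (\<integral>\<^sup>+s. ennreal ((t/2) powr (-a)) * (ennreal (s powr (- b)) * indicator {0<..<t} s)
       + ennreal ((t/2) powr (-b)) * (ennreal ((t - s) powr (- a)) * indicator {0<..<t} s) \<partial>lborel)"
  proof (intro nn_integral_mono)
    fix s :: real
    show "ennreal ((t - s) powr (- a) * s powr (- b)) * indicator {0<..<t} s
      \<le> ennreal ((t/2) powr (-a)) * (ennreal (s powr (- b)) * indicator {0<..<t} s)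
       + ennreal ((t/2) powr (-b)) * (ennreal ((t - s) powr (- a)) * indicator {0<..<t} s)"
    proof (cases "0 < s \<and> s < t")
      case True
      have "(t - s) powr (- a) * s powr (- b) \<le> (t/2) powr (-a) * s powr (-b) + (t/2) powr (-b) * (t - s) powr (- a)"
      proof (cases "s \<le> t / 2")
        case True
        then have "(t - s) powr (- a) \<le> (t/2) powr (-a)" using t ab by (intro powr_mono2') auto
        then have "(t - s) powr (- a) * s powr (- b) \<le> (t/2) powr (-a) * s powr (- b)"
          by (intro mult_right_mono) auto
        then show ?thesis by (intro add_increasing2) auto
      next
        case False
        then have "s powr (- b) \<le> (t/2) powr (-b)" using t ab by (intro powr_mono2') auto
        then have "s powr (- b) * (t - s) powr (- a) \<le> (t/2) powr (-b) * (t - s) powr (- a)"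
          by (intro mult_right_mono) auto
        then show ?thesis by (intro add_increasing) (auto simp: mult.commute)
      qed
      then show ?thesis using True by (auto intro!: ennreal_le_comb)
    qed auto
  qed
  also have "\<dots> = ennreal ((t/2) powr (-a)) * (\<integral>\<^sup>+s. ennreal (s powr (- b)) * indicator {0<..<t} s \<partial>lborel)
       + ennreal ((t/2) powr (-b)) * (\<integral>\<^sup>+s. ennreal ((t - s) powr (- a)) * indicator {0<..<t} s \<partial>lborel)"
    by (subst nn_integral_add) (auto simp: nn_integral_cmult)
  also have "\<dots> \<le> ennreal ((t/2) powr (-a)) * ennreal (t powr (1 - b) / (1 - b))
       + ennreal ((t/2) powr (-b)) * ennreal ((t - 0) powr (1 - a) / (1 - a))"
    using ab t by (intro add_mono mult_left_mono nn_integral_powr_left nn_integral_powr_right) auto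
  also have "\<dots> = ennreal ((t/2) powr (-a) * (t powr (1 - b) / (1 - b)) + (t/2) powr (-b) * (t powr (1 - a) / (1 - a)))"
    using ab by (simp add: ennreal_mult[symmetric] ennreal_plus[symmetric] del: ennreal_plus)
  also have "(t/2) powr (-a) * (t powr (1 - b) / (1 - b)) + (t/2) powr (-b) * (t powr (1 - a) / (1 - a))
     = beta_bound a b * t powr (1 - a - b)"
  proof -
    have "(t/2) powr (-a) * t powr (1 - b) = 2 powr a * t powr (1 - a - b)"
      using t by (simp add: powr_divide powr_minus powr_diff powr_add field_simps)
    moreover have "(t/2) powr (-b) * t powr (1 - a) = 2 powr b * t powr (1 - a - b)"
      using t by (simp add: powr_divide powr_minus powr_diff powr_add field_simps)
    ultimately show ?thesis by (simp add: beta_bound_def algebra_simps)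
  qed
  finally show ?thesis .
qed

subsection \<open>Schwartz functions and tempered distributions\<close>

lemma partials_Nil [simp]: "partials [] f = f"
  by (simp add: partials_def)

lemma partials_Cons: "partials (i # is) f = dir_deriv (axis i 1) (partials is f)"
  by (simp add: partials_def)

lemma dir_deriv_eq: "(f has_derivative f') (at x) \<Longrightarrow> dir_deriv a f x = f' a"
  unfolding dir_deriv_def using frechet_derivative_at by metis

lemma linear_sum_axis:
  assumes "linear (f :: real ^ 'n \<Rightarrow> real)"
  shows "f h = (\<Sum>i\<in>UNIV. h $ i * f (axis i 1))"
proof -
  have "f h = f (\<Sum>i\<in>UNIV. h $ i *\<^sub>R axis i 1)"
    by (subst (1) basis_expansion[of h, symmetric]) (simp add: scalar_mult_eq_scaleR)
  also have "\<dots> = (\<Sum>i\<in>UNIV. h $ i * f (axis i 1))"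
    using assms by (simp add: linear_sum linear_cmul)
  finally show ?thesis .
qed

lemma bounded_linear_sum_coord: "bounded_linear (\<lambda>h :: real ^ 'n. \<Sum>i\<in>UNIV. h $ i * c i)"
  by (intro bounded_linear_sum bounded_linear_mult_const bounded_linear_vec_nth)

lemma abs_sum_coord_le: "\<bar>\<Sum>i\<in>UNIV. (h :: real ^ 'n) $ i * c i\<bar> \<le> norm h * (\<Sum>i\<in>UNIV. \<bar>c i\<bar>)"
proof -
  have "\<bar>\<Sum>i\<in>UNIV. h $ i * c i\<bar> \<le> (\<Sum>i\<in>UNIV. \<bar>h $ i * c i\<bar>)" by (rule sum_abs)
  also have "\<dots> \<le> (\<Sum>i\<in>UNIV. norm h * \<bar>c i\<bar>)"
    by (intro sum_mono) (simp add: abs_mult mult_right_mono component_le_norm_cart)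
  finally show ?thesis by (simp add: sum_distrib_left)
qed

lemma has_derivative_sum_partials:
  assumes "partials is \<phi> differentiable (at x)"
  shows "(partials is \<phi> has_derivative (\<lambda>h. \<Sum>i\<in>UNIV. h $ i * partials (i # is) \<phi> x)) (at x)"
proof -
  obtain f' where f': "(partials is \<phi> has_derivative f') (at x)"
    using assms by (auto simp: differentiable_def)
  have "f' = (\<lambda>h. \<Sum>i\<in>UNIV. h $ i * partials (i # is) \<phi> x)"
    by (rule ext, subst linear_sum_axis)
      (auto simp: partials_Cons dir_deriv_eq[OF f'] has_derivative_linear[OF f'])
  then show ?thesis using f' by simp
qed

text \<open>A family of functions indexed by lists of coordinates and closed under differentiation
  is the family of iterated partial derivatives, by induction on the list. Exhibiting such a family
  is how sums, multiples, translates and convolutions are shown to be Schwartz functions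
  (\<open>schwartzI\<close>).\<close>

lemma partials_eqI:
  fixes D :: "'n list \<Rightarrow> real ^ 'n \<Rightarrow> real"
  assumes "D [] = f"
    and d: "\<And>is x. (D is has_derivative (\<lambda>h. \<Sum>i\<in>UNIV. h $ i * D (i # is) x)) (at x)"
  shows "partials is f = D is"
proof (induction "is")
  case Nil
  then show ?case using assms by simp
next
  case (Cons j "is")
  show ?case
  proof
    fix x
    have "partials (j # is) f x = dir_deriv (axis j 1) (D is) x" by (simp add: partials_Cons Cons)
    also have "\<dots> = (\<Sum>i\<in>UNIV. axis j 1 $ i * D (i # is) x)"
      by (rule dir_deriv_eq[OF d])
    also have "\<dots> = D (j # is) x" by (simp add: axis_def if_distrib[of "\<lambda>x. x * _"] cong: if_cong)
    finally show "partials (j # is) f x = D (j # is) x" .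
  qed
qed

lemma schwartz_differentiable: "\<phi> \<in> schwartz \<Longrightarrow> partials is \<phi> differentiable (at x)"
  by (simp add: schwartz_def)

lemma schwartz_has_derivative:
  "\<phi> \<in> schwartz \<Longrightarrow> (partials is \<phi> has_derivative (\<lambda>h. \<Sum>i\<in>UNIV. h $ i * partials (i # is) \<phi> x)) (at x)"
  by (intro has_derivative_sum_partials schwartz_differentiable)

lemma schwartz_bound:
  assumes "\<phi> \<in> schwartz"
  obtains C where "0 \<le> C" "\<And>x. (1 + norm x) ^ k * \<bar>partials is \<phi> x\<bar> \<le> C"
proof -
  have "bounded (range (\<lambda>x. (1 + norm x) ^ k * partials is \<phi> x))" using assms by (simp add: schwartz_def)
  then obtain C where C: "\<And>x. \<bar>(1 + norm x) ^ k * partials is \<phi> x\<bar> \<le> C"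
    by (auto simp: bounded_iff)
  then have "(1 + norm x) ^ k * \<bar>partials is \<phi> x\<bar> \<le> C" for x
    using C[of x] by (simp add: abs_mult)
  moreover have "0 \<le> C" using C[of 0] by (meson abs_ge_zero order_trans)
  ultimately show ?thesis using that by blast
qed

lemma schwartzI:
  fixes D :: "'n list \<Rightarrow> real ^ 'n \<Rightarrow> real"
  assumes D: "D [] = f"
    and d: "\<And>is x. (D is has_derivative (\<lambda>h. \<Sum>i\<in>UNIV. h $ i * D (i # is) x)) (at x)"
    and b: "\<And>is k. \<exists>C. \<forall>x. (1 + norm x) ^ k * \<bar>D is x\<bar> \<le> C"
  shows "f \<in> schwartz" and "partials is f = D is"
proof -
  have eq: "partials is f = D is" for "is" by (rule partials_eqI[OF D d])
  show "partials is f = D is" by fact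
  have "bounded (range (\<lambda>x. (1 + norm x) ^ k * D is x))" for "is" k
    using b[of k "is"] by (auto simp: bounded_iff abs_mult)
  then show "f \<in> schwartz"
    unfolding schwartz_def mem_Collect_eq eq using d unfolding differentiable_def by blast
qed

lemma partials_zero: "partials is (\<lambda>x. 0) = (\<lambda>x. 0)"
  by (rule partials_eqI[where D = "\<lambda>_ _. 0"]) auto

lemma schwartz_add:
  assumes "\<phi> \<in> schwartz" "\<psi> \<in> schwartz"
  shows "(\<lambda>x. \<phi> x + \<psi> x) \<in> schwartz"
    and "partials is (\<lambda>x. \<phi> x + \<psi> x) = (\<lambda>x. partials is \<phi> x + partials is \<psi> x)"
proof -
  have d: "((\<lambda>x. partials is \<phi> x + partials is \<psi> x) has_derivative
      (\<lambda>h. \<Sum>i\<in>UNIV. h $ i * (partials (i # is) \<phi> x + partials (i # is) \<psi> x))) (at x)" for "is" x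
    using has_derivative_add[OF schwartz_has_derivative[OF assms(1)] schwartz_has_derivative[OF assms(2)]]
    by (simp add: sum.distrib[symmetric] distrib_left)
  have b: "\<exists>C. \<forall>x. (1 + norm x) ^ k * \<bar>partials is \<phi> x + partials is \<psi> x\<bar> \<le> C" for "is" k
  proof -
    obtain C where C: "\<And>x. (1 + norm x) ^ k * \<bar>partials is \<phi> x\<bar> \<le> C" using schwartz_bound[OF assms(1)] by blast
    obtain C' where C': "\<And>x. (1 + norm x) ^ k * \<bar>partials is \<psi> x\<bar> \<le> C'" using schwartz_bound[OF assms(2)] by blast
    have "(1 + norm x) ^ k * \<bar>partials is \<phi> x + partials is \<psi> x\<bar> \<le> C + C'" for x
    proof -
      have "(1 + norm x) ^ k * \<bar>partials is \<phi> x + partials is \<psi> x\<bar>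
         \<le> (1 + norm x) ^ k * (\<bar>partials is \<phi> x\<bar> + \<bar>partials is \<psi> x\<bar>)"
        by (intro mult_left_mono abs_triangle_ineq) auto
      then show ?thesis using C[of x] C'[of x] by (simp add: distrib_left)
    qed
    then show ?thesis by blast
  qed
  show "(\<lambda>x. \<phi> x + \<psi> x) \<in> schwartz"
    "partials is (\<lambda>x. \<phi> x + \<psi> x) = (\<lambda>x. partials is \<phi> x + partials is \<psi> x)"
    by (rule schwartzI[where D = "\<lambda>is x. partials is \<phi> x + partials is \<psi> x", OF _ d b]; simp)+
qed

lemma schwartz_cmult:
  assumes "\<phi> \<in> schwartz"
  shows "(\<lambda>x. c * \<phi> x) \<in> schwartz"
    and "partials is (\<lambda>x. c * \<phi> x) = (\<lambda>x. c * partials is \<phi> x)"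
proof -
  have d: "((\<lambda>x. c * partials is \<phi> x) has_derivative (\<lambda>h. \<Sum>i\<in>UNIV. h $ i * (c * partials (i # is) \<phi> x))) (at x)" for "is" x
    using has_derivative_mult_right[OF schwartz_has_derivative[OF assms], of c]
    by (simp add: sum_distrib_left mult.left_commute)
  have b: "\<exists>C. \<forall>x. (1 + norm x) ^ k * \<bar>c * partials is \<phi> x\<bar> \<le> C" for "is" k
  proof -
    obtain C where C: "\<And>x. (1 + norm x) ^ k * \<bar>partials is \<phi> x\<bar> \<le> C" using schwartz_bound[OF assms(1)] by blast
    then have "\<bar>c\<bar> * ((1 + norm x) ^ k * \<bar>partials is \<phi> x\<bar>) \<le> \<bar>c\<bar> * C" for x
      by (intro mult_left_mono) auto
    then show ?thesis by (auto simp: abs_mult mult.left_commute)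
  qed
  show "(\<lambda>x. c * \<phi> x) \<in> schwartz" "partials is (\<lambda>x. c * \<phi> x) = (\<lambda>x. c * partials is \<phi> x)"
    by (rule schwartzI[where D = "\<lambda>is x. c * partials is \<phi> x", OF _ d b]; simp)+
qed

lemma schwartz_diff:
  assumes "\<phi> \<in> schwartz" "\<psi> \<in> schwartz"
  shows "(\<lambda>x. \<phi> x - \<psi> x) \<in> schwartz"
    and "partials is (\<lambda>x. \<phi> x - \<psi> x) = (\<lambda>x. partials is \<phi> x - partials is \<psi> x)"
  using schwartz_add[OF assms(1) schwartz_cmult(1)[OF assms(2), of "-1"]] schwartz_cmult(2)[OF assms(2), where c = "-1"]
  by simp_all

lemma schwartz_zero: "(\<lambda>x. 0) \<in> schwartz"
  by (rule schwartzI(1)[where D = "\<lambda>_ _. 0"]) auto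

lemma schwartz_sum:
  assumes "finite A" "\<And>v. v \<in> A \<Longrightarrow> \<psi> v \<in> schwartz"
  shows "(\<lambda>x. \<Sum>v\<in>A. c v * \<psi> v x) \<in> schwartz \<and>
     partials is (\<lambda>x. \<Sum>v\<in>A. c v * \<psi> v x) = (\<lambda>x. \<Sum>v\<in>A. c v * partials is (\<psi> v) x)"
  using assms
proof (induction A)
  case empty
  then show ?case by (simp add: schwartz_zero partials_zero)
next
  case (insert v A)
  have v: "(\<lambda>x. c v * \<psi> v x) \<in> schwartz" "partials is (\<lambda>x. c v * \<psi> v x) = (\<lambda>x. c v * partials is (\<psi> v) x)"
    using insert.prems by (auto intro: schwartz_cmult)
  have A: "(\<lambda>x. \<Sum>v\<in>A. c v * \<psi> v x) \<in> schwartz"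
     "partials is (\<lambda>x. \<Sum>v\<in>A. c v * \<psi> v x) = (\<lambda>x. \<Sum>v\<in>A. c v * partials is (\<psi> v) x)"
    using insert by auto
  show ?case using schwartz_add(1)[OF v(1) A(1)] schwartz_add(2)[OF v(1) A(1), of "is"] v(2) A(2) insert.hyps by simp
qed

section \<open>Weighted estimates for translates\<close>

lemma one_plus_norm_diff_le: "1 + norm z \<le> (1 + norm (z - y)) * (1 + norm y)"
proof -
  have "0 \<le> norm y * norm (z - y)" by (intro mult_nonneg_nonneg norm_ge_zero)
  moreover have "norm z \<le> norm (z - y) + norm y" using norm_triangle_sub[of z y] by simp
  ultimately have "1 + norm z \<le> 1 + (norm (z - y) + norm y) + norm y * norm (z - y)" by linarith
  also have "\<dots> = (1 + norm (z - y)) * (1 + norm y)" by (simp add: ring_distribs mult.commute)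
  finally show ?thesis .
qed

text \<open>Peetre's inequality: a polynomial weight moves from z to z-y at the price of the same
  weight at y.\<close>

lemma one_plus_norm_diff_power_le:
  "(1 + norm z) ^ N \<le> (1 + norm (z - y)) ^ N * (1 + norm y) ^ N"
  using power_mono[OF one_plus_norm_diff_le, of z N y] by (simp add: power_mult_distrib)

lemma schwartz_translate:
  assumes "\<phi> \<in> schwartz"
  shows "(\<lambda>x. \<phi> (x - c)) \<in> schwartz"
    and "partials is (\<lambda>x. \<phi> (x - c)) = (\<lambda>x. partials is \<phi> (x - c))"
proof -
  have d: "((\<lambda>x. partials is \<phi> (x - c)) has_derivative (\<lambda>h. \<Sum>i\<in>UNIV. h $ i * partials (i # is) \<phi> (x - c))) (at x)" for "is" x
  proof -
    have "((\<lambda>x. x - c) has_derivative (\<lambda>h. h)) (at x)" by (auto intro!: derivative_eq_intros)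
    from has_derivative_compose[OF this schwartz_has_derivative[OF assms, of "is"]] show ?thesis by simp
  qed
  have b: "\<exists>C. \<forall>x. (1 + norm x) ^ k * \<bar>partials is \<phi> (x - c)\<bar> \<le> C" for "is" k
  proof -
    obtain C where C: "\<And>x. (1 + norm x) ^ k * \<bar>partials is \<phi> x\<bar> \<le> C" using schwartz_bound[OF assms(1)] by blast
    have "(1 + norm x) ^ k * \<bar>partials is \<phi> (x - c)\<bar> \<le> (1 + norm c) ^ k * C" for x
    proof -
      have "(1 + norm x) ^ k * \<bar>partials is \<phi> (x - c)\<bar> \<le> ((1 + norm (x - c)) ^ k * (1 + norm c) ^ k) * \<bar>partials is \<phi> (x - c)\<bar>"
        by (intro mult_right_mono one_plus_norm_diff_power_le) auto
      also have "\<dots> = (1 + norm c) ^ k * ((1 + norm (x - c)) ^ k * \<bar>partials is \<phi> (x - c)\<bar>)" by simp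
      also have "\<dots> \<le> (1 + norm c) ^ k * C" by (intro mult_left_mono C) auto
      finally show ?thesis .
    qed
    then show ?thesis by blast
  qed
  show "(\<lambda>x. \<phi> (x - c)) \<in> schwartz" "partials is (\<lambda>x. \<phi> (x - c)) = (\<lambda>x. partials is \<phi> (x - c))"
    by (rule schwartzI[where D = "\<lambda>is x. partials is \<phi> (x - c)", OF _ d b]; simp)+
qed

lemma schwartz_continuous: "\<phi> \<in> schwartz \<Longrightarrow> continuous_on UNIV (partials is \<phi>)"
  by (intro differentiable_imp_continuous_on) (simp add: differentiable_on_def schwartz_differentiable)

lemma schwartz_measurable: "\<phi> \<in> schwartz \<Longrightarrow> partials is \<phi> \<in> borel_measurable borel"
  by (intro borel_measurable_continuous_onI schwartz_continuous)

lemma schwartz_measurable0: "\<phi> \<in> schwartz \<Longrightarrow> \<phi> \<in> borel_measurable borel"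
  using schwartz_measurable[of \<phi> "[]"] by simp

text \<open>Continuity of translation in the Schwartz seminorms, with polynomial growth in the
  translation vectors. The mean value inequality is used on the segment from z-v to z-y; a point p
  of it satisfies |z-p| \<le> |y| + |v|, so Peetre's inequality turns decay at p into decay at
  z.\<close>

lemma schwartz_weighted_lipschitz:
  fixes \<phi> :: "real ^ 'n \<Rightarrow> real" and "is" :: "'n list"
  assumes "\<phi> \<in> schwartz"
  obtains C where "0 \<le> C"
    "\<And>z y v. (1 + norm z) ^ N * \<bar>partials is \<phi> (z - v) - partials is \<phi> (z - y)\<bar>
        \<le> C * (1 + norm y + norm v) ^ N * norm (v - y)"
proof -
  have "\<exists>C. \<forall>i. 0 \<le> C i \<and> (\<forall>x. (1 + norm x) ^ N * \<bar>partials (i # is) \<phi> x\<bar> \<le> C i)"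
    using schwartz_bound[OF assms] by (intro choice) metis
  then obtain C where C0: "\<And>i. 0 \<le> C i" and C: "\<And>i x. (1 + norm x) ^ N * \<bar>partials (i # is) \<phi> x\<bar> \<le> C i" by auto
  define S where "S = (\<Sum>i\<in>UNIV. C i)"
  have S: "S \<ge> 0" using C0 by (simp add: S_def sum_nonneg)
  have "(1 + norm z) ^ N * \<bar>partials is \<phi> (z - v) - partials is \<phi> (z - y)\<bar>
        \<le> S * (1 + norm y + norm v) ^ N * norm (v - y)" for z y v
  proof -
    define B where "B = S * (1 + norm y + norm v) ^ N / (1 + norm z) ^ N"
    have pz: "0 < (1 + norm z) ^ N" by (simp add: add_pos_nonneg)
    have "norm (partials is \<phi> (z - v) - partials is \<phi> (z - y)) \<le> B * norm ((z - v) - (z - y))"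
    proof (rule differentiable_bound[where S = "closed_segment (z - v) (z - y)"])
      fix p assume p: "p \<in> closed_segment (z - v) (z - y)"
      show "(partials is \<phi> has_derivative (\<lambda>h. \<Sum>i\<in>UNIV. h $ i * partials (i # is) \<phi> p)) (at p within closed_segment (z - v) (z - y))"
        by (rule has_derivative_at_withinI[OF schwartz_has_derivative[OF assms]])
      show "onorm (\<lambda>h. \<Sum>i\<in>UNIV. h $ i * partials (i # is) \<phi> p) \<le> B"
      proof (rule onorm_bound)
        obtain u where u: "0 \<le> u" "u \<le> 1" "p = (1 - u) *\<^sub>R (z - v) + u *\<^sub>R (z - y)"
          using p by (auto simp: in_segment)
        have zp: "z - p = (1 - u) *\<^sub>R v + u *\<^sub>R y" by (simp add: u(3) algebra_simps)
        have "norm (z - p) \<le> (1 - u) * norm v + u * norm y"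
          unfolding zp using u norm_triangle_ineq[of "(1 - u) *\<^sub>R v" "u *\<^sub>R y"] by simp
        also have "\<dots> \<le> 1 * norm v + 1 * norm y" using u by (intro add_mono mult_right_mono) auto
        finally have np: "1 + norm (z - p) \<le> 1 + norm y + norm v" by simp
        have le: "\<bar>partials (i # is) \<phi> p\<bar> \<le> C i * ((1 + norm y + norm v) ^ N / (1 + norm z) ^ N)" for i
        proof -
          have "(1 + norm z) ^ N * \<bar>partials (i # is) \<phi> p\<bar>
              \<le> ((1 + norm (z - (z - p))) ^ N * (1 + norm (z - p)) ^ N) * \<bar>partials (i # is) \<phi> p\<bar>"
            by (intro mult_right_mono one_plus_norm_diff_power_le) auto
          also have "\<dots> = ((1 + norm p) ^ N * \<bar>partials (i # is) \<phi> p\<bar>) * (1 + norm (z - p)) ^ N" by simp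
          also have "\<dots> \<le> C i * (1 + norm y + norm v) ^ N"
            using np C0 by (intro mult_mono C power_mono) auto
          finally show ?thesis using pz by (simp add: field_simps)
        qed
        show "0 \<le> B" using S by (simp add: B_def)
        fix h :: "real ^ 'n"
        have "norm (\<Sum>i\<in>UNIV. h $ i * partials (i # is) \<phi> p) \<le> norm h * (\<Sum>i\<in>UNIV. \<bar>partials (i # is) \<phi> p\<bar>)"
          using abs_sum_coord_le by simp
        also have "\<dots> \<le> norm h * (\<Sum>i\<in>UNIV. C i * ((1 + norm y + norm v) ^ N / (1 + norm z) ^ N))"
          by (intro mult_left_mono sum_mono le) auto
        also have "\<dots> = B * norm h" unfolding B_def S_def by (subst sum_distrib_right[symmetric]) simp
        finally show "norm (\<Sum>i\<in>UNIV. h $ i * partials (i # is) \<phi> p) \<le> B * norm h" .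
      qed
    qed auto
    then have "\<bar>partials is \<phi> (z - v) - partials is \<phi> (z - y)\<bar> \<le> B * norm (v - y)"
      by (simp add: norm_minus_commute)
    then show ?thesis using pz by (simp add: B_def field_simps)
  qed
  with S that show ?thesis by blast
qed

lemma schwartz_weighted_lipschitz_all:
  assumes "\<phi> \<in> schwartz"
  obtains B where "\<And>is. 0 \<le> B is"
    "\<And>is z y v. (1 + norm z) ^ N * \<bar>partials is \<phi> (z - v) - partials is \<phi> (z - y)\<bar>
        \<le> B is * (1 + norm y + norm v) ^ N * norm (v - y)"
proof -
  have "\<exists>B. \<forall>is. 0 \<le> B is \<and> (\<forall>z y v. (1 + norm z) ^ N * \<bar>partials is \<phi> (z - v) - partials is \<phi> (z - y)\<bar>
        \<le> B is * (1 + norm y + norm v) ^ N * norm (v - y))"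
    using schwartz_weighted_lipschitz[OF assms] by (intro choice) metis
  with that show ?thesis by blast
qed

lemma schwartz_lipschitz:
  assumes "\<phi> \<in> schwartz"
  obtains C where "0 \<le> C" "\<And>x y. \<bar>partials is \<phi> x - partials is \<phi> y\<bar> \<le> C * norm (x - y)"
proof -
  obtain C where C: "0 \<le> C"
    "\<And>z y v. (1 + norm z) ^ 0 * \<bar>partials is \<phi> (z - v) - partials is \<phi> (z - y)\<bar>
        \<le> C * (1 + norm y + norm v) ^ 0 * norm (v - y)"
    using schwartz_weighted_lipschitz[OF assms] by blast
  have "\<bar>partials is \<phi> x - partials is \<phi> y\<bar> \<le> C * norm (x - y)" for x y
    using C(2)[of 0 "- x" "- y"] by (simp add: norm_minus_commute)
  with C that show ?thesis by blast
qed

text \<open>The derivative is Lipschitz, so the first-order remainder is quadratic uniformly in x.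
  That uniformity replaces dominated convergence when one differentiates under an integral.\<close>

lemma schwartz_quadratic_remainder:
  fixes \<phi> :: "real ^ 'n \<Rightarrow> real" and "is" :: "'n list"
  assumes "\<phi> \<in> schwartz"
  obtains C where "0 \<le> C"
    "\<And>x h. \<bar>partials is \<phi> (x + h) - partials is \<phi> x - (\<Sum>i\<in>UNIV. h $ i * partials (i # is) \<phi> x)\<bar>
        \<le> C * (norm h)\<^sup>2"
proof -
  have "\<exists>C. \<forall>i. 0 \<le> C i \<and> (\<forall>x y. \<bar>partials (i # is) \<phi> x - partials (i # is) \<phi> y\<bar> \<le> C i * norm (x - y))"
    using schwartz_lipschitz[OF assms] by (intro choice) metis
  then obtain C where C0: "\<And>i. 0 \<le> C i"
    and C: "\<And>i x y. \<bar>partials (i # is) \<phi> x - partials (i # is) \<phi> y\<bar> \<le> C i * norm (x - y)" by auto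
  define S where "S = (\<Sum>i\<in>UNIV. C i)"
  have S: "S \<ge> 0" using C0 by (simp add: S_def sum_nonneg)
  have "\<bar>partials is \<phi> (x + h) - partials is \<phi> x - (\<Sum>i\<in>UNIV. h $ i * partials (i # is) \<phi> x)\<bar>
        \<le> S * (norm h)\<^sup>2" for x h
  proof -
    have "norm (partials is \<phi> (x + h) - partials is \<phi> x - (\<Sum>i\<in>UNIV. (x + h - x) $ i * partials (i # is) \<phi> x))
       \<le> norm (x + h - x) * (S * norm h)"
    proof (rule differentiable_bound_linearization[where S = "closed_segment x (x + h)"])
      fix t :: real assume "t \<in> {0..1}"
      then show "x + t *\<^sub>R (x + h - x) \<in> closed_segment x (x + h)"
        by (auto simp: in_segment algebra_simps intro!: exI[of _ t])
    next
      fix p assume "p \<in> closed_segment x (x + h)"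
      then obtain u where u: "0 \<le> u" "u \<le> 1" "p = (1 - u) *\<^sub>R x + u *\<^sub>R (x + h)" by (auto simp: in_segment)
      have "p - x = u *\<^sub>R h" by (simp add: u(3) algebra_simps)
      then have px: "norm (p - x) \<le> norm h" using u mult_right_mono[of u 1 "norm h"] by simp
      show "(partials is \<phi> has_derivative (\<lambda>h. \<Sum>i\<in>UNIV. h $ i * partials (i # is) \<phi> p)) (at p within closed_segment x (x + h))"
        by (rule has_derivative_at_withinI[OF schwartz_has_derivative[OF assms]])
      show "onorm ((\<lambda>h. \<Sum>i\<in>UNIV. h $ i * partials (i # is) \<phi> p) - (\<lambda>h. \<Sum>i\<in>UNIV. h $ i * partials (i # is) \<phi> x)) \<le> S * norm h"
      proof (rule onorm_bound)
        show "0 \<le> S * norm h" using S by simp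
        fix k :: "real ^ 'n"
        have "((\<lambda>h. \<Sum>i\<in>UNIV. h $ i * partials (i # is) \<phi> p) - (\<lambda>h. \<Sum>i\<in>UNIV. h $ i * partials (i # is) \<phi> x)) k
           = (\<Sum>i\<in>UNIV. k $ i * (partials (i # is) \<phi> p - partials (i # is) \<phi> x))"
          by (simp add: sum_subtractf right_diff_distrib)
        also have "norm \<dots> \<le> norm k * (\<Sum>i\<in>UNIV. \<bar>partials (i # is) \<phi> p - partials (i # is) \<phi> x\<bar>)"
          using abs_sum_coord_le by simp
        also have "\<dots> \<le> norm k * (\<Sum>i\<in>UNIV. C i * norm h)"
          using C0 px by (intro mult_left_mono sum_mono order_trans[OF C]) auto
        finally show "norm (((\<lambda>h. \<Sum>i\<in>UNIV. h $ i * partials (i # is) \<phi> p) - (\<lambda>h. \<Sum>i\<in>UNIV. h $ i * partials (i # is) \<phi> x)) k) \<le> S * norm h * norm k"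
          by (simp add: S_def sum_distrib_right[symmetric] mult.commute)
      qed
    qed auto
    then show ?thesis by (simp add: power2_eq_square mult.commute mult.left_commute)
  qed
  with S that show ?thesis by blast
qed

lemma has_derivative_quadraticI:
  assumes "bounded_linear f'" and q: "\<And>h. norm (f (x + h) - f x - f' h) \<le> C * (norm h)\<^sup>2"
  shows "(f has_derivative f') (at x)"
proof (rule has_derivativeI_sandwich[where e = 1 and H = "\<lambda>y. C * norm (y - x)"])
  fix y assume "y \<noteq> x"
  then show "norm ((f y - f x) - f' (y - x)) / norm (y - x) \<le> C * norm (y - x)"
    using q[of "y - x"] by (simp add: divide_le_eq power2_eq_square mult.assoc)
next
  have "((\<lambda>y. C * norm (y - x)) \<longlongrightarrow> C * norm (x - x)) (at x)" by (intro tendsto_intros)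
  then show "((\<lambda>y. C * norm (y - x)) \<longlongrightarrow> 0) (at x)" by simp
qed (use assms in auto)

section \<open>Convolution with Schwartz functions\<close>

definition conv :: "(real ^ 'n \<Rightarrow> real) \<Rightarrow> (real ^ 'n \<Rightarrow> real) \<Rightarrow> real ^ 'n \<Rightarrow> real" where
  "conv k \<psi> z = (LINT y|lborel. k y * \<psi> (z - y))"

lemma integrable_mult_bounded:
  fixes f g :: "'a \<Rightarrow> real"
  assumes "integrable M f" "g \<in> borel_measurable M" "\<And>x. \<bar>g x\<bar> \<le> C"
  shows "integrable M (\<lambda>x. f x * g x)"
proof (rule Bochner_Integration.integrable_bound[of _ "\<lambda>x. C * f x"])
  show "AE x in M. norm (f x * g x) \<le> norm (C * f x)"
  proof (rule AE_I2)
    fix x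
    have "\<bar>f x\<bar> * \<bar>g x\<bar> \<le> \<bar>f x\<bar> * \<bar>C\<bar>" using assms(3)[of x] by (intro mult_left_mono) auto
    then show "norm (f x * g x) \<le> norm (C * f x)" by (simp add: abs_mult mult.commute)
  qed
qed (use assms in auto)

lemma schwartz_bounded:
  assumes "\<phi> \<in> schwartz"
  obtains C where "0 \<le> C" "\<And>x. \<bar>partials is \<phi> x\<bar> \<le> C"
  using schwartz_bound[OF assms, of 0 "is"] by auto

lemma measurable_partials_shift:
  assumes "\<psi> \<in> schwartz"
  shows "(\<lambda>y. partials is \<psi> (z - y)) \<in> borel_measurable borel"
  by (rule measurable_compose[OF _ schwartz_measurable[OF assms]]) measurable

lemma conv_integrable:
  assumes "integrable lborel k" "\<psi> \<in> schwartz"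
  shows "integrable lborel (\<lambda>y. k y * partials is \<psi> (z - y))"
proof -
  obtain C where C: "\<And>x. \<bar>partials is \<psi> x\<bar> \<le> C" using schwartz_bounded[OF assms(2)] by blast
  show ?thesis using measurable_partials_shift[OF assms(2)]
    by (intro integrable_mult_bounded[OF assms(1), where C = C] C) auto
qed

text \<open>The remainder of \<psi> is at most C |h|^2 at every point, so after integration against
  k it is at most C |h|^2 times the L^1 norm of k.\<close>

lemma conv_has_derivative:
  fixes \<psi> :: "real ^ 'n \<Rightarrow> real" and "is" :: "'n list"
  assumes k: "integrable lborel k" and \<psi>: "\<psi> \<in> schwartz"
  shows "(conv k (partials is \<psi>) has_derivative
    (\<lambda>h. \<Sum>i\<in>UNIV. h $ i * conv k (partials (i # is) \<psi>) z)) (at z)"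
proof -
  obtain C where C: "0 \<le> C"
    "\<And>x h. \<bar>partials is \<psi> (x + h) - partials is \<psi> x - (\<Sum>i\<in>UNIV. h $ i * partials (i # is) \<psi> x)\<bar>
        \<le> C * (norm h)\<^sup>2" using schwartz_quadratic_remainder[OF \<psi>] by blast
  note int = conv_integrable[OF k \<psi>]
  show ?thesis
  proof (rule has_derivative_quadraticI[where C = "C * (LINT y|lborel. \<bar>k y\<bar>)"])
    fix h :: "real ^ 'n"
    let ?R = "\<lambda>y. partials is \<psi> (z - y + h) - partials is \<psi> (z - y) - (\<Sum>i\<in>UNIV. h $ i * partials (i # is) \<psi> (z - y))"
    have ih: "integrable lborel (\<lambda>y. k y * partials is \<psi> (z - y + h))"
      using int[of "is" "z + h"] by (simp add: algebra_simps)
    have isum: "integrable lborel (\<lambda>y. \<Sum>i\<in>UNIV. h $ i * (k y * partials (i # is) \<psi> (z - y)))"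
      by (intro Bochner_Integration.integrable_sum integrable_mult_right int)
    have eq: "k y * ?R y = k y * partials is \<psi> (z - y + h) - k y * partials is \<psi> (z - y)
        - (\<Sum>i\<in>UNIV. h $ i * (k y * partials (i # is) \<psi> (z - y)))" for y
      by (simp add: algebra_simps sum_distrib_left)
    have iR: "integrable lborel (\<lambda>y. k y * ?R y)"
      unfolding eq by (intro Bochner_Integration.integrable_diff ih int isum)
    have e: "conv k (partials is \<psi>) (z + h) - conv k (partials is \<psi>) z - (\<Sum>i\<in>UNIV. h $ i * conv k (partials (i # is) \<psi>) z)
       = (LINT y|lborel. k y * ?R y)"
    proof -
      have "(LINT y|lborel. k y * ?R y) = (LINT y|lborel. k y * partials is \<psi> (z - y + h)) - (LINT y|lborel. k y * partials is \<psi> (z - y))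
          - (LINT y|lborel. (\<Sum>i\<in>UNIV. h $ i * (k y * partials (i # is) \<psi> (z - y))))"
        unfolding eq using ih int isum by (simp add: Bochner_Integration.integral_diff)
      also have "(LINT y|lborel. (\<Sum>i\<in>UNIV. h $ i * (k y * partials (i # is) \<psi> (z - y))))
         = (\<Sum>i\<in>UNIV. h $ i * (LINT y|lborel. k y * partials (i # is) \<psi> (z - y)))"
        by (subst Bochner_Integration.integral_sum) (auto intro: integrable_mult_right int)
      finally show ?thesis by (simp add: conv_def algebra_simps)
    qed
    have "\<bar>LINT y|lborel. k y * ?R y\<bar> \<le> (LINT y|lborel. \<bar>k y * ?R y\<bar>)" by (rule integral_abs_bound)
    also have "\<dots> \<le> (LINT y|lborel. (C * (norm h)\<^sup>2) * \<bar>k y\<bar>)"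
    proof (rule integral_mono[OF integrable_abs[OF iR]])
      show "integrable lborel (\<lambda>y. (C * (norm h)\<^sup>2) * \<bar>k y\<bar>)" using k by simp
      fix y
      have "\<bar>k y\<bar> * \<bar>?R y\<bar> \<le> \<bar>k y\<bar> * (C * (norm h)\<^sup>2)" by (rule mult_left_mono[OF C(2) abs_ge_zero])
      also have "\<dots> = (C * (norm h)\<^sup>2) * \<bar>k y\<bar>" by (rule mult.commute)
      finally show "\<bar>k y * ?R y\<bar> \<le> (C * (norm h)\<^sup>2) * \<bar>k y\<bar>" by (simp only: abs_mult)
    qed
    finally show "norm (conv k (partials is \<psi>) (z + h) - conv k (partials is \<psi>) z - (\<Sum>i\<in>UNIV. h $ i * conv k (partials (i # is) \<psi>) z))
        \<le> C * (LINT y|lborel. \<bar>k y\<bar>) * (norm h)\<^sup>2" unfolding e by (simp add: mult_ac)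
  qed (rule bounded_linear_sum_coord)
qed

lemma conv_dir_deriv:
  assumes k: "integrable lborel k" and \<psi>: "\<psi> \<in> schwartz"
  shows "dir_deriv a (conv k \<psi>) z = conv k (dir_deriv a \<psi>) z"
proof -
  have "dir_deriv a (conv k \<psi>) z = (\<Sum>i\<in>UNIV. a $ i * conv k (partials [i] \<psi>) z)"
    using dir_deriv_eq[OF conv_has_derivative[OF k \<psi>, of "[]"]] by simp
  also have "\<dots> = (LINT y|lborel. (\<Sum>i\<in>UNIV. a $ i * (k y * partials [i] \<psi> (z - y))))"
    unfolding conv_def
    by (subst Bochner_Integration.integral_sum) (auto intro: integrable_mult_right conv_integrable[OF k \<psi>])
  also have "\<dots> = conv k (dir_deriv a \<psi>) z"
    unfolding conv_def using dir_deriv_eq[OF schwartz_has_derivative[OF \<psi>, of "[]"]]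
    by (intro Bochner_Integration.integral_cong) (auto simp: sum_distrib_left mult_ac)
  finally show ?thesis .
qed

text \<open>The decay shared by Schwartz functions, heat kernels and bounded functions of compact
  support. It asks for no smoothness.\<close>

definition rapid :: "(real ^ 'n \<Rightarrow> real) \<Rightarrow> bool" where
  "rapid k \<longleftrightarrow> k \<in> borel_measurable borel \<and> (\<forall>N::nat. integrable lborel (\<lambda>y. (1 + norm y) ^ N * k y))"

lemma rapid_integrable: "rapid k \<Longrightarrow> integrable lborel k"
  unfolding rapid_def by (drule conjunct2, drule spec[of _ 0]) simp

lemma conv_weighted_bound:
  assumes k: "integrable lborel (\<lambda>y. (1 + norm y) ^ N * k y)" "k \<in> borel_measurable borel"
    and g: "g \<in> borel_measurable borel" "\<And>x. (1 + norm x) ^ N * \<bar>g x\<bar> \<le> C"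
  shows "(1 + norm z) ^ N * \<bar>conv k g z\<bar> \<le> C * (LINT y|lborel. (1 + norm y) ^ N * \<bar>k y\<bar>)"
proof -
  have le: "(1 + norm z) ^ N * \<bar>k y * g (z - y)\<bar> \<le> C * ((1 + norm y) ^ N * \<bar>k y\<bar>)" for y
  proof -
    have "(1 + norm z) ^ N * \<bar>k y * g (z - y)\<bar> \<le> ((1 + norm (z - y)) ^ N * (1 + norm y) ^ N) * \<bar>k y * g (z - y)\<bar>"
      by (intro mult_right_mono one_plus_norm_diff_power_le) auto
    also have "\<dots> = ((1 + norm (z - y)) ^ N * \<bar>g (z - y)\<bar>) * ((1 + norm y) ^ N * \<bar>k y\<bar>)" by (simp add: abs_mult mult_ac)
    also have "\<dots> \<le> C * ((1 + norm y) ^ N * \<bar>k y\<bar>)" by (intro mult_right_mono g) auto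
    finally show ?thesis .
  qed
  have ik: "integrable lborel (\<lambda>y. (1 + norm y) ^ N * \<bar>k y\<bar>)"
    using integrable_abs[OF k(1)] by (simp add: abs_mult)
  have [measurable]: "k \<in> borel_measurable borel" "g \<in> borel_measurable borel" by fact+
  have "integrable lborel (\<lambda>y. (1 + norm z) ^ N * \<bar>k y * g (z - y)\<bar>)"
    by (rule Bochner_Integration.integrable_bound[OF integrable_mult_right[OF ik, of C]])
      (use le in \<open>auto intro!: order_trans[OF le abs_ge_self]\<close>)
  then have i: "(LINT y|lborel. (1 + norm z) ^ N * \<bar>k y * g (z - y)\<bar>) \<le> (LINT y|lborel. C * ((1 + norm y) ^ N * \<bar>k y\<bar>))"
    using ik by (intro integral_mono le integrable_mult_right) auto
  have "(1 + norm z) ^ N * \<bar>conv k g z\<bar> \<le> (1 + norm z) ^ N * (LINT y|lborel. \<bar>k y * g (z - y)\<bar>)"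
    unfolding conv_def by (intro mult_left_mono integral_abs_bound) auto
  with i show ?thesis by simp
qed

text \<open>All derivatives fall on \<psi>; by Peetre's inequality the weight is shared between
  \<psi> and k, so that decay of k is all that is asked of it.\<close>

lemma conv_schwartz:
  assumes k: "rapid k" and \<psi>: "\<psi> \<in> schwartz"
  shows "conv k \<psi> \<in> schwartz" and "partials is (conv k \<psi>) = conv k (partials is \<psi>)"
proof -
  have b: "\<exists>C. \<forall>x. (1 + norm x) ^ N * \<bar>conv k (partials is \<psi>) x\<bar> \<le> C" for "is" N
  proof -
    obtain C where C: "\<And>x. (1 + norm x) ^ N * \<bar>partials is \<psi> x\<bar> \<le> C" using schwartz_bound[OF \<psi>] by blast
    then show ?thesis using k conv_weighted_bound[of N k "partials is \<psi>" C] schwartz_measurable[OF \<psi>]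
      by (auto simp: rapid_def)
  qed
  show "conv k \<psi> \<in> schwartz" "partials is (conv k \<psi>) = conv k (partials is \<psi>)"
    by (rule schwartzI[where D = "\<lambda>is. conv k (partials is \<psi>)",
          OF _ conv_has_derivative[OF rapid_integrable[OF k] \<psi>] b]; simp)+
qed

text \<open>Replaces the suprema in the seminorm by arbitrary pointwise bounds, so that later
  arguments estimate each derivative separately and never evaluate a supremum. Passing to |C| makes
  the constant nonnegative.\<close>

lemma tempered_bound:
  assumes "tempered T"
  obtains C N where "0 \<le> C"
    "\<And>\<phi> b. \<phi> \<in> schwartz \<Longrightarrow> (\<And>is x. (1 + norm x) ^ N * \<bar>partials is \<phi> x\<bar> \<le> b is) \<Longrightarrow>
       \<bar>T \<phi>\<bar> \<le> C * (\<Sum>is | length is \<le> N. b is)"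
proof -
  obtain C N where C: "\<And>\<phi>. \<phi> \<in> schwartz \<Longrightarrow> \<bar>T \<phi>\<bar> \<le> C * schwartz_seminorm N \<phi>"
    using assms unfolding tempered_def by blast
  show ?thesis
  proof (rule that[of "\<bar>C\<bar>" N])
    fix \<phi> :: "real ^ 'a \<Rightarrow> real" and b
    assume \<phi>: "\<phi> \<in> schwartz" and b: "\<And>is x. (1 + norm x) ^ N * \<bar>partials is \<phi> x\<bar> \<le> b is"
    have sup: "0 \<le> (SUP x. (1 + norm x) ^ N * \<bar>partials is \<phi> x\<bar>)" for "is"
      using b by (intro order_trans[OF _ cSUP_upper[of 0]]) (auto intro!: bdd_aboveI2)
    have s0: "0 \<le> schwartz_seminorm N \<phi>" unfolding schwartz_seminorm_def by (intro sum_nonneg sup)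
    have "schwartz_seminorm N \<phi> \<le> (\<Sum>is | length is \<le> N. b is)"
      unfolding schwartz_seminorm_def using b by (intro sum_mono cSUP_least) auto
    then have "\<bar>C\<bar> * schwartz_seminorm N \<phi> \<le> \<bar>C\<bar> * (\<Sum>is | length is \<le> N. b is)"
      by (intro mult_left_mono) auto
    moreover have "C * schwartz_seminorm N \<phi> \<le> \<bar>C\<bar> * schwartz_seminorm N \<phi>"
      using s0 by (intro mult_right_mono) auto
    ultimately show "\<bar>T \<phi>\<bar> \<le> \<bar>C\<bar> * (\<Sum>is | length is \<le> N. b is)" using C[OF \<phi>] by linarith
  qed auto
qed

lemma tempered_add:
  "tempered T \<Longrightarrow> \<phi> \<in> schwartz \<Longrightarrow> \<psi> \<in> schwartz \<Longrightarrow> T (\<lambda>x. \<phi> x + \<psi> x) = T \<phi> + T \<psi>"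
  by (simp add: tempered_def)

lemma tempered_cmult: "tempered T \<Longrightarrow> \<phi> \<in> schwartz \<Longrightarrow> T (\<lambda>x. c * \<phi> x) = c * T \<phi>"
  by (simp add: tempered_def)

lemma tempered_diff:
  assumes "tempered T" "\<phi> \<in> schwartz" "\<psi> \<in> schwartz"
  shows "T (\<lambda>x. \<phi> x - \<psi> x) = T \<phi> - T \<psi>"
proof -
  have c: "(\<lambda>x. -1 * \<psi> x) \<in> schwartz" by (rule schwartz_cmult[OF assms(3)])
  have "T (\<lambda>x. \<phi> x + -1 * \<psi> x) = T \<phi> + T (\<lambda>x. -1 * \<psi> x)"
    by (rule tempered_add[OF assms(1,2) c])
  also have "T (\<lambda>x. -1 * \<psi> x) = -1 * T \<psi>" by (rule tempered_cmult[OF assms(1,3)])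
  finally show ?thesis by simp
qed

lemma tempered_sum:
  assumes T: "tempered T" and "finite A" "\<And>v. v \<in> A \<Longrightarrow> \<psi> v \<in> schwartz"
  shows "T (\<lambda>x. \<Sum>v\<in>A. c v * \<psi> v x) = (\<Sum>v\<in>A. c v * T (\<psi> v))"
  using assms(2,3)
proof (induction A)
  case empty
  have "T (\<lambda>x. 0 * 0) = 0 * T (\<lambda>x. 0)" by (rule tempered_cmult[OF T schwartz_zero])
  then show ?case by simp
next
  case (insert v A)
  have v: "(\<lambda>x. c v * \<psi> v x) \<in> schwartz" "T (\<lambda>x. c v * \<psi> v x) = c v * T (\<psi> v)"
    using insert.prems T by (auto intro: schwartz_cmult tempered_cmult)
  have "(\<lambda>x. \<Sum>v\<in>A. c v * \<psi> v x) \<in> schwartz" using schwartz_sum[OF insert.hyps(1)] insert.prems by auto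
  then have "T (\<lambda>x. c v * \<psi> v x + (\<Sum>v\<in>A. c v * \<psi> v x)) = T (\<lambda>x. c v * \<psi> v x) + T (\<lambda>x. \<Sum>v\<in>A. c v * \<psi> v x)"
    by (rule tempered_add[OF T v(1)])
  then show ?case using insert v by simp
qed

subsection \<open>The heat kernel\<close>

lemma heat_kernel_nonneg [simp]: "0 \<le> heat_kernel t x"
  by (simp add: heat_kernel_def)

lemma heat_kernel_pos: "0 < t \<Longrightarrow> 0 < heat_kernel t x"
  by (simp add: heat_kernel_def)

lemma heat_kernel_minus [simp]: "heat_kernel t (- x) = heat_kernel t x"
  by (simp add: heat_kernel_def)

lemma heat_kernel_measurable2 [measurable]:
  assumes [measurable]: "f \<in> borel_measurable M" "g \<in> borel_measurable M"
  shows "(\<lambda>p. heat_kernel (f p) (g p :: real ^ 'n)) \<in> borel_measurable M"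
  unfolding heat_kernel_def by measurable

lemma norm_power2_Basis: "(norm (x :: 'a::euclidean_space))\<^sup>2 = (\<Sum>b\<in>Basis. (x \<bullet> b)\<^sup>2)"
  unfolding power2_norm_eq_inner by (subst euclidean_inner) (simp add: power2_eq_square)

text \<open>G is the density of independent normal variables of variance 2t; its unit mass is
  thereby reduced to dimension one.\<close>

lemma heat_kernel_eq_prod:
  fixes x :: "real ^ 'n"
  assumes "0 < t"
  shows "heat_kernel t x = (\<Prod>b\<in>Basis. normal_density 0 (sqrt (2 * t)) (x \<bullet> b))"
proof -
  have nd: "normal_density 0 (sqrt (2 * t)) y = (4 * pi * t) powr (- 1 / 2) * exp (- y\<^sup>2 / (4 * t))" for y
  proof -
    have "(sqrt (2 * t))\<^sup>2 = 2 * t" using assms by simp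
    moreover have "(4 * pi * t) powr (- 1 / 2) = 1 / sqrt (4 * pi * t)"
      using assms by (simp add: powr_half_sqrt[symmetric] powr_minus_divide)
    moreover have "2 * pi * (2 * t) = 4 * pi * t" "2 * (2 * t) = 4 * t" by simp_all
    ultimately show ?thesis unfolding normal_density_def by simp
  qed
  have "(\<Prod>b\<in>Basis. normal_density 0 (sqrt (2 * t)) (x \<bullet> b))
     = (\<Prod>b\<in>(Basis :: (real ^ 'n) set). (4 * pi * t) powr (- 1 / 2)) * (\<Prod>b\<in>Basis. exp (- (x \<bullet> b)\<^sup>2 / (4 * t)))"
    unfolding prod.distrib[symmetric] nd ..
  also have "(\<Prod>b\<in>(Basis :: (real ^ 'n) set). (4 * pi * t) powr (- 1 / 2)) = (4 * pi * t) powr (- real CARD('n) / 2)"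
    using assms by (simp add: powr_power)
  also have "(\<Prod>b\<in>Basis. exp (- (x \<bullet> b)\<^sup>2 / (4 * t))) = exp (- (norm x)\<^sup>2 / (4 * t))"
    unfolding norm_power2_Basis by (simp add: exp_sum[symmetric] sum_divide_distrib sum_negf)
  finally show ?thesis by (simp add: heat_kernel_def)
qed

lemma nn_integral_lborel_translate:
  fixes f :: "'a::euclidean_space \<Rightarrow> ennreal"
  assumes [measurable]: "f \<in> borel_measurable borel"
  shows "(\<integral>\<^sup>+x. f (x - c) \<partial>lborel) = (\<integral>\<^sup>+x. f x \<partial>lborel)"
    and "(\<integral>\<^sup>+x. f (c - x) \<partial>lborel) = (\<integral>\<^sup>+x. f x \<partial>lborel)"
proof -
  show "(\<integral>\<^sup>+x. f (x - c) \<partial>lborel) = (\<integral>\<^sup>+x. f x \<partial>lborel)"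
    by (subst (2) lborel_distr_plus[of "- c", symmetric]) (simp add: nn_integral_distr)
  have "(\<integral>\<^sup>+x. f x \<partial>lborel) = (\<integral>\<^sup>+x. f x \<partial>distr lborel borel (\<lambda>x. c + (-1) *\<^sub>R x))"
    using lborel_affine[of "-1" c] by (simp add: density_1)
  then show "(\<integral>\<^sup>+x. f (c - x) \<partial>lborel) = (\<integral>\<^sup>+x. f x \<partial>lborel)"
    by (simp add: nn_integral_distr)
qed

lemma nn_integral_heat_kernel:
  assumes "0 < t"
  shows "(\<integral>\<^sup>+x. ennreal (heat_kernel t (x :: real ^ 'n)) \<partial>lborel) = 1"
proof -
  have 1: "(\<integral>\<^sup>+x. ennreal (normal_density 0 (sqrt (2 * t)) x) \<partial>lborel) = 1"
    using assms by (subst nn_integral_eq_integral) auto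
  have "(\<integral>\<^sup>+x. ennreal (heat_kernel t (x :: real ^ 'n)) \<partial>lborel)
     = (\<integral>\<^sup>+x. (\<Prod>b\<in>Basis. ennreal (normal_density 0 (sqrt (2 * t)) ((x :: real ^ 'n) \<bullet> b))) \<partial>lborel)"
    using assms by (simp add: heat_kernel_eq_prod prod_ennreal)
  also have "\<dots> = 1" by (subst nn_integral_lborel_prod) (auto simp: 1)
  finally show ?thesis .
qed

lemma nn_integral_heat_kernel_translate:
  assumes "0 < t"
  shows "(\<integral>\<^sup>+x. ennreal (heat_kernel t (x - y :: real ^ 'n)) \<partial>lborel) = 1"
  using nn_integral_lborel_translate(1)[of "\<lambda>x. ennreal (heat_kernel t (x :: real ^ 'n))" y]
    nn_integral_heat_kernel[OF assms] by simp

lemma heat_kernel_integrable: "0 < t \<Longrightarrow> integrable lborel (heat_kernel t :: real ^ 'n \<Rightarrow> real)"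
  by (rule integrableI_nonneg) (auto simp: nn_integral_heat_kernel)

lemma heat_kernel_integrable_translate:
  "0 < t \<Longrightarrow> integrable lborel (\<lambda>x. heat_kernel t (x - y :: real ^ 'n))"
  by (rule integrableI_nonneg) (auto simp: nn_integral_heat_kernel_translate)

lemma integral_heat_kernel:
  assumes "0 < t" shows "(LINT x|lborel. heat_kernel t (x :: real ^ 'n)) = 1"
  using nn_integral_heat_kernel[OF assms, where 'n = 'n] heat_kernel_integrable[OF assms, where 'n = 'n]
  by (simp add: nn_integral_eq_integral ennreal_eq_1)

lemma integral_heat_kernel_translate:
  assumes "0 < t" shows "(LINT x|lborel. heat_kernel t (x - y :: real ^ 'n)) = 1"
  using nn_integral_heat_kernel_translate[OF assms, of y] heat_kernel_integrable_translate[OF assms, of y]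
  by (simp add: nn_integral_eq_integral ennreal_eq_1)

text \<open>The q-th power of G at time t is a multiple of G at time t/q, which has mass one. The
  leftover factor q^(-n/2) is at most 1 and is dropped.\<close>

lemma heat_kernel_Lq:
  assumes t: "0 < t" and q: "1 \<le> q"
  shows "Lq_le q (\<lambda>x :: real ^ 'n. heat_kernel t (x - y)) ((4 * pi * t) powr (- (real CARD('n) / 2 * (1 - 1 / q))))"
proof -
  let ?n = "real CARD('n)"
  have eq: "heat_kernel t x powr q = ((4 * pi * t) powr (- ?n / 2 * (q - 1)) * q powr (- ?n / 2)) * heat_kernel (t / q) x"
    for x :: "real ^ 'n"
  proof -
    have "heat_kernel t x powr q = (4 * pi * t) powr (- ?n / 2 * q) * exp (- (norm x)\<^sup>2 / (4 * t) * q)"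
      unfolding heat_kernel_def by (simp add: powr_mult powr_powr powr_def[of "exp _"])
    moreover have "(4 * pi * t) powr (- ?n / 2 * (q - 1)) * q powr (- ?n / 2) * (4 * pi * (t / q)) powr (- ?n / 2)
       = (4 * pi * t) powr (- ?n / 2 * q)"
      using t q by (simp add: powr_divide powr_add[symmetric] powr_minus field_simps)
    moreover have "- (norm x)\<^sup>2 / (4 * (t / q)) = - (norm x)\<^sup>2 / (4 * t) * q" using t q by (simp add: field_simps)
    ultimately show ?thesis by (simp add: heat_kernel_def mult.assoc[symmetric])
  qed
  have "q powr (- ?n / 2) \<le> q powr 0" using q by (intro powr_mono) auto
  then have qq: "q powr (- ?n / 2) \<le> 1" using q by simp
  have "(\<integral>\<^sup>+x. ennreal (\<bar>heat_kernel t (x - y)\<bar> powr q) \<partial>lborel)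
    = (\<integral>\<^sup>+x. ennreal ((4 * pi * t) powr (- ?n / 2 * (q - 1)) * q powr (- ?n / 2)) * ennreal (heat_kernel (t / q) (x - y)) \<partial>lborel)"
    by (simp add: eq ennreal_mult)
  also have "\<dots> = ennreal ((4 * pi * t) powr (- ?n / 2 * (q - 1)) * q powr (- ?n / 2))"
    using t q by (simp add: nn_integral_cmult nn_integral_heat_kernel_translate)
  also have "\<dots> \<le> ennreal ((4 * pi * t) powr (- ?n / 2 * (q - 1)))"
    using qq by (intro ennreal_leI) (simp add: mult_left_le)
  also have "(4 * pi * t) powr (- ?n / 2 * (q - 1)) = ((4 * pi * t) powr (- (?n / 2 * (1 - 1 / q)))) powr q"
    unfolding powr_powr using q by (intro arg_cong[where f = "(powr) _"]) (simp add: field_simps)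
  finally show ?thesis unfolding Lq_le_def by simp
qed

text \<open>Completion of the square: as a function of y the product of two Gaussians is a Gaussian
  about a weighted mean of x and z. The semigroup law then needs only unit mass.\<close>

lemma heat_kernel_mult:
  fixes x y z :: "real ^ 'n"
  assumes s: "0 < s" and t: "0 < t"
  shows "heat_kernel s (x - y) * heat_kernel t (y - z)
    = heat_kernel (s + t) (x - z) * heat_kernel (s * t / (s + t)) (y - (t / (s + t)) *\<^sub>R x - (s / (s + t)) *\<^sub>R z)"
proof -
  let ?n = "real CARD('n)"
  define u v where "u = x - y" and "v = y - z"
  have st: "s + t > 0" using s t by simp
  have w: "y - (t / (s + t)) *\<^sub>R x - (s / (s + t)) *\<^sub>R z = (s / (s + t)) *\<^sub>R v - (t / (s + t)) *\<^sub>R u"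
  proof -
    have "y = (s / (s + t)) *\<^sub>R y + (t / (s + t)) *\<^sub>R y"
      using st by (simp add: scaleR_left_distrib[symmetric] add_divide_distrib[symmetric])
    then show ?thesis unfolding u_def v_def by (simp add: algebra_simps)
  qed
  have xz: "x - z = u + v" by (simp add: u_def v_def)
  have "- (norm u)\<^sup>2 / (4 * s) + - (norm v)\<^sup>2 / (4 * t)
     = - (norm (u + v))\<^sup>2 / (4 * (s + t)) + - (norm ((s / (s + t)) *\<^sub>R v - (t / (s + t)) *\<^sub>R u))\<^sup>2 / (4 * (s * t / (s + t)))"
  proof -
    define U V W where "U = u \<bullet> u" and "V = v \<bullet> v" and "W = u \<bullet> v"
    define r where "r = s + t"
    have r: "r > 0" "r \<noteq> 0" "s \<noteq> 0" "t \<noteq> 0" using st s t by (auto simp: r_def)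
    have n1: "(norm (u + v))\<^sup>2 = U + 2 * W + V"
      by (simp add: power2_norm_eq_inner inner_add U_def V_def W_def inner_commute)
    have n2: "(norm ((s / r) *\<^sub>R v - (t / r) *\<^sub>R u))\<^sup>2 = (s\<^sup>2 * V - 2 * s * t * W + t\<^sup>2 * U) / r\<^sup>2"
      unfolding power2_norm_eq_inner using r
      by (simp add: inner_diff U_def V_def W_def inner_commute[of v u] power2_eq_square field_simps)
    have n3: "(norm u)\<^sup>2 = U" "(norm v)\<^sup>2 = V" by (simp_all add: power2_norm_eq_inner U_def V_def)
    have "- U / (4 * s) + - V / (4 * t) = - (U + 2 * W + V) / (4 * r) + - ((s\<^sup>2 * V - 2 * s * t * W + t\<^sup>2 * U) / r\<^sup>2) / (4 * (s * t / r))"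
    proof -
      have e1: "- ((s\<^sup>2 * V - 2 * s * t * W + t\<^sup>2 * U) / r\<^sup>2) / (4 * (s * t / r)) = - (s\<^sup>2 * V - 2 * s * t * W + t\<^sup>2 * U) / (4 * s * t * r)"
        using r by (simp add: field_simps power2_eq_square)
      have e2: "- U / (4 * s) + - V / (4 * t) = - (U * t * r + V * s * r) / (4 * s * t * r)"
        using r by (simp add: field_simps)
      have e3: "- (U + 2 * W + V) / (4 * r) = - ((U + 2 * W + V) * s * t) / (4 * s * t * r)"
        using r by (simp add: field_simps)
      have e4: "- ((U + 2 * W + V) * s * t) + - (s\<^sup>2 * V - 2 * s * t * W + t\<^sup>2 * U) = - (U * t * r + V * s * r)"
        by (simp add: r_def algebra_simps power2_eq_square)
      show ?thesis unfolding e1 e2 e3 add_divide_distrib[symmetric] e4 ..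
    qed
    then show ?thesis unfolding n3 n1 r_def[symmetric] n2 .
  qed
  then have "exp (- (norm u)\<^sup>2 / (4 * s)) * exp (- (norm v)\<^sup>2 / (4 * t))
     = exp (- (norm (u + v))\<^sup>2 / (4 * (s + t))) * exp (- (norm ((s / (s + t)) *\<^sub>R v - (t / (s + t)) *\<^sub>R u))\<^sup>2 / (4 * (s * t / (s + t))))"
    unfolding exp_add[symmetric] by simp
  moreover have "(4 * pi * s) powr (- ?n / 2) * (4 * pi * t) powr (- ?n / 2)
     = (4 * pi * (s + t)) powr (- ?n / 2) * (4 * pi * (s * t / (s + t))) powr (- ?n / 2)"
  proof -
    have "4 * pi * s * (4 * pi * t) = 4 * pi * (s + t) * (4 * pi * (s * t / (s + t)))"
      using st by (simp add: field_simps)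
    then show ?thesis using s t st by (simp add: powr_mult[symmetric] mult_ac)
  qed
  ultimately show ?thesis
    unfolding w xz unfolding heat_kernel_def u_def[symmetric] v_def[symmetric] by (simp add: mult_ac)
qed

lemma heat_kernel_semigroup:
  fixes x z :: "real ^ 'n"
  assumes "0 < s" "0 < t"
  shows "integrable lborel (\<lambda>y. heat_kernel s (x - y) * heat_kernel t (y - z))"
    and "(LINT y|lborel. heat_kernel s (x - y) * heat_kernel t (y - z)) = heat_kernel (s + t) (x - z)"
proof -
  have "0 < s * t / (s + t)" using assms by simp
  then show "integrable lborel (\<lambda>y. heat_kernel s (x - y) * heat_kernel t (y - z))"
    "(LINT y|lborel. heat_kernel s (x - y) * heat_kernel t (y - z)) = heat_kernel (s + t) (x - z)"
    unfolding heat_kernel_mult[OF assms] diff_diff_eq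
    by (auto simp: integral_heat_kernel_translate intro!: integrable_mult_right heat_kernel_integrable_translate)
qed

section \<open>Gaussian decay against polynomial weights\<close>

lemma power_exp_bounded:
  assumes "0 < c"
  obtains C :: real where "0 \<le> C" "\<And>r. 0 \<le> r \<Longrightarrow> (1 + r) ^ N * exp (- (c * r\<^sup>2)) \<le> C"
\<comment> \<open>The constant is the maximum of e^(Nr - c r^2), after (1+r)^N has been bounded by
  e^(Nr).\<close>
proof (rule that[of "exp ((real N)\<^sup>2 / (4 * c))"])
  fix r :: real assume r: "0 \<le> r"
  have "(1 + r) ^ N \<le> exp r ^ N" using r exp_ge_add_one_self[of r] by (intro power_mono) auto
  also have "\<dots> = exp (real N * r)" by (simp add: exp_of_nat_mult)
  finally have "(1 + r) ^ N * exp (- (c * r\<^sup>2)) \<le> exp (real N * r) * exp (- (c * r\<^sup>2))"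
    by (intro mult_right_mono) auto
  also have "\<dots> = exp (real N * r - c * r\<^sup>2)" by (simp add: exp_add[symmetric])
  also have "real N * r - c * r\<^sup>2 \<le> (real N)\<^sup>2 / (4 * c)"
  proof -
    have "0 \<le> (real N - 2 * c * r)\<^sup>2 / (4 * c)" using assms by simp
    also have "\<dots> = (real N)\<^sup>2 / (4 * c) - (real N * r - c * r\<^sup>2)"
      using assms by (simp add: field_simps power2_eq_square)
    finally show ?thesis by simp
  qed
  finally show "(1 + r) ^ N * exp (- (c * r\<^sup>2)) \<le> exp ((real N)\<^sup>2 / (4 * c))" by simp
qed simp

lemma real_polynomial_function_grad:
  fixes p :: "real ^ 'n \<Rightarrow> real"
  assumes "real_polynomial_function p"
  shows "\<exists>p'. (\<forall>i. real_polynomial_function (p' i)) \<and>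
    (\<forall>x. (p has_derivative (\<lambda>h. \<Sum>i\<in>UNIV. h $ i * p' i x)) (at x))"
  using assms
proof induction
  case (linear f)
  have "(\<lambda>h. \<Sum>i\<in>UNIV. h $ i * f (axis i 1)) = f"
    by (rule ext, rule linear_sum_axis[symmetric]) (rule bounded_linear.linear[OF linear])
  then show ?case using bounded_linear_imp_has_derivative[OF linear]
    by (intro exI[of _ "\<lambda>i x. f (axis i 1)"]) auto
next
  case (const c)
  show ?case by (intro exI[of _ "\<lambda>i x. 0"]) auto
next
  case (add f g)
  then obtain f' g' where f': "\<And>i. real_polynomial_function (f' i)" "\<And>x. (f has_derivative (\<lambda>h. \<Sum>i\<in>UNIV. h $ i * f' i x)) (at x)"
    and g': "\<And>i. real_polynomial_function (g' i)" "\<And>x. (g has_derivative (\<lambda>h. \<Sum>i\<in>UNIV. h $ i * g' i x)) (at x)" by blast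
  show ?case using f'(1) g'(1) has_derivative_add[OF f'(2) g'(2)]
    by (intro exI[of _ "\<lambda>i x. f' i x + g' i x"]) (auto simp: distrib_left sum.distrib)
next
  case (mult f g)
  then obtain f' g' where f': "\<And>i. real_polynomial_function (f' i)" "\<And>x. (f has_derivative (\<lambda>h. \<Sum>i\<in>UNIV. h $ i * f' i x)) (at x)"
    and g': "\<And>i. real_polynomial_function (g' i)" "\<And>x. (g has_derivative (\<lambda>h. \<Sum>i\<in>UNIV. h $ i * g' i x)) (at x)" by blast
  have "((\<lambda>x. f x * g x) has_derivative (\<lambda>h. \<Sum>i\<in>UNIV. h $ i * (f x * g' i x + f' i x * g x))) (at x)" for x
    using has_derivative_mult[OF f'(2)[of x] g'(2)[of x]]
    by (simp add: distrib_left sum.distrib sum_distrib_left sum_distrib_right mult_ac)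
  moreover have "real_polynomial_function (\<lambda>x. f x * g' i x + f' i x * g x)" for i
    by (intro real_polynomial_function.intros(3) real_polynomial_function.intros(4) f' g' mult.hyps)
  ultimately show ?case by (intro exI[of _ "\<lambda>i x. f x * g' i x + f' i x * g x"]) auto
qed

lemma real_polynomial_function_growth:
  fixes p :: "'a::real_normed_vector \<Rightarrow> real"
  assumes "real_polynomial_function p"
  shows "\<exists>C m. 0 \<le> C \<and> (\<forall>x. \<bar>p x\<bar> \<le> C * (1 + norm x) ^ m)"
  using assms
proof induction
  case (linear f)
  then obtain K where "K \<ge> 0" "\<And>x. norm (f x) \<le> norm x * K" using bounded_linear.nonneg_bounded by blast
  have "\<bar>f x\<bar> \<le> K * (1 + norm x) ^ 1" for x
    using \<open>\<And>x. norm (f x) \<le> norm x * K\<close>[of x] \<open>K \<ge> 0\<close> by (simp add: algebra_simps)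
  then show ?case using \<open>K \<ge> 0\<close> by blast
next
  case (const c)
  show ?case by (rule exI[of _ "\<bar>c\<bar>"], rule exI[of _ 0]) auto
next
  case (add f g)
  then obtain C m C' m' where C: "0 \<le> C" "\<And>x. \<bar>f x\<bar> \<le> C * (1 + norm x) ^ m" and C': "0 \<le> C'" "\<And>x. \<bar>g x\<bar> \<le> C' * (1 + norm x) ^ m'" by blast
  have "\<bar>f x + g x\<bar> \<le> (C + C') * (1 + norm x) ^ (m + m')" for x
  proof -
    have "\<bar>f x + g x\<bar> \<le> C * (1 + norm x) ^ m + C' * (1 + norm x) ^ m'" using C(2)[of x] C'(2)[of x] by linarith
    also have "\<dots> \<le> C * (1 + norm x) ^ (m + m') + C' * (1 + norm x) ^ (m + m')"
      using C C' by (intro add_mono mult_left_mono power_increasing) auto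
    finally show ?thesis by (simp add: distrib_right)
  qed
  then show ?case using C C' by (intro exI[of _ "C + C'"] exI[of _ "m + m'"]) auto
next
  case (mult f g)
  then obtain C m C' m' where C: "0 \<le> C" "\<And>x. \<bar>f x\<bar> \<le> C * (1 + norm x) ^ m" and C': "0 \<le> C'" "\<And>x. \<bar>g x\<bar> \<le> C' * (1 + norm x) ^ m'" by blast
  have "\<bar>f x * g x\<bar> \<le> (C * C') * (1 + norm x) ^ (m + m')" for x
    using mult_mono[OF C(2)[of x] C'(2)[of x]] C by (simp add: abs_mult power_add mult_ac)
  then show ?case using C C' by (intro exI[of _ "C * C'"] exI[of _ "m + m'"]) auto
qed

lemma heat_kernel_has_derivative:
  fixes x :: "real ^ 'n"
  assumes "0 < t"
  shows "(heat_kernel t has_derivative (\<lambda>h. - (h \<bullet> x) / (2 * t) * heat_kernel t x)) (at x)"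
  unfolding heat_kernel_def power2_norm_eq_inner using assms
  by (auto intro!: derivative_eq_intros simp: inner_commute field_simps)

text \<open>Polynomials times G are closed under differentiation. The precise (Hermite) polynomials
  are irrelevant: only their at most polynomial growth is used.\<close>

lemma heat_kernel_partials:
  assumes t: "0 < t"
  shows "\<exists>p. real_polynomial_function p \<and> partials is (heat_kernel t :: real ^ 'n \<Rightarrow> real) = (\<lambda>x. p x * heat_kernel t x)"
proof (induction "is")
  case Nil
  show ?case by (intro exI[of _ "\<lambda>x. 1"]) auto
next
  case (Cons i "is")
  then obtain p where p: "real_polynomial_function p"
    "partials is (heat_kernel t :: real ^ 'n \<Rightarrow> real) = (\<lambda>x. p x * heat_kernel t x)" by blast
  obtain p' where p': "\<And>i. real_polynomial_function (p' i)"
    "\<And>x. (p has_derivative (\<lambda>h. \<Sum>i\<in>UNIV. h $ i * p' i x)) (at x)"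
    using real_polynomial_function_grad[OF p(1)] by blast
  have "partials (i # is) (heat_kernel t) x = (p' i x + (- 1 / (2 * t)) * x $ i * p x) * heat_kernel t x" for x
  proof -
    have D: "((\<lambda>x. p x * heat_kernel t x) has_derivative
       (\<lambda>h. p x * (- (h \<bullet> x) / (2 * t) * heat_kernel t x) + (\<Sum>i\<in>UNIV. h $ i * p' i x) * heat_kernel t x)) (at x)"
      by (rule has_derivative_mult[OF p'(2) heat_kernel_has_derivative[OF t]])
    have "axis i 1 \<bullet> x = x $ i" by (simp add: inner_axis')
    moreover have "(\<Sum>j\<in>UNIV. axis i 1 $ j * p' j x) = p' i x"
      by (simp add: axis_def if_distrib[of "\<lambda>x. x * _"] cong: if_cong)
    ultimately have "dir_deriv (axis i 1) (\<lambda>x. p x * heat_kernel t x) x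
       = p x * (- (x $ i) / (2 * t) * heat_kernel t x) + p' i x * heat_kernel t x"
      using dir_deriv_eq[OF D, of "axis i 1"] by simp
    then show ?thesis unfolding partials_Cons p(2) by (simp add: algebra_simps)
  qed
  moreover have "real_polynomial_function (\<lambda>x. p' i x + (- 1 / (2 * t)) * x $ i * p x)"
    by (intro real_polynomial_function.intros(3) p' real_polynomial_function.intros(4) p real_polynomial_function.intros(2)
        real_polynomial_function.intros(1) bounded_linear_vec_nth)
  ultimately show ?case by blast
qed

text \<open>Half of the exponent rebuilds the kernel at time 2t, the other half remains as a spare
  Gaussian factor. The spare factor absorbs weights, so that weighted estimates are reduced to the
  unit mass of the doubled kernel.\<close>

lemma heat_kernel_double:
  assumes "0 < t"
  shows "heat_kernel t (x :: real ^ 'n) = 2 powr (real CARD('n) / 2) * exp (- ((norm x)\<^sup>2 / (8 * t))) * heat_kernel (2 * t) x"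
proof -
  have "(4 * pi * (2 * t)) powr (- real CARD('n) / 2) = 2 powr (- real CARD('n) / 2) * (4 * pi * t) powr (- real CARD('n) / 2)"
    using assms by (simp add: powr_mult[symmetric] mult_ac)
  moreover have "exp (- (norm x)\<^sup>2 / (4 * t)) = exp (- ((norm x)\<^sup>2 / (8 * t))) * exp (- (norm x)\<^sup>2 / (4 * (2 * t)))"
    unfolding exp_add[symmetric] by simp
  ultimately show ?thesis unfolding heat_kernel_def by (simp add: powr_minus)
qed

text \<open>The constant serves all t \<le> T, because the spare factor exp(-|x|^2/(8t)) increases
  with t.\<close>

lemma heat_kernel_weighted_le:
  assumes "0 < T"
  obtains C where "0 \<le> C" "\<And>t (x :: real ^ 'n). 0 < t \<Longrightarrow> t \<le> T \<Longrightarrow> (1 + norm x) ^ N * heat_kernel t x \<le> C * heat_kernel (2 * t) x"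
proof -
  obtain C where C: "0 \<le> C" "\<And>r. 0 \<le> r \<Longrightarrow> (1 + r) ^ N * exp (- (1 / (8 * T) * r\<^sup>2)) \<le> C"
    using power_exp_bounded[of "1 / (8 * T)" N] assms by auto
  have "(1 + norm x) ^ N * heat_kernel t x \<le> (2 powr (real CARD('n) / 2) * C) * heat_kernel (2 * t) x" if t: "0 < t" "t \<le> T" for t and x :: "real ^ 'n"
  proof -
    have "(norm x)\<^sup>2 / (8 * T) \<le> (norm x)\<^sup>2 / (8 * t)" using t assms by (intro divide_left_mono) auto
    then have "(1 + norm x) ^ N * exp (- ((norm x)\<^sup>2 / (8 * t))) \<le> (1 + norm x) ^ N * exp (- (1 / (8 * T) * (norm x)\<^sup>2))"
      by (intro mult_left_mono) auto
    also have "\<dots> \<le> C" by (rule C(2)) simp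
    finally have "((1 + norm x) ^ N * exp (- ((norm x)\<^sup>2 / (8 * t)))) * (2 powr (real CARD('n) / 2) * heat_kernel (2 * t) x)
       \<le> C * (2 powr (real CARD('n) / 2) * heat_kernel (2 * t) x)" by (intro mult_right_mono) auto
    then show ?thesis by (subst heat_kernel_double[OF t(1)]) (simp add: mult_ac)
  qed
  with C that[of "2 powr (real CARD('n) / 2) * C"] show ?thesis by auto
qed

lemma heat_kernel_le_peak: "0 < t \<Longrightarrow> heat_kernel t (x :: real ^ 'n) \<le> (4 * pi * t) powr (- real CARD('n) / 2)"
  unfolding heat_kernel_def by (intro mult_left_le) auto

lemma heat_kernel_schwartz:
  assumes t: "0 < t"
  shows "(heat_kernel t :: real ^ 'n \<Rightarrow> real) \<in> schwartz"
  unfolding schwartz_def mem_Collect_eq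
proof (intro conjI allI)
  fix "is" :: "'n list" and x and k :: nat
  obtain p where p: "real_polynomial_function p"
    "partials is (heat_kernel t :: real ^ 'n \<Rightarrow> real) = (\<lambda>x. p x * heat_kernel t x)"
    using heat_kernel_partials[OF t] by blast
  obtain p' where "\<And>x. (p has_derivative (\<lambda>h. \<Sum>i\<in>UNIV. h $ i * p' i x)) (at x)"
    using real_polynomial_function_grad[OF p(1)] by blast
  from has_derivative_mult[OF this heat_kernel_has_derivative[OF t]]
  show "partials is (heat_kernel t) differentiable (at x)" unfolding p(2) differentiable_def by blast
  obtain B m where B: "0 \<le> B" "\<And>x. \<bar>p x\<bar> \<le> B * (1 + norm x) ^ m"
    using real_polynomial_function_growth[OF p(1)] by blast
  obtain C where C: "0 \<le> C" "\<And>s (x :: real ^ 'n). 0 < s \<Longrightarrow> s \<le> t \<Longrightarrow> (1 + norm x) ^ (k + m) * heat_kernel s x \<le> C * heat_kernel (2 * s) x"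
    using heat_kernel_weighted_le[OF t] by blast
  have "\<bar>(1 + norm x) ^ k * (p x * heat_kernel t x)\<bar> \<le> B * (C * (4 * pi * (2 * t)) powr (- real CARD('n) / 2))" for x
  proof -
    have "\<bar>(1 + norm x) ^ k * (p x * heat_kernel t x)\<bar> = (1 + norm x) ^ k * \<bar>p x\<bar> * heat_kernel t x" by (simp add: abs_mult)
    also have "\<dots> \<le> (1 + norm x) ^ k * (B * (1 + norm x) ^ m) * heat_kernel t x"
      by (intro mult_right_mono mult_left_mono B) auto
    also have "\<dots> = B * ((1 + norm x) ^ (k + m) * heat_kernel t x)" by (simp add: power_add)
    also have "\<dots> \<le> B * (C * (4 * pi * (2 * t)) powr (- real CARD('n) / 2))"
      using B C t by (intro mult_left_mono order_trans[OF C(2)] heat_kernel_le_peak) auto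
    finally show ?thesis .
  qed
  then show "bounded (range (\<lambda>x. (1 + norm x) ^ k * partials is (heat_kernel t) x))"
    unfolding p(2) bounded_iff by auto
qed

lemma heat_kernel_rapid:
  assumes t: "0 < t"
  shows "rapid (heat_kernel t :: real ^ 'n \<Rightarrow> real)"
  unfolding rapid_def
proof (intro conjI allI)
  fix N :: nat
  obtain C where C: "0 \<le> C" "\<And>s (x :: real ^ 'n). 0 < s \<Longrightarrow> s \<le> t \<Longrightarrow> (1 + norm x) ^ N * heat_kernel s x \<le> C * heat_kernel (2 * s) x"
    using heat_kernel_weighted_le[OF t] by blast
  have "norm ((1 + norm y) ^ N * heat_kernel t y) \<le> norm (C * heat_kernel (2 * t) y)" for y :: "real ^ 'n"
    using C(1) C(2)[of t y] t by (simp add: abs_mult)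
  then show "integrable lborel (\<lambda>y :: real ^ 'n. (1 + norm y) ^ N * heat_kernel t y)"
    using t by (intro Bochner_Integration.integrable_bound[OF integrable_mult_right[OF heat_kernel_integrable[of "2 * t"], of C]]) auto
qed measurable

text \<open>The derivative of G in direction a (\<open>dir_deriv_heat_kernel\<close>), given by its
  formula so that joint measurability in time and space is immediate.\<close>

definition heat_grad :: "real ^ 'n \<Rightarrow> real \<Rightarrow> real ^ 'n \<Rightarrow> real" where
  "heat_grad a t x = - (a \<bullet> x) / (2 * t) * heat_kernel t x"

lemma heat_grad_measurable2 [measurable]:
  assumes [measurable]: "f \<in> borel_measurable M" "g \<in> borel_measurable M"
  shows "(\<lambda>p. heat_grad a (f p) (g p :: real ^ 'n)) \<in> borel_measurable M"
  unfolding heat_grad_def by measurable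

lemma dir_deriv_heat_kernel: "0 < t \<Longrightarrow> dir_deriv a (heat_kernel t) = heat_grad a t"
  by (rule ext) (simp add: dir_deriv_eq[OF heat_kernel_has_derivative] heat_grad_def)

lemma heat_grad_minus: "heat_grad a t (- x) = - heat_grad a t x"
  by (simp add: heat_grad_def)

definition grad_const :: "real ^ 'n \<Rightarrow> real" where
  "grad_const a = norm a * 2 powr (real CARD('n) / 2)"

lemma grad_const_nonneg [simp]: "0 \<le> grad_const a"
  by (simp add: grad_const_def)

text \<open>In the parabolic variable w = |x| / (2 sqrt t) the spare Gaussian factor is exp(-w^2/2),
  and w exp(-w^2/2) \<le> 1. Scaling back produces the power t^(1/2).\<close>

lemma norm_heat_kernel_le:
  assumes t: "0 < t"
  shows "norm x * heat_kernel t (x :: real ^ 'n) \<le> 2 * t powr (1 / 2) * 2 powr (real CARD('n) / 2) * heat_kernel (2 * t) x"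
proof -
  define w where "w = norm x / (2 * sqrt t)"
  have w: "norm x = 2 * sqrt t * w" "w \<ge> 0" using t by (auto simp: w_def)
  have w2: "(norm x)\<^sup>2 / (8 * t) = w\<^sup>2 / 2" using t by (simp add: w(1) power_mult_distrib)
  have "w \<le> 1 + w\<^sup>2 / 2" using zero_le_power2[of "w - 1"] by (simp add: power2_diff)
  also have "\<dots> \<le> exp (w\<^sup>2 / 2)" by (rule exp_ge_add_one_self)
  finally have "w * exp (- (w\<^sup>2 / 2)) \<le> 1" by (simp add: exp_minus field_simps)
  then have "(w * exp (- (w\<^sup>2 / 2))) * (2 * sqrt t * 2 powr (real CARD('n) / 2) * heat_kernel (2 * t) x)
      \<le> 1 * (2 * sqrt t * 2 powr (real CARD('n) / 2) * heat_kernel (2 * t) x)" using t by (intro mult_right_mono) auto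
  then show ?thesis unfolding w2[symmetric] using t
    by (subst heat_kernel_double[OF t]) (simp add: w(1) powr_half_sqrt mult_ac)
qed

lemma heat_grad_le:
  assumes t: "0 < t"
  shows "\<bar>heat_grad a t x\<bar> \<le> grad_const a * t powr (- (1 / 2)) * heat_kernel (2 * t) (x :: real ^ 'n)"
proof -
  have "\<bar>heat_grad a t x\<bar> = \<bar>a \<bullet> x\<bar> / (2 * t) * heat_kernel t x" using t by (simp add: heat_grad_def abs_mult)
  also have "\<dots> \<le> (norm a * norm x) / (2 * t) * heat_kernel t x"
    using t by (intro mult_right_mono divide_right_mono Cauchy_Schwarz_ineq2) auto
  also have "\<dots> = norm a / (2 * t) * (norm x * heat_kernel t x)" by simp
  also have "\<dots> \<le> norm a / (2 * t) * (2 * t powr (1 / 2) * 2 powr (real CARD('n) / 2) * heat_kernel (2 * t) x)"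
    using t by (intro mult_left_mono norm_heat_kernel_le) auto
  also have "\<dots> = grad_const a * (t powr (1 / 2) / t) * heat_kernel (2 * t) x" using t by (simp add: grad_const_def)
  also have "t powr (1 / 2) / t = t powr (- (1 / 2))"
  proof -
    have "t powr (1 / 2) / t powr 1 = t powr (1 / 2 - 1)" by (rule powr_diff[symmetric])
    then show ?thesis using t by simp
  qed
  finally show ?thesis .
qed

lemma heat_grad_Lq:
  fixes a y :: "real ^ 'n"
  assumes t: "0 < t" and q: "1 \<le> q"
  shows "Lq_le q (\<lambda>x. heat_grad a t (x - y)) (grad_const a * t powr (- (1 / 2 + real CARD('n) / 2 * (1 - 1 / q))))"
proof -
  let ?r = "real CARD('n) / 2 * (1 - 1 / q)"
  have r: "?r \<ge> 0" using q by simp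
  have 1: "Lq_le q (\<lambda>x. grad_const a * t powr (- (1 / 2)) * heat_kernel (2 * t) (x - y))
     (\<bar>grad_const a * t powr (- (1 / 2))\<bar> * (4 * pi * (2 * t)) powr (- ?r))"
    using t q by (intro Lq_le_cmult heat_kernel_Lq) auto
  have "(4 * pi * (2 * t)) powr (- ?r) \<le> t powr (- ?r)"
  proof (rule powr_mono2')
    have "1 * t \<le> (4 * pi * 2) * t" using t pi_gt3 by (intro mult_right_mono) auto
    then show "t \<le> 4 * pi * (2 * t)" by simp
  qed (use t r in auto)
  then have "\<bar>grad_const a * t powr (- (1 / 2))\<bar> * (4 * pi * (2 * t)) powr (- ?r) \<le> (grad_const a * t powr (- (1 / 2))) * t powr (- ?r)"
    by (simp add: abs_mult mult_left_mono)
  also have "\<dots> = grad_const a * t powr (- (1 / 2 + ?r))" by (simp add: powr_add[symmetric])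
  finally have "Lq_le q (\<lambda>x. grad_const a * t powr (- (1 / 2)) * heat_kernel (2 * t) (x - y)) (grad_const a * t powr (- (1 / 2 + ?r)))"
    using q by (intro Lq_le_mono[OF 1]) auto
  then show ?thesis
    using heat_grad_le[OF t] q by (elim Lq_le_dominated) (auto simp: abs_mult)
qed

lemma heat_grad_L1:
  fixes a y :: "real ^ 'n"
  assumes t: "0 < t"
  shows "(\<integral>\<^sup>+x. ennreal \<bar>heat_grad a t (x - y)\<bar> \<partial>lborel) \<le> ennreal (grad_const a * t powr (- (1 / 2)))"
  using heat_grad_Lq[OF t, of 1 a y] by (simp add: Lq_le_def)

section \<open>Semigroup identities and dominating functions\<close>

lemma conv_heat_kernel:
  assumes "0 < s" "0 < t"
  shows "conv (heat_kernel s) (heat_kernel t) = (heat_kernel (s + t) :: real ^ 'n \<Rightarrow> real)"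
proof
  fix z :: "real ^ 'n"
  have "conv (heat_kernel s) (heat_kernel t) z = (LINT y|lborel. heat_kernel t (z - y) * heat_kernel s (y - 0))"
    by (simp add: conv_def mult.commute)
  also have "\<dots> = heat_kernel (s + t) z" by (subst heat_kernel_semigroup(2)) (use assms in \<open>auto simp: add.commute\<close>)
  finally show "conv (heat_kernel s) (heat_kernel t) z = heat_kernel (s + t) z" .
qed

lemma heat_grad_semigroup:
  assumes "0 < s" "0 < t"
  shows "conv (heat_kernel s) (heat_grad a t) = (heat_grad a (s + t) :: real ^ 'n \<Rightarrow> real)"
proof
  fix z
  have "conv (heat_kernel s) (heat_grad a t) z = dir_deriv a (conv (heat_kernel s) (heat_kernel t)) z"
    using assms by (simp add: conv_dir_deriv heat_kernel_integrable heat_kernel_schwartz dir_deriv_heat_kernel)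
  then show "conv (heat_kernel s) (heat_grad a t) z = heat_grad a (s + t) z"
    using assms by (simp add: conv_heat_kernel dir_deriv_heat_kernel)
qed

text \<open>The exponent 2n is generous; it is chosen because (1+|x|)^(2n) dominates the product of
  1 + x_b^2 over the coordinates, whose reciprocal integrates as a product of one-dimensional
  integrals.\<close>

lemma integrable_one_plus_norm:
  "integrable lborel (\<lambda>x :: real ^ 'n. 1 / (1 + norm x) ^ (2 * CARD('n)))"
proof (rule integrableI_bounded)
  have fin: "(\<integral>\<^sup>+x. ennreal (inverse (1 + x\<^sup>2)) \<partial>lborel) < \<infinity>"
    using integrable_inverse_1_plus_square
    by (simp add: set_integrable_def integrable_iff_bounded einterval_def)
  have "(\<integral>\<^sup>+x. ennreal (norm (1 / (1 + norm (x :: real ^ 'n)) ^ (2 * CARD('n)))) \<partial>lborel)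
     \<le> (\<integral>\<^sup>+x. (\<Prod>b\<in>Basis. ennreal (inverse (1 + ((x :: real ^ 'n) \<bullet> b)\<^sup>2))) \<partial>lborel)"
  proof (intro nn_integral_mono)
    fix x :: "real ^ 'n"
    have "1 / (1 + norm x) ^ (2 * CARD('n)) = (\<Prod>b\<in>(Basis :: (real ^ 'n) set). inverse ((1 + norm x)\<^sup>2))"
      by (simp add: power_mult inverse_eq_divide power_one_over)
    also have "\<dots> \<le> (\<Prod>b\<in>Basis. inverse (1 + (x \<bullet> b)\<^sup>2))"
    proof (intro prod_mono conjI le_imp_inverse_le)
      fix b :: "real ^ 'n" assume b: "b \<in> Basis"
      have "(x \<bullet> b)\<^sup>2 \<le> (norm x)\<^sup>2" using Basis_le_norm[OF b, of x] by (simp add: abs_le_square_iff[symmetric])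
      then show "1 + (x \<bullet> b)\<^sup>2 \<le> (1 + norm x)\<^sup>2"
        by (simp add: power2_sum add_increasing2)
    qed (auto simp: add_pos_nonneg)
    finally show "ennreal (norm (1 / (1 + norm x) ^ (2 * CARD('n)))) \<le> (\<Prod>b\<in>Basis. ennreal (inverse (1 + (x \<bullet> b)\<^sup>2)))"
      by (subst prod_ennreal) (auto intro!: ennreal_leI)
  qed
  also have "\<dots> = (\<Prod>b\<in>(Basis :: (real ^ 'n) set). \<integral>\<^sup>+x. ennreal (inverse (1 + x\<^sup>2)) \<partial>lborel)"
    by (rule nn_integral_lborel_prod) auto
  also have "\<dots> < \<infinity>" using fin by (simp add: power_less_top_ennreal)
  finally show "(\<integral>\<^sup>+x. ennreal (norm (1 / (1 + norm (x :: real ^ 'n)) ^ (2 * CARD('n)))) \<partial>lborel) < \<infinity>" .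
qed measurable

lemma schwartz_rapid:
  fixes \<phi> :: "real ^ 'n \<Rightarrow> real"
  assumes "\<phi> \<in> schwartz"
  shows "rapid \<phi>"
  unfolding rapid_def
proof (intro conjI allI schwartz_measurable0 assms)
  fix N :: nat
  obtain C where C: "0 \<le> C" "\<And>x. (1 + norm x) ^ (N + 2 * CARD('n)) * \<bar>partials [] \<phi> x\<bar> \<le> C"
    using schwartz_bound[OF assms] by blast
  have "norm ((1 + norm y) ^ N * \<phi> y) \<le> norm (C * (1 / (1 + norm y) ^ (2 * CARD('n))))" for y
    using C(1) C(2)[of y] by (simp add: abs_mult power_add field_simps add_pos_nonneg)
  then show "integrable lborel (\<lambda>y. (1 + norm y) ^ N * \<phi> y)"
    using schwartz_measurable0[OF assms]
    by (intro Bochner_Integration.integrable_bound[OF integrable_mult_right[OF integrable_one_plus_norm, of C]]) auto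
qed

lemma heat_kernel_le_double:
  assumes t: "0 < t" and s: "t / 2 \<le> s" "s \<le> 2 * t"
  shows "heat_kernel s (x :: real ^ 'n) \<le> 4 powr (real CARD('n) / 2) * heat_kernel (2 * t) x"
proof -
  have "(4 * pi * s) powr (- real CARD('n) / 2) \<le> (4 * pi * (t / 2)) powr (- real CARD('n) / 2)"
    using t s by (intro powr_mono2') auto
  also have "\<dots> = 4 powr (real CARD('n) / 2) * (4 * pi * (2 * t)) powr (- real CARD('n) / 2)"
  proof -
    have "4 powr (real CARD('n) / 2) = (1 / 4) powr (- real CARD('n) / 2)"
      by (simp add: powr_divide powr_minus)
    then show ?thesis using t by (simp add: powr_mult[symmetric])
  qed
  finally have 1: "(4 * pi * s) powr (- real CARD('n) / 2) \<le> 4 powr (real CARD('n) / 2) * (4 * pi * (2 * t)) powr (- real CARD('n) / 2)" .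
  have "(norm x)\<^sup>2 / (4 * (2 * t)) \<le> (norm x)\<^sup>2 / (4 * s)" using t s by (intro divide_left_mono) auto
  then have 2: "exp (- (norm x)\<^sup>2 / (4 * s)) \<le> exp (- (norm x)\<^sup>2 / (4 * (2 * t)))" by simp
  show ?thesis unfolding heat_kernel_def using mult_mono[OF 1 2] by (simp add: mult.assoc)
qed

text \<open>For s between t/2 and 2t all kernels lie below one multiple of the kernel at time 2t, so
  dominated convergence applies along sequences. The shift by N makes every term of the sequence
  obey this bound.\<close>

lemma heat_kernel_continuous_L1:
  assumes t: "0 < t"
  shows "((\<lambda>s. LINT x|lborel. \<bar>heat_kernel s x - heat_kernel t (x :: real ^ 'n)\<bar>) \<longlongrightarrow> 0) (at t)"
  unfolding tendsto_at_iff_sequentially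
proof (intro allI impI)
  fix X assume X: "X \<longlonglongrightarrow> t"
  have "\<forall>\<^sub>F n in sequentially. t / 2 < X n" "\<forall>\<^sub>F n in sequentially. X n < 2 * t"
    using order_tendstoD[OF X, of "t / 2"] order_tendstoD[OF X, of "2 * t"] t by auto
  then have "\<forall>\<^sub>F n in sequentially. t / 2 < X n \<and> X n < 2 * t" by eventually_elim simp
  then obtain N where N: "\<And>n. n \<ge> N \<Longrightarrow> t / 2 < X n \<and> X n < 2 * t" by (auto simp: eventually_sequentially)
  let ?c = "2 * 4 powr (real CARD('n) / 2)"
  have "(\<lambda>n. LINT x|lborel. \<bar>heat_kernel (X (n + N)) x - heat_kernel t (x :: real ^ 'n)\<bar>) \<longlonglongrightarrow> (LINT x|(lborel :: (real ^ 'n) measure). 0)"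
  proof (rule integral_dominated_convergence[where w = "\<lambda>x. ?c * heat_kernel (2 * t) x"])
    show "integrable lborel (\<lambda>x :: real ^ 'n. ?c * heat_kernel (2 * t) x)"
      using t by (intro integrable_mult_right heat_kernel_integrable) auto
    have X': "(\<lambda>n. X (n + N)) \<longlonglongrightarrow> t" using X by (rule LIMSEQ_ignore_initial_segment)
    have "(\<lambda>n. \<bar>heat_kernel (X (n + N)) x - heat_kernel t x\<bar>) \<longlonglongrightarrow> \<bar>heat_kernel t x - heat_kernel t x\<bar>" for x :: "real ^ 'n"
      unfolding heat_kernel_def using t by (intro tendsto_intros X') auto
    then show "AE x :: real ^ 'n in lborel. (\<lambda>n. \<bar>heat_kernel (X (n + N)) x - heat_kernel t x\<bar>) \<longlonglongrightarrow> 0" by simp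
    have "\<bar>heat_kernel (X (n + N)) x - heat_kernel t x\<bar> \<le> ?c * heat_kernel (2 * t) x" for n and x :: "real ^ 'n"
    proof -
      have "heat_kernel (X (n + N)) x \<le> 4 powr (real CARD('n) / 2) * heat_kernel (2 * t) x"
        using N[of "n + N"] by (intro heat_kernel_le_double[OF t]) auto
      moreover have "heat_kernel t x \<le> 4 powr (real CARD('n) / 2) * heat_kernel (2 * t) x"
        using t by (intro heat_kernel_le_double[OF t]) auto
      ultimately show ?thesis
        using heat_kernel_nonneg[of "X (n + N)" x] heat_kernel_nonneg[of t x] unfolding mult.assoc[of 2] by linarith
    qed
    then show "AE x :: real ^ 'n in lborel. norm (\<bar>heat_kernel (X (n + N)) x - heat_kernel t x\<bar>) \<le> ?c * heat_kernel (2 * t) x" for n by simp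
  qed measurable
  then have "(\<lambda>n. LINT x|lborel. \<bar>heat_kernel (X n) x - heat_kernel t (x :: real ^ 'n)\<bar>) \<longlonglongrightarrow> 0"
    by (simp add: LIMSEQ_offset[where k = N and f = "\<lambda>n. LINT x|lborel. \<bar>heat_kernel (X n) x - heat_kernel t (x :: real ^ 'n)\<bar>"])
  then show "((\<lambda>s. LINT x|lborel. \<bar>heat_kernel s x - heat_kernel t (x :: real ^ 'n)\<bar>) \<circ> X) \<longlonglongrightarrow> 0" by (simp add: o_def)
qed

subsection \<open>The heat semigroup on tempered distributions\<close>

lemma integral_lborel_reflect:
  fixes f :: "'a::euclidean_space \<Rightarrow> real"
  assumes [measurable]: "f \<in> borel_measurable borel"
  shows "(LINT x|lborel. f (c - x)) = (LINT x|lborel. f x)"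
proof -
  have "(LINT x|lborel. f x) = (LINT x|distr lborel borel (\<lambda>x. c + (-1) *\<^sub>R x). f x)"
    using lborel_affine[of "-1" c] by (simp add: density_1)
  then show ?thesis by (simp add: integral_distr)
qed

lemma conv_commute:
  assumes [measurable]: "f \<in> borel_measurable borel" "g \<in> borel_measurable borel"
  shows "conv f g = conv g f"
proof
  fix z
  show "conv f g z = conv g f z"
    unfolding conv_def using integral_lborel_reflect[of "\<lambda>y. f y * g (z - y)" z] by (simp add: mult.commute)
qed

text \<open>Nothing is asked of g, because s takes finitely many values. Thus the formula applies
  alike to g v = T(\<psi>(. - v)) and to g v = a derivative of \<psi> at z - v, which is what lets T
  pass through the sum.\<close>

lemma integral_comp_finite_range:
  fixes k :: "'a \<Rightarrow> real" and s :: "'a \<Rightarrow> 'b" and g :: "'b \<Rightarrow> real"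
  assumes k: "integrable M k" and s: "simple_function M s"
  shows "integrable M (\<lambda>y. k y * g (s y))"
    and "(LINT y|M. k y * g (s y)) = (\<Sum>v\<in>s ` space M. (LINT y|M. k y * indicator (s -` {v} \<inter> space M) y) * g v)"
proof -
  have fin: "finite (s ` space M)" using s by (simp add: simple_function_def)
  have sets: "s -` {v} \<inter> space M \<in> sets M" if "v \<in> s ` space M" for v using s that by (auto simp: simple_function_def)
  have i: "integrable M (\<lambda>y. k y * indicator (s -` {v} \<inter> space M) y * g v)" if "v \<in> s ` space M" for v
    by (intro integrable_mult_left integrable_real_mult_indicator sets that k)
  have eq: "k y * g (s y) = (\<Sum>v\<in>s ` space M. k y * indicator (s -` {v} \<inter> space M) y * g v)" if "y \<in> space M" for y
  proof -
    have "(\<Sum>v\<in>s ` space M. k y * indicator (s -` {v} \<inter> space M) y * g v) = (\<Sum>v\<in>s ` space M. if v = s y then k y * g v else 0)"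
      using that by (intro sum.cong) (auto simp: indicator_def)
    also have "\<dots> = k y * g (s y)" using fin that by (simp add: sum.delta)
    finally show ?thesis by simp
  qed
  show "integrable M (\<lambda>y. k y * g (s y))"
    by (subst Bochner_Integration.integrable_cong[OF refl eq]) (auto intro!: Bochner_Integration.integrable_sum i)
  show "(LINT y|M. k y * g (s y)) = (\<Sum>v\<in>s ` space M. (LINT y|M. k y * indicator (s -` {v} \<inter> space M) y) * g v)"
  proof (subst Bochner_Integration.integral_cong[OF refl eq])
    show "(LINT y|M. (\<Sum>v\<in>s ` space M. k y * indicator (s -` {v} \<inter> space M) y * g v))
       = (\<Sum>v\<in>s ` space M. (LINT y|M. k y * indicator (s -` {v} \<inter> space M) y) * g v)"
      by (subst Bochner_Integration.integral_sum[OF i]) auto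
  qed auto
qed

lemma tempered_translate_lipschitz:
  fixes T :: "'n::finite distr"
  assumes T: "tempered T" and \<psi>: "\<psi> \<in> schwartz"
  obtains C N where "0 \<le> C"
    "\<And>y v. \<bar>T (\<lambda>z. \<psi> (z - v)) - T (\<lambda>z. \<psi> (z - y))\<bar> \<le> C * ((1 + norm y + norm v) ^ N * norm (v - y))"
proof -
  obtain C N where C: "0 \<le> C" and T_le:
    "\<And>\<phi> b. \<phi> \<in> schwartz \<Longrightarrow> (\<And>is x. (1 + norm x) ^ N * \<bar>partials is \<phi> x\<bar> \<le> b is) \<Longrightarrow> \<bar>T \<phi>\<bar> \<le> C * (\<Sum>is | length is \<le> N. b is)"
    using tempered_bound[OF T] by blast
  obtain B where B: "\<And>is. 0 \<le> B is" "\<And>is z y v. (1 + norm z) ^ N * \<bar>partials is \<psi> (z - v) - partials is \<psi> (z - y)\<bar>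
        \<le> B is * (1 + norm y + norm v) ^ N * norm (v - y)"
    using schwartz_weighted_lipschitz_all[OF \<psi>] by blast
  show ?thesis
  proof (rule that[of "C * (\<Sum>is | length is \<le> N. B is)" N])
    show "0 \<le> C * (\<Sum>is | length is \<le> N. B is)" using C B(1) by (intro mult_nonneg_nonneg sum_nonneg) auto
    fix y v :: "real ^ 'n"
    have sv: "(\<lambda>z. \<psi> (z - v)) \<in> schwartz" "(\<lambda>z. \<psi> (z - y)) \<in> schwartz" by (intro schwartz_translate \<psi>)+
    have "\<bar>T (\<lambda>z. \<psi> (z - v) - \<psi> (z - y))\<bar> \<le> C * (\<Sum>is | length is \<le> N. B is * (1 + norm y + norm v) ^ N * norm (v - y))"
      by (rule T_le[OF schwartz_diff(1)[OF sv]])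
        (simp add: schwartz_diff(2)[OF sv] schwartz_translate(2)[OF \<psi>] B(2))
    then show "\<bar>T (\<lambda>z. \<psi> (z - v)) - T (\<lambda>z. \<psi> (z - y))\<bar> \<le> C * (\<Sum>is | length is \<le> N. B is) * ((1 + norm y + norm v) ^ N * norm (v - y))"
      unfolding tempered_diff[OF T sv] by (simp add: sum_distrib_right mult.assoc)
  qed
qed

lemma tempered_translate_continuous:
  fixes T :: "'n::finite distr"
  assumes T: "tempered T" and \<psi>: "\<psi> \<in> schwartz"
  shows "continuous_on UNIV (\<lambda>y. T (\<lambda>z. \<psi> (z - y)))"
proof -
  obtain C N where C: "0 \<le> C"
    "\<And>y v. \<bar>T (\<lambda>z. \<psi> (z - v)) - T (\<lambda>z. \<psi> (z - y))\<bar> \<le> C * ((1 + norm y + norm v) ^ N * norm (v - y))"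
    using tempered_translate_lipschitz[OF T \<psi>] by blast
  show ?thesis
    unfolding continuous_on_def
  proof
    fix y :: "real ^ 'n"
    have "((\<lambda>v. T (\<lambda>z. \<psi> (z - v)) - T (\<lambda>z. \<psi> (z - y))) \<longlongrightarrow> 0) (at y)"
    proof (rule Lim_null_comparison)
      show "\<forall>\<^sub>F v in at y. norm (T (\<lambda>z. \<psi> (z - v)) - T (\<lambda>z. \<psi> (z - y))) \<le> C * ((1 + norm y + norm v) ^ N * norm (v - y))"
        using C(2) by (intro always_eventually) auto
      have "((\<lambda>v. C * ((1 + norm y + norm v) ^ N * norm (v - y))) \<longlongrightarrow> C * ((1 + norm y + norm y) ^ N * norm (y - y))) (at y)"
        by (intro tendsto_intros)
      then show "((\<lambda>v. C * ((1 + norm y + norm v) ^ N * norm (v - y))) \<longlongrightarrow> 0) (at y)" by simp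
    qed
    then show "((\<lambda>y. T (\<lambda>z. \<psi> (z - y))) \<longlongrightarrow> T (\<lambda>z. \<psi> (z - y))) (at y within UNIV)" by (simp add: LIM_zero_iff)
  qed
qed

text \<open>A distribution is exchanged with an integral by replacing the translation parameter with
  simple functions \<open>s\<^sub>j \<rightarrow> id\<close>, for which the integral is a finite sum.\<close>

lemma tempered_conv:
  fixes T :: "'n::finite distr"
  assumes T: "tempered T" and \<psi>: "\<psi> \<in> schwartz" and k: "rapid k"
  shows "integrable lborel (\<lambda>y. k y * T (\<lambda>z. \<psi> (z - y)))"
    and "T (conv k \<psi>) = (LINT y|lborel. k y * T (\<lambda>z. \<psi> (z - y)))"
proof -
  have k_int: "integrable lborel k" by (rule rapid_integrable[OF k])
  have [measurable]: "k \<in> borel_measurable borel" using k by (simp add: rapid_def)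
  have [measurable]: "(\<lambda>y. T (\<lambda>z. \<psi> (z - y))) \<in> borel_measurable borel"
    by (rule borel_measurable_continuous_onI[OF tempered_translate_continuous[OF T \<psi>]])
  have kN: "integrable lborel (\<lambda>y. (1 + norm y) ^ N * \<bar>k y\<bar>)" for N :: nat
    using integrable_abs[of lborel "\<lambda>y. (1 + norm y) ^ N * k y"] k by (simp add: rapid_def abs_mult)
  obtain C1 N1 where C1: "0 \<le> C1"
    "\<And>y v. \<bar>T (\<lambda>z. \<psi> (z - v)) - T (\<lambda>z. \<psi> (z - y))\<bar> \<le> C1 * ((1 + norm y + norm v) ^ N1 * norm (v - y))"
    using tempered_translate_lipschitz[OF T \<psi>] by blast
  show int: "integrable lborel (\<lambda>y. k y * T (\<lambda>z. \<psi> (z - y)))"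
  proof (rule Bochner_Integration.integrable_bound)
    show "integrable lborel (\<lambda>y. \<bar>T \<psi>\<bar> * \<bar>k y\<bar> + C1 * ((1 + norm y) ^ Suc N1 * \<bar>k y\<bar>))"
      using k_int by (intro Bochner_Integration.integrable_add integrable_mult_right kN) auto
    have "\<bar>k y * T (\<lambda>z. \<psi> (z - y))\<bar> \<le> \<bar>T \<psi>\<bar> * \<bar>k y\<bar> + C1 * ((1 + norm y) ^ Suc N1 * \<bar>k y\<bar>)" for y
    proof -
      have "C1 * ((1 + norm y) ^ N1 * norm y) \<le> C1 * ((1 + norm y) ^ N1 * (1 + norm y))"
        using C1(1) by (intro mult_left_mono) auto
      then have "\<bar>T (\<lambda>z. \<psi> (z - y))\<bar> \<le> \<bar>T \<psi>\<bar> + C1 * (1 + norm y) ^ Suc N1"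
        using C1(2)[of y 0] by (simp add: mult_ac)
      then have "\<bar>k y\<bar> * \<bar>T (\<lambda>z. \<psi> (z - y))\<bar> \<le> \<bar>k y\<bar> * (\<bar>T \<psi>\<bar> + C1 * (1 + norm y) ^ Suc N1)"
        by (intro mult_left_mono) auto
      then show ?thesis by (simp add: abs_mult algebra_simps)
    qed
    then show "AE y in lborel. norm (k y * T (\<lambda>z. \<psi> (z - y))) \<le> norm (\<bar>T \<psi>\<bar> * \<bar>k y\<bar> + C1 * ((1 + norm y) ^ Suc N1 * \<bar>k y\<bar>))"
      by (auto intro!: order_trans[OF _ abs_ge_self])
  qed measurable
  have "(\<lambda>x :: real ^ 'n. x) \<in> borel_measurable lborel" by simp
  \<comment> \<open>Approximation relative to the base point 0 gives |s_j(x)| \<le> 2|x|; without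
    such a bound the polynomial weights in s_j would not be dominated.\<close>
  from borel_measurable_implies_sequence_metric[OF this, of 0]
  obtain s :: "nat \<Rightarrow> real ^ 'n \<Rightarrow> real ^ 'n" where s: "\<And>j. simple_function lborel (s j)" "\<And>x. (\<lambda>j. s j x) \<longlonglongrightarrow> x"
    and s2: "\<And>j x. norm (s j x) \<le> 2 * norm x" by auto
  have [measurable]: "s j \<in> borel_measurable borel" for j using borel_measurable_simple_function[OF s(1)] by simp
  \<comment> \<open>The common majorant of both exchange errors: its weight exponent is N1 for the
    growth of T on translates, and N for the order of T.\<close>
  define e where "e N j y = \<bar>k y\<bar> * ((1 + norm y + norm (s j y)) ^ N * norm (s j y - y))" for N :: nat and j y
  have e_meas[measurable]: "e N j \<in> borel_measurable borel" for N j unfolding e_def by measurable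
  have e_le: "\<bar>e N j y\<bar> \<le> 3 ^ Suc N * ((1 + norm y) ^ Suc N * \<bar>k y\<bar>)" for N j y
  proof -
    have "1 + norm y + norm (s j y) \<le> 3 * (1 + norm y)" using s2[of j y] by simp
    moreover have "norm (s j y - y) \<le> 3 * (1 + norm y)"
      using order_trans[OF norm_triangle_ineq4[of "s j y" y] add_right_mono[OF s2[of j y], of "norm y"]] by simp
    ultimately have "(1 + norm y + norm (s j y)) ^ N * norm (s j y - y) \<le> (3 * (1 + norm y)) ^ N * (3 * (1 + norm y))"
      by (intro mult_mono power_mono) auto
    then have "\<bar>k y\<bar> * ((1 + norm y + norm (s j y)) ^ N * norm (s j y - y)) \<le> \<bar>k y\<bar> * ((3 * (1 + norm y)) ^ N * (3 * (1 + norm y)))"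
      by (intro mult_left_mono) auto
    also have "\<bar>k y\<bar> * ((3 * (1 + norm y)) ^ N * (3 * (1 + norm y))) = 3 ^ Suc N * ((1 + norm y) ^ Suc N * \<bar>k y\<bar>)"
      by (simp only: power_mult_distrib power_Suc mult_ac)
    finally show ?thesis by (simp add: e_def abs_mult)
  qed
  have e_int: "integrable lborel (e N j)" for N j
    by (rule Bochner_Integration.integrable_bound[OF integrable_mult_right[OF kN, where c = "3 ^ Suc N"]])
      (use e_le in \<open>auto simp del: power_Suc intro!: order_trans[OF e_le abs_ge_self]\<close>)
  have e_lim: "(\<lambda>j. LINT y|lborel. e N j y) \<longlonglongrightarrow> 0" for N
  proof -
    have "(\<lambda>j. LINT y|lborel. e N j y) \<longlonglongrightarrow> (LINT y|(lborel :: (real ^ 'n) measure). 0)"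
    proof (rule integral_dominated_convergence[where w = "\<lambda>y. 3 ^ Suc N * ((1 + norm y) ^ Suc N * \<bar>k y\<bar>)"])
      have "(\<lambda>j. e N j y) \<longlonglongrightarrow> \<bar>k y\<bar> * ((1 + norm y + norm y) ^ N * norm (y - y))" for y
        unfolding e_def by (intro tendsto_intros s(2))
      then show "AE y in lborel. (\<lambda>j. e N j y) \<longlonglongrightarrow> 0" by simp
      show "integrable lborel (\<lambda>y. 3 ^ Suc N * ((1 + norm y) ^ Suc N * \<bar>k y\<bar>))" by (intro integrable_mult_right kN)
    qed (use e_le in auto)
    then show ?thesis by simp
  qed
  have I1: "\<bar>(LINT y|lborel. k y * T (\<lambda>z. \<psi> (z - s j y))) - (LINT y|lborel. k y * T (\<lambda>z. \<psi> (z - y)))\<bar> \<le> C1 * (LINT y|lborel. e N1 j y)" for j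
  proof -
    have i: "integrable lborel (\<lambda>y. k y * T (\<lambda>z. \<psi> (z - s j y)))"
      by (rule integral_comp_finite_range(1)[OF k_int s(1), where g = "\<lambda>v. T (\<lambda>z. \<psi> (z - v))"])
    have "(LINT y|lborel. k y * T (\<lambda>z. \<psi> (z - s j y))) - (LINT y|lborel. k y * T (\<lambda>z. \<psi> (z - y)))
       = (LINT y|lborel. k y * T (\<lambda>z. \<psi> (z - s j y)) - k y * T (\<lambda>z. \<psi> (z - y)))"
      using i int by simp
    also have "\<bar>\<dots>\<bar> \<le> (LINT y|lborel. C1 * e N1 j y)"
    proof (rule order_trans[OF integral_abs_bound integral_mono])
      show "integrable lborel (\<lambda>y. \<bar>k y * T (\<lambda>z. \<psi> (z - s j y)) - k y * T (\<lambda>z. \<psi> (z - y))\<bar>)" using i int by simp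
      show "integrable lborel (\<lambda>y. C1 * e N1 j y)" by (intro integrable_mult_right e_int)
      fix y
      have "\<bar>k y\<bar> * \<bar>T (\<lambda>z. \<psi> (z - s j y)) - T (\<lambda>z. \<psi> (z - y))\<bar> \<le> \<bar>k y\<bar> * (C1 * ((1 + norm y + norm (s j y)) ^ N1 * norm (s j y - y)))"
        by (intro mult_left_mono C1(2)) auto
      then show "\<bar>k y * T (\<lambda>z. \<psi> (z - s j y)) - k y * T (\<lambda>z. \<psi> (z - y))\<bar> \<le> C1 * e N1 j y"
        unfolding e_def right_diff_distrib[symmetric] abs_mult by (simp add: mult_ac)
    qed
    finally show ?thesis by simp
  qed
  obtain C N where C: "0 \<le> C" and T_le:
    "\<And>\<phi> b. \<phi> \<in> schwartz \<Longrightarrow> (\<And>is x. (1 + norm x) ^ N * \<bar>partials is \<phi> x\<bar> \<le> b is) \<Longrightarrow> \<bar>T \<phi>\<bar> \<le> C * (\<Sum>is | length is \<le> N. b is)"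
    using tempered_bound[OF T] by blast
  obtain B where B: "\<And>is. 0 \<le> B is" "\<And>is z y v. (1 + norm z) ^ N * \<bar>partials is \<psi> (z - v) - partials is \<psi> (z - y)\<bar>
        \<le> B is * (1 + norm y + norm v) ^ N * norm (v - y)"
    using schwartz_weighted_lipschitz_all[OF \<psi>] by blast
  define S where "S = (\<Sum>is | length is \<le> N. B is)"
  \<comment> \<open>For the finite-valued s_j the integral is T of a finite combination \<phi> of
    translates of \<psi>. This \<phi> approximates \<open>conv k \<psi>\<close> in the seminorm that
    controls T, since each derivative differs by at most a multiple of the integral of e.\<close>
  have I2: "\<bar>(LINT y|lborel. k y * T (\<lambda>z. \<psi> (z - s j y))) - T (conv k \<psi>)\<bar> \<le> C * S * (LINT y|lborel. e N j y)" for j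
  proof -
    define c where "c v = (LINT y|lborel. k y * indicator (s j -` {v} \<inter> space lborel) y)" for v
    let ?V = "s j ` space lborel"
    have fin: "finite ?V" using s(1)[of j] by (simp add: simple_function_def)
    have tr: "(\<lambda>z. \<psi> (z - v)) \<in> schwartz" for v by (rule schwartz_translate[OF \<psi>])
    define \<phi> where "\<phi> = (\<lambda>z. \<Sum>v\<in>?V. c v * \<psi> (z - v))"
    have \<phi>S: "\<phi> \<in> schwartz" "partials is \<phi> = (\<lambda>z. \<Sum>v\<in>?V. c v * partials is \<psi> (z - v))" for "is"
      using schwartz_sum[OF fin, where \<psi> = "\<lambda>v z. \<psi> (z - v)" and c = c] tr
      by (simp_all add: \<phi>_def schwartz_translate(2)[OF \<psi>])
    have "(LINT y|lborel. k y * T (\<lambda>z. \<psi> (z - s j y))) = (\<Sum>v\<in>?V. c v * T (\<lambda>z. \<psi> (z - v)))"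
      unfolding c_def by (rule integral_comp_finite_range(2)[OF k_int s(1), where g = "\<lambda>v. T (\<lambda>z. \<psi> (z - v))"])
    also have "\<dots> = T \<phi>" unfolding \<phi>_def by (rule tempered_sum[OF T fin tr, symmetric])
    finally have L: "(LINT y|lborel. k y * T (\<lambda>z. \<psi> (z - s j y))) = T \<phi>" .
    have cS: "conv k \<psi> \<in> schwartz" by (rule conv_schwartz(1)[OF k \<psi>])
    have "\<bar>T (\<lambda>z. \<phi> z - conv k \<psi> z)\<bar> \<le> C * (\<Sum>is | length is \<le> N. B is * (LINT y|lborel. e N j y))"
    proof (rule T_le[OF schwartz_diff(1)[OF \<phi>S(1) cS]])
      fix "is" :: "'n list" and z :: "real ^ 'n"
      have i: "integrable lborel (\<lambda>y. k y * partials is \<psi> (z - s j y))"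
        by (rule integral_comp_finite_range(1)[OF k_int s(1), where g = "\<lambda>v. partials is \<psi> (z - v)"])
      have i2: "integrable lborel (\<lambda>y. k y * partials is \<psi> (z - y))" by (rule conv_integrable[OF k_int \<psi>])
      have "partials is \<phi> z = (LINT y|lborel. k y * partials is \<psi> (z - s j y))"
        unfolding \<phi>S(2) c_def by (rule integral_comp_finite_range(2)[OF k_int s(1), where g = "\<lambda>v. partials is \<psi> (z - v)", symmetric])
      then have "(1 + norm z) ^ N * \<bar>partials is (\<lambda>z. \<phi> z - conv k \<psi> z) z\<bar>
         = \<bar>LINT y|lborel. (1 + norm z) ^ N * (k y * partials is \<psi> (z - s j y) - k y * partials is \<psi> (z - y))\<bar>"
        using i i2 unfolding schwartz_diff(2)[OF \<phi>S(1) cS] conv_schwartz(2)[OF k \<psi>] unfolding conv_def by (simp add: abs_mult)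
      also have "\<dots> \<le> (LINT y|lborel. B is * e N j y)"
      proof (rule order_trans[OF integral_abs_bound integral_mono])
        show "integrable lborel (\<lambda>y. \<bar>(1 + norm z) ^ N * (k y * partials is \<psi> (z - s j y) - k y * partials is \<psi> (z - y))\<bar>)" using i i2 by simp
        show "integrable lborel (\<lambda>y. B is * e N j y)" by (intro integrable_mult_right e_int)
        fix y
        have "\<bar>k y\<bar> * ((1 + norm z) ^ N * \<bar>partials is \<psi> (z - s j y) - partials is \<psi> (z - y)\<bar>)
           \<le> \<bar>k y\<bar> * (B is * (1 + norm y + norm (s j y)) ^ N * norm (s j y - y))"
          by (intro mult_left_mono B(2)) auto
        then show "\<bar>(1 + norm z) ^ N * (k y * partials is \<psi> (z - s j y) - k y * partials is \<psi> (z - y))\<bar> \<le> B is * e N j y"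
          unfolding e_def right_diff_distrib[symmetric] abs_mult by (simp add: mult_ac)
      qed
      finally show "(1 + norm z) ^ N * \<bar>partials is (\<lambda>z. \<phi> z - conv k \<psi> z) z\<bar> \<le> B is * (LINT y|lborel. e N j y)" by simp
    qed
    then show ?thesis unfolding L tempered_diff[OF T \<phi>S(1) cS] S_def by (simp add: sum_distrib_right mult.assoc)
  qed
  define D where "D = \<bar>T (conv k \<psi>) - (LINT y|lborel. k y * T (\<lambda>z. \<psi> (z - y)))\<bar>"
  have le: "D \<le> C * S * (LINT y|lborel. e N j y) + C1 * (LINT y|lborel. e N1 j y)" for j
    unfolding D_def using I1[of j] I2[of j] by linarith
  have "(\<lambda>j. C * S * (LINT y|lborel. e N j y) + C1 * (LINT y|lborel. e N1 j y)) \<longlonglongrightarrow> C * S * 0 + C1 * 0"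
    by (intro tendsto_intros e_lim)
  then have "D \<le> C * S * 0 + C1 * 0" by (rule tendsto_lowerbound) (use le in auto)
  then show "T (conv k \<psi>) = (LINT y|lborel. k y * T (\<lambda>z. \<psi> (z - y)))" by (simp add: D_def)
qed

lemma heat_kernel_commute: "heat_kernel t (x - y) = heat_kernel t (y - x)"
  using heat_kernel_minus[of t "y - x"] by simp

lemma heat_eq: "heat t v x = v (\<lambda>z. heat_kernel t (z - x))"
  by (simp add: heat_def heat_kernel_commute[of t x])

lemma heat_continuous: "tempered T \<Longrightarrow> 0 < t \<Longrightarrow> continuous_on UNIV (heat t T)"
  unfolding heat_eq[abs_def] by (intro tempered_translate_continuous heat_kernel_schwartz)

lemma heat_borel: "tempered T \<Longrightarrow> 0 < t \<Longrightarrow> heat t T \<in> borel_measurable borel"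
  by (intro borel_measurable_continuous_onI heat_continuous)

text \<open>\<open>tempered_conv\<close> with \<phi> as the decaying kernel and G as the translated
  test function, so that T is evaluated on translates of G only, which is the heat extension of
  T.\<close>

lemma tempered_conv_heat_kernel:
  fixes T :: "'n::finite distr"
  assumes "tempered T" "0 < t" "\<phi> \<in> schwartz"
  shows "integrable lborel (\<lambda>y. heat t T y * \<phi> y)"
    and "T (conv \<phi> (heat_kernel t)) = (LINT y|lborel. heat t T y * \<phi> y)"
  using tempered_conv[OF assms(1) heat_kernel_schwartz[OF assms(2)] schwartz_rapid[OF assms(3)]]
  by (simp_all add: heat_eq mult.commute)

lemma heat_kernel_translate_schwartz:
  assumes "0 < s"
  shows "(\<lambda>y. heat_kernel s (y - x :: real ^ 'n)) \<in> schwartz" "(\<lambda>y. heat_kernel s (x - y :: real ^ 'n)) \<in> schwartz"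
proof -
  show 1: "(\<lambda>y. heat_kernel s (y - x :: real ^ 'n)) \<in> schwartz"
    by (rule schwartz_translate(1)[OF heat_kernel_schwartz[OF assms]])
  then show "(\<lambda>y. heat_kernel s (x - y :: real ^ 'n)) \<in> schwartz"
    by (simp add: heat_kernel_commute[of s x])
qed

lemma heat_semigroup:
  fixes T :: "'n::finite distr"
  assumes T: "tempered T" and s: "0 < s" and t: "0 < t"
  shows "integrable lborel (\<lambda>y. heat t T y * heat_kernel s (x - y))"
    and "(LINT y|lborel. heat t T y * heat_kernel s (x - y)) = heat (s + t) T x"
proof -
  note S = heat_kernel_translate_schwartz(2)[OF s, of x]
  show "integrable lborel (\<lambda>y. heat t T y * heat_kernel s (x - y))"
    by (rule tempered_conv_heat_kernel(1)[OF T t S])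
  have "conv (\<lambda>y. heat_kernel s (x - y)) (heat_kernel t) = (\<lambda>z. heat_kernel (s + t) (z - x))"
  proof
    fix z
    have "conv (\<lambda>y. heat_kernel s (x - y)) (heat_kernel t) z = (LINT y|lborel. heat_kernel s (x - y) * heat_kernel t (y - z))"
      unfolding conv_def heat_kernel_commute[of t z] ..
    also have "\<dots> = heat_kernel (s + t) (z - x)"
      by (simp add: heat_kernel_semigroup(2)[OF s t] heat_kernel_commute[of _ z])
    finally show "conv (\<lambda>y. heat_kernel s (x - y)) (heat_kernel t) z = heat_kernel (s + t) (z - x)" .
  qed
  then show "(LINT y|lborel. heat t T y * heat_kernel s (x - y)) = heat (s + t) T x"
    using tempered_conv_heat_kernel(2)[OF T t S] by (simp add: heat_eq)
qed

text \<open>For t > r > 0 the semigroup law expresses the heat extension at time t as an integral of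
  the fixed continuous function at time r against a kernel; such integrals are jointly measurable.
  With r = r_k decreasing to 0 the approximants are eventually constant at each point.\<close>

lemma heat_jointly_measurable:
  fixes T :: "'n::finite distr"
  assumes T: "tempered T"
  shows "(\<lambda>p. indicator {0<..} (fst p) * heat (fst p) T (snd p)) \<in> borel_measurable (borel :: (real \<times> (real ^ 'n)) measure)"
proof (rule borel_measurable_LIMSEQ_real)
  define r where "r k = inverse (real (Suc k))" for k
  have r: "r k > 0" for k by (simp add: r_def)
  define h where "h k = (\<lambda>p :: real \<times> (real ^ 'n). indicator {r k<..} (fst p) *
      (LINT y|lborel. heat (r k) T y * heat_kernel (fst p - r k) (snd p - y)))" for k
  show "h k \<in> borel_measurable borel" for k
  proof -
    note [measurable] = heat_borel[OF T r]
    have "(\<lambda>p. LINT y|lborel. heat (r k) T y * heat_kernel (fst p - r k) (snd p - y)) \<in> borel_measurable (borel :: (real \<times> (real ^ 'n)) measure)"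
      unfolding borel_prod[symmetric] by measurable
    then show ?thesis unfolding h_def borel_prod[symmetric] by measurable
  qed
  fix p :: "real \<times> (real ^ 'n)"
  have h_eq: "h k p = indicator {r k<..} (fst p) * heat (fst p) T (snd p)" for k
    using heat_semigroup(2)[OF T _ r, where s = "fst p - r k" and x = "snd p"] by (auto simp: h_def indicator_def)
  have "\<forall>\<^sub>F k in sequentially. h k p = indicator {0<..} (fst p) * heat (fst p) T (snd p)"
  proof (cases "fst p > 0")
    case True
    have "r \<longlonglongrightarrow> 0" unfolding r_def by (rule LIMSEQ_inverse_real_of_nat)
    then have "\<forall>\<^sub>F k in sequentially. r k < fst p" using True by (rule order_tendstoD)
    then show ?thesis by (rule eventually_mono) (use True in \<open>simp add: h_eq\<close>)
  next
    case False
    then have "\<not> r k < fst p" for k using r[of k] by linarith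
    then show ?thesis using False by (auto simp: h_eq indicator_def)
  qed
  then show "(\<lambda>k. h k p) \<longlonglongrightarrow> indicator {0<..} (fst p) * heat (fst p) T (snd p)"
    by (rule tendsto_eventually)
qed

section \<open>Behaviour at the initial time\<close>

lemma heat_kernel_moment_bound:
  obtains C where "0 \<le> C" "\<And>t. 0 < t \<Longrightarrow> t \<le> 1 \<Longrightarrow>
    integrable lborel (\<lambda>y :: real ^ 'n. heat_kernel t y * ((1 + norm y) ^ N * norm y)) \<and>
    (LINT y|lborel. heat_kernel t (y :: real ^ 'n) * ((1 + norm y) ^ N * norm y)) \<le> C * t powr (1 / 2)"
proof -
  obtain B where B: "0 \<le> B" "\<And>t (x :: real ^ 'n). 0 < t \<Longrightarrow> t \<le> 2 \<Longrightarrow> (1 + norm x) ^ N * heat_kernel t x \<le> B * heat_kernel (2 * t) x"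
    using heat_kernel_weighted_le[of 2 N] by auto
  let ?c = "2 * 2 powr (real CARD('n) / 2)"
  show ?thesis
  proof (rule that[of "?c * B"])
    fix t :: real assume t: "0 < t" "t \<le> 1"
    have le: "heat_kernel t y * ((1 + norm y) ^ N * norm y) \<le> ?c * B * t powr (1 / 2) * heat_kernel (4 * t) y" for y :: "real ^ 'n"
    proof -
      have "heat_kernel t y * ((1 + norm y) ^ N * norm y) = (1 + norm y) ^ N * (norm y * heat_kernel t y)" by simp
      also have "\<dots> \<le> (1 + norm y) ^ N * (2 * t powr (1 / 2) * 2 powr (real CARD('n) / 2) * heat_kernel (2 * t) y)"
        by (intro mult_left_mono norm_heat_kernel_le t) auto
      also have "\<dots> = ?c * t powr (1 / 2) * ((1 + norm y) ^ N * heat_kernel (2 * t) y)" by simp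
      also have "\<dots> \<le> ?c * t powr (1 / 2) * (B * heat_kernel (2 * (2 * t)) y)"
        using t by (intro mult_left_mono B) auto
      finally show ?thesis by (simp add: mult_ac)
    qed
    have i: "integrable lborel (\<lambda>y :: real ^ 'n. ?c * B * t powr (1 / 2) * heat_kernel (4 * t) y)"
      using t by (intro integrable_mult_right heat_kernel_integrable) auto
    have i2: "integrable lborel (\<lambda>y :: real ^ 'n. heat_kernel t y * ((1 + norm y) ^ N * norm y))"
      by (rule Bochner_Integration.integrable_bound[OF i]) (auto intro!: order_trans[OF le abs_ge_self])
    have "(LINT y|lborel. heat_kernel t (y :: real ^ 'n) * ((1 + norm y) ^ N * norm y)) \<le> (LINT y|lborel. ?c * B * t powr (1 / 2) * heat_kernel (4 * t) (y :: real ^ 'n))"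
      by (intro integral_mono i i2 le)
    also have "\<dots> = ?c * B * t powr (1 / 2)" using t by (simp add: integral_heat_kernel)
    finally show "integrable lborel (\<lambda>y :: real ^ 'n. heat_kernel t y * ((1 + norm y) ^ N * norm y)) \<and>
       (LINT y|lborel. heat_kernel t (y :: real ^ 'n) * ((1 + norm y) ^ N * norm y)) \<le> ?c * B * t powr (1 / 2)" using i2 by simp
  qed (use B in simp)
qed

text \<open>After moving the heat kernel onto \<phi>, the weighted Lipschitz estimate bounds G *
  \<phi> - \<phi> in the seminorm of T by a moment of G, which is of order t^(1/2).\<close>

lemma tempered_heat_initial:
  fixes T :: "'n::finite distr"
  assumes T: "tempered T" and \<phi>: "\<phi> \<in> schwartz"
  shows "((\<lambda>t. LINT y|lborel. heat t T y * \<phi> y) \<longlongrightarrow> T \<phi>) (at_right 0)"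
proof -
  obtain C N where C: "0 \<le> C" and T_le:
    "\<And>\<phi> b. \<phi> \<in> schwartz \<Longrightarrow> (\<And>is x. (1 + norm x) ^ N * \<bar>partials is \<phi> x\<bar> \<le> b is) \<Longrightarrow> \<bar>T \<phi>\<bar> \<le> C * (\<Sum>is | length is \<le> N. b is)"
    using tempered_bound[OF T] by blast
  obtain B where B: "\<And>is. 0 \<le> B is" "\<And>is z y v. (1 + norm z) ^ N * \<bar>partials is \<phi> (z - v) - partials is \<phi> (z - y)\<bar>
        \<le> B is * (1 + norm y + norm v) ^ N * norm (v - y)"
    using schwartz_weighted_lipschitz_all[OF \<phi>] by blast
  obtain A where A: "0 \<le> A" "\<And>t. 0 < t \<Longrightarrow> t \<le> 1 \<Longrightarrow>
    integrable lborel (\<lambda>y :: real ^ 'n. heat_kernel t y * ((1 + norm y) ^ N * norm y)) \<and>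
    (LINT y|lborel. heat_kernel t (y :: real ^ 'n) * ((1 + norm y) ^ N * norm y)) \<le> A * t powr (1 / 2)"
    using heat_kernel_moment_bound[of N] by blast
  define S where "S = (\<Sum>is :: 'n list | length is \<le> N. B is)"
  have bound: "\<bar>(LINT y|lborel. heat t T y * \<phi> y) - T \<phi>\<bar> \<le> C * S * A * t powr (1 / 2)" if t: "0 < t" "t \<le> 1" for t
  proof -
    have comm: "conv \<phi> (heat_kernel t) = conv (heat_kernel t) \<phi>"
      by (rule conv_commute) (use schwartz_measurable0[OF \<phi>] in auto)
    have cS: "conv (heat_kernel t) \<phi> \<in> schwartz" by (rule conv_schwartz(1)[OF heat_kernel_rapid[OF t(1)] \<phi>])
    have "\<bar>T (\<lambda>z. conv (heat_kernel t) \<phi> z - \<phi> z)\<bar> \<le> C * (\<Sum>is | length is \<le> N. B is * (A * t powr (1 / 2)))"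
    proof (rule T_le[OF schwartz_diff(1)[OF cS \<phi>]])
      fix "is" :: "'n list" and z :: "real ^ 'n"
      have i: "integrable lborel (\<lambda>y. heat_kernel t y * partials is \<phi> (z - y))"
        by (rule conv_integrable[OF heat_kernel_integrable[OF t(1)] \<phi>])
      have i2: "integrable lborel (\<lambda>y :: real ^ 'n. heat_kernel t y * partials is \<phi> z)"
        by (rule integrable_mult_left[OF heat_kernel_integrable[OF t(1)]])
      have ig: "(LINT y|lborel. heat_kernel t (y :: real ^ 'n) * partials is \<phi> z) = partials is \<phi> z"
        using integral_heat_kernel[OF t(1), where 'n = 'n] by simp
      have "partials is (\<lambda>z. conv (heat_kernel t) \<phi> z - \<phi> z) z
         = (LINT y|lborel. heat_kernel t y * partials is \<phi> (z - y) - heat_kernel t y * partials is \<phi> z)"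
        unfolding schwartz_diff(2)[OF cS \<phi>] conv_schwartz(2)[OF heat_kernel_rapid[OF t(1)] \<phi>]
        unfolding conv_def Bochner_Integration.integral_diff[OF i i2] ig ..
      then have "(1 + norm z) ^ N * \<bar>partials is (\<lambda>z. conv (heat_kernel t) \<phi> z - \<phi> z) z\<bar>
         = \<bar>LINT y|lborel. (1 + norm z) ^ N * (heat_kernel t y * partials is \<phi> (z - y) - heat_kernel t y * partials is \<phi> z)\<bar>"
        by (simp only: integral_mult_right_zero abs_mult) simp
      also have "\<dots> \<le> (LINT y|lborel. B is * (heat_kernel t (y :: real ^ 'n) * ((1 + norm y) ^ N * norm y)))"
      proof (rule order_trans[OF integral_abs_bound integral_mono])
        show "integrable lborel (\<lambda>y. \<bar>(1 + norm z) ^ N * (heat_kernel t y * partials is \<phi> (z - y) - heat_kernel t y * partials is \<phi> z)\<bar>)" using i i2 by simp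
        show "integrable lborel (\<lambda>y :: real ^ 'n. B is * (heat_kernel t y * ((1 + norm y) ^ N * norm y)))"
          using A(2)[OF t] by (intro integrable_mult_right) auto
        fix y :: "real ^ 'n"
        have "heat_kernel t y * ((1 + norm z) ^ N * \<bar>partials is \<phi> (z - y) - partials is \<phi> (z - 0)\<bar>)
           \<le> heat_kernel t y * (B is * (1 + norm (0 :: real ^ 'n) + norm y) ^ N * norm (y - 0))"
          by (intro mult_left_mono B(2)) auto
        then show "\<bar>(1 + norm z) ^ N * (heat_kernel t y * partials is \<phi> (z - y) - heat_kernel t y * partials is \<phi> z)\<bar>
           \<le> B is * (heat_kernel t y * ((1 + norm y) ^ N * norm y))"
          unfolding right_diff_distrib[symmetric] abs_mult by (simp add: mult_ac)
      qed
      also have "\<dots> \<le> B is * (A * t powr (1 / 2))" using A(2)[OF t] B(1) by (simp add: mult_left_mono)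
      finally show "(1 + norm z) ^ N * \<bar>partials is (\<lambda>z. conv (heat_kernel t) \<phi> z - \<phi> z) z\<bar> \<le> B is * (A * t powr (1 / 2))" .
    qed
    then show ?thesis
      unfolding tempered_diff[OF T cS \<phi>] tempered_conv_heat_kernel(2)[OF T t(1) \<phi>, symmetric] comm S_def
      by (simp add: sum_distrib_right mult.assoc)
  qed
  have "((\<lambda>t. (LINT y|lborel. heat t T y * \<phi> y) - T \<phi>) \<longlongrightarrow> 0) (at_right 0)"
  proof (rule Lim_null_comparison)
    have "\<forall>\<^sub>F t in at_right 0. 0 < t \<and> t \<le> (1::real)"
      by (auto simp: eventually_at_right_field intro: exI[of _ 1])
    then show "\<forall>\<^sub>F t in at_right 0. norm ((LINT y|lborel. heat t T y * \<phi> y) - T \<phi>) \<le> C * S * A * t powr (1 / 2)"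
      by eventually_elim (use bound in auto)
    have "((\<lambda>t::real. C * S * A * t powr (1 / 2)) \<longlongrightarrow> C * S * A * 0 powr (1 / 2)) (at_right 0)"
      by (intro tendsto_intros) (auto simp: eventually_at_filter)
    then show "((\<lambda>t::real. C * S * A * t powr (1 / 2)) \<longlongrightarrow> 0) (at_right 0)" by simp
  qed
  then show ?thesis by (simp add: LIM_zero_iff)
qed

subsection \<open>Duality and representing functions\<close>

text \<open>Young's inequality for L^1 and L^q, as Minkowski's inequality for an average of
  translates of c, all of norm at most b.\<close>

lemma Lq_le_conv:
  fixes k c :: "real ^ 'n \<Rightarrow> real"
  assumes k: "k \<in> borel_measurable borel" "(\<integral>\<^sup>+y. ennreal \<bar>k y\<bar> \<partial>lborel) \<le> ennreal A" "0 \<le> A"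
    and c: "Lq_le q c b" "0 \<le> b" and q: "1 \<le> q"
  shows "Lq_le q (conv k c) (A * b)"
  unfolding conv_def[abs_def]
proof (rule minkowski_integral(3)[where \<kappa> = "\<lambda>y. \<bar>k y\<bar> * b"])
  have [measurable]: "k \<in> borel_measurable borel" "c \<in> borel_measurable borel"
    using k c by (auto simp: Lq_le_def)
  show "sigma_finite_measure (lborel :: (real ^ 'n) measure)" by (rule lborel.sigma_finite_measure_axioms)
  show "(\<lambda>(y, x). k y * c (x - y)) \<in> borel_measurable (lborel \<Otimes>\<^sub>M borel)" by measurable
  have "(\<integral>\<^sup>+y. ennreal (\<bar>k y\<bar> * b) \<partial>lborel) = (\<integral>\<^sup>+y. ennreal \<bar>k y\<bar> \<partial>lborel) * ennreal b"
    using c by (simp add: ennreal_mult nn_integral_multc)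
  also have "\<dots> \<le> ennreal A * ennreal b" by (intro mult_right_mono k) auto
  finally show "(\<integral>\<^sup>+y. ennreal (\<bar>k y\<bar> * b) \<partial>lborel) \<le> ennreal (A * b)" using k c by (simp add: ennreal_mult)
  have "(\<integral>\<^sup>+x. ennreal (\<bar>k y * c (x - y)\<bar> powr q) \<partial>lborel) \<le> ennreal ((\<bar>k y\<bar> * b) powr q)" for y
  proof -
    have "(\<integral>\<^sup>+x. ennreal (\<bar>k y * c (x - y)\<bar> powr q) \<partial>lborel) = ennreal (\<bar>k y\<bar> powr q) * (\<integral>\<^sup>+x. ennreal (\<bar>c (x - y)\<bar> powr q) \<partial>lborel)"
      by (simp add: nn_integral_cmult[symmetric] abs_mult powr_mult ennreal_mult)
    also have "(\<integral>\<^sup>+x. ennreal (\<bar>c (x - y)\<bar> powr q) \<partial>lborel) = (\<integral>\<^sup>+x. ennreal (\<bar>c x\<bar> powr q) \<partial>lborel)"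
      by (rule nn_integral_lborel_translate(1)) measurable
    also have "ennreal (\<bar>k y\<bar> powr q) * \<dots> \<le> ennreal (\<bar>k y\<bar> powr q) * ennreal (b powr q)"
      using c by (intro mult_left_mono) (auto simp: Lq_le_def)
    finally show ?thesis using c by (simp add: powr_mult ennreal_mult)
  qed
  then show "AE y in lborel. (\<integral>\<^sup>+x. ennreal (\<bar>k y * c (x - y)\<bar> powr q) \<partial>lborel) \<le> ennreal ((\<bar>k y\<bar> * b) powr q)"
    by simp
  show "(\<lambda>y. \<bar>k y\<bar> * b) \<in> borel_measurable lborel" by measurable
qed (use k c q in auto)

lemma Lq_le_of_integrable:
  assumes "integrable lborel (\<lambda>x. \<bar>h x\<bar> powr p)" "h \<in> borel_measurable borel" "0 < p"
  shows "Lq_le p h ((LINT x|lborel. \<bar>h x\<bar> powr p) powr (1 / p))"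
  unfolding Lq_le_def using assms by (subst nn_integral_eq_integral) (auto simp: powr_powr)

lemma indicator_cball_integrable: "integrable lborel (indicator (cball 0 R) :: 'a::euclidean_space \<Rightarrow> real)"
  using emeasure_bounded_finite[of "cball (0::'a) R"] by (intro integrable_real_indicator) auto

lemma rapid_compact_support:
  fixes c :: "real ^ 'n \<Rightarrow> real"
  assumes c: "c \<in> borel_measurable borel" "\<And>x. \<bar>c x\<bar> \<le> m" "\<And>x. R < norm x \<Longrightarrow> c x = 0"
  shows "rapid c"
  unfolding rapid_def
proof (intro conjI allI c)
  fix N :: nat
  have m: "0 \<le> m" using c(2)[of 0] by linarith
  have "norm ((1 + norm y) ^ N * c y) \<le> norm ((1 + \<bar>R\<bar>) ^ N * m * indicator (cball 0 R) y)" for y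
  proof (cases "norm y \<le> R")
    case True
    have "(1 + norm y) ^ N * \<bar>c y\<bar> \<le> (1 + \<bar>R\<bar>) ^ N * m"
      using True c(2)[of y] by (intro mult_mono power_mono) auto
    then show ?thesis using True m by (simp add: abs_mult)
  qed (use c in auto)
  then show "integrable lborel (\<lambda>y. (1 + norm y) ^ N * c y)"
    using c by (intro Bochner_Integration.integrable_bound[OF integrable_mult_right[OF indicator_cball_integrable]]) auto
qed

section \<open>Mollification by the heat kernel\<close>

lemma conv_heat_kernel_pointwise:
  fixes c :: "real ^ 'n \<Rightarrow> real"
  assumes c: "continuous_on UNIV c" "\<And>x. \<bar>c x\<bar> \<le> m"
  shows "((\<lambda>s. conv (heat_kernel s) c x) \<longlongrightarrow> c x) (at_right 0)"
proof -
  have [measurable]: "c \<in> borel_measurable borel" by (rule borel_measurable_continuous_onI[OF c(1)])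
  obtain C where C: "0 \<le> C" "\<And>t. 0 < t \<Longrightarrow> t \<le> 1 \<Longrightarrow>
    integrable lborel (\<lambda>y :: real ^ 'n. heat_kernel t y * ((1 + norm y) ^ 0 * norm y)) \<and>
    (LINT y|lborel. heat_kernel t (y :: real ^ 'n) * ((1 + norm y) ^ 0 * norm y)) \<le> C * t powr (1 / 2)"
    using heat_kernel_moment_bound[of 0] by blast
  show ?thesis
  proof (rule tendstoI)
    fix e :: real assume e: "0 < e"
    have "isCont c x" using c(1) by (simp add: continuous_on_eq_continuous_at)
    then obtain d where d: "0 < d" "\<And>y. dist y x < d \<Longrightarrow> dist (c y) (c x) < e / 2"
      using e unfolding continuous_at_eps_delta by (metis half_gt_zero)
    \<comment> \<open>Continuity of c at x is recast as |c(x-y) - c(x)| \<le> e/2 + L|y|: beyond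
      distance d the oscillation 2m is at most L|y|. The first moment of the kernel, of order
      s^(1/2), then finishes the estimate.\<close>
    define L where "L = 2 * m / d"
    have m: "0 \<le> m" using c(2)[of 0] by linarith
    have L: "0 \<le> L" using m d by (simp add: L_def)
    have cle: "\<bar>c (x - y) - c x\<bar> \<le> e / 2 + L * norm y" for y
    proof (cases "norm y < d")
      case True
      then have "dist (c (x - y)) (c x) < e / 2" by (intro d(2)) (simp add: dist_norm)
      then show ?thesis using L by (simp add: dist_real_def add_increasing2)
    next
      case False
      have "\<bar>c (x - y) - c x\<bar> \<le> 2 * m" using c(2)[of "x - y"] c(2)[of x] by linarith
      also have "2 * m * 1 \<le> 2 * m * (norm y / d)" using False d m by (intro mult_left_mono) auto
      finally show ?thesis using e by (simp add: L_def)
    qed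
    have le: "\<bar>conv (heat_kernel s) c x - c x\<bar> \<le> e / 2 + L * (C * s powr (1 / 2))" if s: "0 < s" "s \<le> 1" for s
    proof -
      have i1: "integrable lborel (\<lambda>y. heat_kernel s y * c (x - y))"
        by (rule integrable_mult_bounded[OF heat_kernel_integrable[OF s(1)] _ c(2)]) measurable
      have i2: "integrable lborel (\<lambda>y. heat_kernel s y * c x)"
        by (rule integrable_mult_left[OF heat_kernel_integrable[OF s(1)]])
      have i3: "integrable lborel (\<lambda>y :: real ^ 'n. (e / 2) * heat_kernel s y + L * (heat_kernel s y * ((1 + norm y) ^ 0 * norm y)))"
        using C(2)[OF s] heat_kernel_integrable[OF s(1)]
        by (intro Bochner_Integration.integrable_add integrable_mult_right) auto
      have "conv (heat_kernel s) c x - c x = (LINT y|lborel. heat_kernel s y * c (x - y) - heat_kernel s y * c x)"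
        unfolding Bochner_Integration.integral_diff[OF i1 i2] conv_def
        using integral_heat_kernel[OF s(1), where 'n = 'n] by simp
      also have "\<bar>\<dots>\<bar> \<le> (LINT y|lborel. (e / 2) * heat_kernel s (y :: real ^ 'n) + L * (heat_kernel s y * ((1 + norm y) ^ 0 * norm y)))"
      proof (rule order_trans[OF integral_abs_bound integral_mono])
        show "integrable lborel (\<lambda>y. \<bar>heat_kernel s y * c (x - y) - heat_kernel s y * c x\<bar>)"
          by (rule integrable_abs[OF Bochner_Integration.integrable_diff[OF i1 i2]])
        fix y :: "real ^ 'n"
        have "heat_kernel s y * \<bar>c (x - y) - c x\<bar> \<le> heat_kernel s y * (e / 2 + L * norm y)"
          by (intro mult_left_mono cle) auto
        then show "\<bar>heat_kernel s y * c (x - y) - heat_kernel s y * c x\<bar> \<le> (e / 2) * heat_kernel s y + L * (heat_kernel s y * ((1 + norm y) ^ 0 * norm y))"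
          unfolding right_diff_distrib[symmetric] abs_mult by (simp add: algebra_simps)
      qed (rule i3)
      also have "\<dots> = e / 2 + L * (LINT y|lborel. heat_kernel s (y :: real ^ 'n) * ((1 + norm y) ^ 0 * norm y))"
        using C(2)[OF s] heat_kernel_integrable[OF s(1), where 'n = 'n] integral_heat_kernel[OF s(1), where 'n = 'n]
        by (subst Bochner_Integration.integral_add) auto
      also have "\<dots> \<le> e / 2 + L * (C * s powr (1 / 2))" using C(2)[OF s] L by (intro add_left_mono mult_left_mono) auto
      finally show ?thesis .
    qed
    have "((\<lambda>s. e / 2 + L * (C * s powr (1 / 2))) \<longlongrightarrow> e / 2 + L * (C * 0 powr (1 / 2))) (at_right 0)"
      by (intro tendsto_intros) (auto simp: eventually_at_filter)
    then have "\<forall>\<^sub>F s in at_right 0. e / 2 + L * (C * s powr (1 / 2)) < e"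
      by (rule order_tendstoD(2)) (use e in auto)
    moreover have "\<forall>\<^sub>F s in at_right 0. 0 < s \<and> s \<le> (1::real)"
      by (auto simp: eventually_at_right_field intro: exI[of _ 1])
    ultimately show "\<forall>\<^sub>F s in at_right 0. dist (conv (heat_kernel s) c x) (c x) < e"
    proof eventually_elim
      case (elim s)
      then show ?case using le[of s] by (simp add: dist_real_def)
    qed
  qed
qed

lemma heat_kernel_gauss_weight:
  assumes "0 < s" "s \<le> 1"
  shows "exp ((norm z)\<^sup>2 / 16) * heat_kernel s (z :: real ^ 'n) \<le> 2 powr (real CARD('n) / 2) * heat_kernel (2 * s) z"
proof -
  have "(norm z)\<^sup>2 / 16 \<le> (norm z)\<^sup>2 / (8 * s)" using assms by (intro divide_left_mono) auto
  then have "exp ((norm z)\<^sup>2 / 16) * exp (- ((norm z)\<^sup>2 / (8 * s))) \<le> 1"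
    unfolding exp_add[symmetric] by simp
  then have "(exp ((norm z)\<^sup>2 / 16) * exp (- ((norm z)\<^sup>2 / (8 * s)))) * (2 powr (real CARD('n) / 2) * heat_kernel (2 * s) z)
     \<le> 1 * (2 powr (real CARD('n) / 2) * heat_kernel (2 * s) z)" by (intro mult_right_mono) auto
  then show ?thesis by (subst heat_kernel_double[OF assms(1)]) (simp add: mult_ac)
qed

text \<open>Dominated convergence against f needs a majorant that is itself a Schwartz function,
  because integrability of f is known only against those. If |x-y| \<le> R, then |x|^2/32 \<le>
  R^2/16 + |y|^2/16, and the last exponential is absorbed by the kernel for s \<le> 1. Time 8 is the
  one whose Gaussian is exp(-|x|^2/32).\<close>

lemma conv_heat_kernel_dominated:
  fixes c :: "real ^ 'n \<Rightarrow> real"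
  assumes c: "c \<in> borel_measurable borel" "\<And>x. \<bar>c x\<bar> \<le> m" "\<And>x. R < norm x \<Longrightarrow> c x = 0"
  obtains C where "\<And>s x. 0 < s \<Longrightarrow> s \<le> 1 \<Longrightarrow> \<bar>conv (heat_kernel s) c x\<bar> \<le> C * heat_kernel 8 x"
proof
  let ?w = "\<lambda>x :: real ^ 'n. exp ((norm x)\<^sup>2 / 32)"
  define D where "D = m * exp (R\<^sup>2 / 16) * 2 powr (real CARD('n) / 2)"
  fix s x assume s: "0 < s" "s \<le> (1::real)"
  have m: "0 \<le> m" using c(2)[of 0] by linarith
  have le: "?w x * \<bar>heat_kernel s y * c (x - y)\<bar> \<le> D * heat_kernel (2 * s) y" for y
  proof (cases "norm (x - y) \<le> R")
    case True
    have "(norm x)\<^sup>2 \<le> (norm (x - y) + norm y)\<^sup>2"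
      using norm_triangle_sub[of x y] by (intro power_mono) (auto simp: add.commute)
    also have "\<dots> \<le> 2 * (norm (x - y))\<^sup>2 + 2 * (norm y)\<^sup>2"
      using zero_le_power2[of "norm (x - y) - norm y"] by (simp add: power2_sum power2_diff)
    also have "\<dots> \<le> 2 * R\<^sup>2 + 2 * (norm y)\<^sup>2" using True by (simp add: power_mono)
    finally have "?w x \<le> exp (R\<^sup>2 / 16 + (norm y)\<^sup>2 / 16)" by simp
    then have "?w x * (heat_kernel s y * \<bar>c (x - y)\<bar>) \<le> exp (R\<^sup>2 / 16 + (norm y)\<^sup>2 / 16) * (heat_kernel s y * m)"
      using c(2) m by (intro mult_mono mult_left_mono mult_nonneg_nonneg) auto
    also have "\<dots> = (m * exp (R\<^sup>2 / 16)) * (exp ((norm y)\<^sup>2 / 16) * heat_kernel s y)" by (simp add: exp_add)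
    also have "\<dots> \<le> (m * exp (R\<^sup>2 / 16)) * (2 powr (real CARD('n) / 2) * heat_kernel (2 * s) y)"
      using m by (intro mult_left_mono heat_kernel_gauss_weight s) auto
    finally show ?thesis by (simp add: D_def abs_mult)
  next
    case False
    then show ?thesis using c(3)[of "x - y"] m by (simp add: D_def)
  qed
  have [measurable]: "c \<in> borel_measurable borel" by fact
  have iD: "integrable lborel (\<lambda>y :: real ^ 'n. D * heat_kernel (2 * s) y)"
    using s by (intro integrable_mult_right heat_kernel_integrable) auto
  have "?w x * \<bar>conv (heat_kernel s) c x\<bar> \<le> (LINT y|lborel. ?w x * \<bar>heat_kernel s y * c (x - y)\<bar>)"
    unfolding conv_def by (simp add: mult_left_mono)
  also have "\<dots> \<le> (LINT y|lborel. D * heat_kernel (2 * s) (y :: real ^ 'n))"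
  proof (rule integral_mono[OF _ iD le])
    show "integrable lborel (\<lambda>y. ?w x * \<bar>heat_kernel s y * c (x - y)\<bar>)"
      by (rule Bochner_Integration.integrable_bound[OF iD]) (auto intro!: order_trans[OF le abs_ge_self] simp del: abs_mult)
  qed
  also have "\<dots> = D" using s by (simp add: integral_heat_kernel)
  finally have 1: "?w x * \<bar>conv (heat_kernel s) c x\<bar> \<le> D" .
  have 2: "heat_kernel 8 x * ?w x = (32 * pi) powr (- real CARD('n) / 2)"
    by (simp add: heat_kernel_def mult.assoc exp_add[symmetric])
  have "\<bar>conv (heat_kernel s) c x\<bar> = \<bar>conv (heat_kernel s) c x\<bar> * ?w x / ?w x" by simp
  also have "\<dots> \<le> D / ?w x" using 1 by (intro divide_right_mono) (auto simp: mult.commute)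
  also have "\<dots> = D / (32 * pi) powr (- real CARD('n) / 2) * heat_kernel 8 x"
    unfolding 2[symmetric] using heat_kernel_pos[of 8 x] by simp
  finally show "\<bar>conv (heat_kernel s) c x\<bar> \<le> D / (32 * pi) powr (- real CARD('n) / 2) * heat_kernel 8 x" .
qed

text \<open>Mollification of c by the heat kernel gives Schwartz functions, does not increase the
  L^p norm, and converges pointwise under a Gaussian majorant.\<close>

lemma schwartz_dual_continuous:
  fixes f c :: "real ^ 'n \<Rightarrow> real"
  assumes f: "f \<in> borel_measurable borel" "\<And>\<phi>. \<phi> \<in> schwartz \<Longrightarrow> integrable lborel (\<lambda>x. f x * \<phi> x)"
    and dual: "\<And>\<phi> b. \<phi> \<in> schwartz \<Longrightarrow> 0 \<le> b \<Longrightarrow> Lq_le p \<phi> b \<Longrightarrow> \<bar>LINT x|lborel. f x * \<phi> x\<bar> \<le> B * b"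
    and p: "1 \<le> p"
    and c: "continuous_on UNIV c" "\<And>x. \<bar>c x\<bar> \<le> m" "\<And>x. R < norm x \<Longrightarrow> c x = 0"
    and b: "0 \<le> b" "Lq_le p c b"
  shows "\<bar>LINT x|lborel. f x * c x\<bar> \<le> B * b"
proof -
  have cm[measurable]: "c \<in> borel_measurable borel" by (rule borel_measurable_continuous_onI[OF c(1)])
  have [measurable]: "f \<in> borel_measurable borel" by fact
  obtain C where C: "\<And>s x. 0 < s \<Longrightarrow> s \<le> 1 \<Longrightarrow> \<bar>conv (heat_kernel s) c x\<bar> \<le> C * heat_kernel 8 x"
    using conv_heat_kernel_dominated[OF cm c(2,3)] by blast
  define s where "s k = inverse (real (Suc k))" for k
  have s: "0 < s k" "s k \<le> 1" for k by (auto simp: s_def inverse_le_1_iff)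
  have s_lim: "filterlim s (at_right 0) sequentially"
    unfolding filterlim_at using s LIMSEQ_inverse_real_of_nat by (auto simp: s_def[abs_def])
  let ?\<phi> = "\<lambda>k. conv (heat_kernel (s k)) c"
  have \<phi>S: "?\<phi> k \<in> schwartz" for k
  proof -
    have "?\<phi> k = conv c (heat_kernel (s k))" by (rule conv_commute) measurable
    then show ?thesis using conv_schwartz(1)[OF rapid_compact_support[OF cm c(2,3)] heat_kernel_schwartz[OF s(1)]] by simp
  qed
  note [measurable] = schwartz_measurable0[OF \<phi>S]
  have le: "\<bar>LINT x|lborel. f x * ?\<phi> k x\<bar> \<le> B * b" for k
  proof (rule dual[OF \<phi>S b(1)])
    have "Lq_le p (?\<phi> k) (1 * b)"
      using s[of k] by (intro Lq_le_conv b p) (auto simp: nn_integral_heat_kernel)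
    then show "Lq_le p (?\<phi> k) b" by simp
  qed
  have "(\<lambda>k. LINT x|lborel. f x * ?\<phi> k x) \<longlonglongrightarrow> (LINT x|lborel. f x * c x)"
  proof (rule integral_dominated_convergence[where w = "\<lambda>x. C * \<bar>f x * heat_kernel 8 x\<bar>"])
    show "integrable lborel (\<lambda>x. C * \<bar>f x * heat_kernel 8 x\<bar>)"
      by (intro integrable_mult_right integrable_abs f heat_kernel_schwartz) auto
    have "(\<lambda>k. f x * ?\<phi> k x) \<longlonglongrightarrow> f x * c x" for x
      by (intro tendsto_intros filterlim_compose[OF conv_heat_kernel_pointwise[OF c(1,2)] s_lim])
    then show "AE x in lborel. (\<lambda>k. f x * ?\<phi> k x) \<longlonglongrightarrow> f x * c x" by simp
    have "\<bar>f x * ?\<phi> k x\<bar> \<le> C * \<bar>f x * heat_kernel 8 x\<bar>" for k x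
      using mult_left_mono[OF C[OF s, of k x], of "\<bar>f x\<bar>"] by (simp add: abs_mult mult_ac)
    then show "AE x in lborel. norm (f x * ?\<phi> k x) \<le> C * \<bar>f x * heat_kernel 8 x\<bar>" for k by simp
  qed measurable
  then have "(\<lambda>k. \<bar>LINT x|lborel. f x * ?\<phi> k x\<bar>) \<longlonglongrightarrow> \<bar>LINT x|lborel. f x * c x\<bar>" by (rule tendsto_rabs)
  then show ?thesis by (rule tendsto_upperbound) (use le in auto)
qed

text \<open>Lebesgue measurability supplies continuous functions converging almost everywhere.
  Clipping the values to [-m,m] and multiplying by the cutoff \<rho> preserves the limit and gives
  the common bound and support that dominated convergence asks for; the cutoff needs the room from R
  to R+1.\<close>

lemma borel_limit_continuous:
  fixes g :: "real ^ 'n \<Rightarrow> real"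
  assumes g[measurable]: "g \<in> borel_measurable borel" and m: "\<And>x. \<bar>g x\<bar> \<le> m" and R: "\<And>x. R < norm x \<Longrightarrow> g x = 0"
  obtains h where "\<And>k. continuous_on UNIV (h k)" "\<And>k x. \<bar>h k x\<bar> \<le> m" "\<And>k x. R + 1 < norm x \<Longrightarrow> h k x = 0"
    "AE x in lborel. (\<lambda>k. h k x) \<longlonglongrightarrow> g x"
proof -
  have "g \<in> borel_measurable lebesgue" by (rule measurable_completion) (use g in simp)
  then have "g measurable_on UNIV" by (intro lebesgue_measurable_imp_measurable_on) auto
  then obtain N u where N: "negligible N" and u: "\<And>k. continuous_on UNIV (u k)" "\<And>x. x \<notin> N \<Longrightarrow> (\<lambda>k. u k x) \<longlonglongrightarrow> g x"
    by (auto simp: measurable_on_def)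
  define \<rho> where "\<rho> x = max 0 (min 1 (R + 1 - norm x))" for x :: "real ^ 'n"
  define h where "h k x = max (- m) (min m (u k x)) * \<rho> x" for k x
  have m0: "0 \<le> m" using m[of 0] by linarith
  have \<rho>: "0 \<le> \<rho> x" "\<rho> x \<le> 1" for x by (auto simp: \<rho>_def)
  show ?thesis
  proof (rule that[of h])
    show "continuous_on UNIV (h k)" for k unfolding h_def \<rho>_def by (intro continuous_intros u)
    show "\<bar>h k x\<bar> \<le> m" for k x
    proof -
      have "\<bar>max (- m) (min m (u k x))\<bar> * \<bar>\<rho> x\<bar> \<le> m * 1" using m0 \<rho>[of x] by (intro mult_mono) auto
      then show ?thesis by (simp add: h_def abs_mult)
    qed
    show "R + 1 < norm x \<Longrightarrow> h k x = 0" for k x by (simp add: h_def \<rho>_def)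
    have "AE x in lebesgue. x \<notin> N" using N by (simp add: negligible_iff_null_sets AE_not_in)
    then have "AE x in lborel. x \<notin> N" by (simp add: AE_completion_iff)
    then show "AE x in lborel. (\<lambda>k. h k x) \<longlonglongrightarrow> g x"
    proof eventually_elim
      case (elim x)
      have "(\<lambda>k. h k x) \<longlonglongrightarrow> max (- m) (min m (g x)) * \<rho> x"
        unfolding h_def by (intro tendsto_intros u(2) elim)
      moreover have "max (- m) (min m (g x)) = g x" using m[of x] by auto
      moreover have "g x * \<rho> x = g x" using R[of x] by (cases "R < norm x") (auto simp: \<rho>_def)
      ultimately show ?case by simp
    qed
  qed
qed

lemma schwartz_dual_measurable:
  fixes f g :: "real ^ 'n \<Rightarrow> real"
  assumes f: "f \<in> borel_measurable borel" "\<And>\<phi>. \<phi> \<in> schwartz \<Longrightarrow> integrable lborel (\<lambda>x. f x * \<phi> x)"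
    and dual: "\<And>\<phi> b. \<phi> \<in> schwartz \<Longrightarrow> 0 \<le> b \<Longrightarrow> Lq_le p \<phi> b \<Longrightarrow> \<bar>LINT x|lborel. f x * \<phi> x\<bar> \<le> B * b"
    and p: "1 \<le> p"
    and g: "g \<in> borel_measurable borel" "\<And>x. \<bar>g x\<bar> \<le> m" "\<And>x. R < norm x \<Longrightarrow> g x = 0"
  shows "integrable lborel (\<lambda>x. f x * g x)" and "integrable lborel (\<lambda>x. \<bar>g x\<bar> powr p)"
    and "\<bar>LINT x|lborel. f x * g x\<bar> \<le> B * (LINT x|lborel. \<bar>g x\<bar> powr p) powr (1 / p)"
proof -
  have [measurable]: "f \<in> borel_measurable borel" "g \<in> borel_measurable borel" by fact+
  have [measurable]: "cball (0 :: real ^ 'n) (R + 1) \<in> sets borel" by simp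
  have m0: "0 \<le> m" using g(2)[of 0] by linarith
  \<comment> \<open>Local integrability of f: the kernel at time 8 is a Schwartz function bounded
    below by a positive constant on each ball.\<close>
  have loc: "integrable lborel (\<lambda>x. m * (\<bar>f x\<bar> * indicator (cball 0 (R + 1)) x))"
  proof (rule Bochner_Integration.integrable_bound)
    let ?c = "(32 * pi) powr (real CARD('n) / 2) * exp ((\<bar>R\<bar> + 1)\<^sup>2 / 32)"
    show "integrable lborel (\<lambda>x. m * (?c * (f x * heat_kernel 8 x)))"
      by (intro integrable_mult_right f heat_kernel_schwartz) auto
    have "indicator (cball 0 (R + 1)) x \<le> ?c * heat_kernel 8 x" for x :: "real ^ 'n"
    proof (cases "norm x \<le> R + 1")
      case True
      then have "(norm x)\<^sup>2 \<le> (\<bar>R\<bar> + 1)\<^sup>2" by (intro power_mono) auto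
      then have "1 \<le> exp ((\<bar>R\<bar> + 1)\<^sup>2 / 32) * exp (- (norm x)\<^sup>2 / 32)" unfolding exp_add[symmetric] by simp
      also have "\<dots> = ?c * heat_kernel 8 x" by (simp add: heat_kernel_def powr_minus)
      finally show ?thesis by (simp add: indicator_def)
    qed (auto simp: indicator_def)
    then have "m * (\<bar>f x\<bar> * indicator (cball 0 (R + 1)) x) \<le> m * (\<bar>f x\<bar> * (?c * heat_kernel 8 x))" for x
      using m0 by (intro mult_left_mono) auto
    then show "AE x in lborel. norm (m * (\<bar>f x\<bar> * indicator (cball 0 (R + 1)) x)) \<le> norm (m * (?c * (f x * heat_kernel 8 x)))"
      using m0 by (simp add: abs_mult mult_ac)
  qed measurable
  have dom: "\<bar>f x * h x\<bar> \<le> m * (\<bar>f x\<bar> * indicator (cball 0 (R + 1)) x)" "\<bar>h x\<bar> powr p \<le> m powr p * indicator (cball 0 (R + 1)) x"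
    if "\<bar>h x\<bar> \<le> m" "R + 1 < norm x \<Longrightarrow> h x = 0" for h :: "real ^ 'n \<Rightarrow> real" and x
  proof -
    show "\<bar>f x * h x\<bar> \<le> m * (\<bar>f x\<bar> * indicator (cball 0 (R + 1)) x)"
    proof (cases "norm x \<le> R + 1")
      case True
      then show ?thesis using mult_left_mono[OF that(1), of "\<bar>f x\<bar>"] by (simp add: abs_mult mult.commute)
    qed (use that in simp)
    show "\<bar>h x\<bar> powr p \<le> m powr p * indicator (cball 0 (R + 1)) x"
    proof (cases "norm x \<le> R + 1")
      case True
      then show ?thesis using that(1) p powr_mono2[of p "\<bar>h x\<bar>" m] by simp
    qed (use that in simp)
  qed
  have loc2: "integrable lborel (\<lambda>x :: real ^ 'n. m powr p * indicator (cball 0 (R + 1)) x)"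
    by (intro integrable_mult_right indicator_cball_integrable)
  have int: "integrable lborel (\<lambda>x. f x * h x)" "integrable lborel (\<lambda>x. \<bar>h x\<bar> powr p)"
    if [measurable]: "h \<in> borel_measurable borel" and h: "\<And>x. \<bar>h x\<bar> \<le> m" "\<And>x. R + 1 < norm x \<Longrightarrow> h x = 0" for h
  proof -
    show "integrable lborel (\<lambda>x. f x * h x)"
    proof (rule Bochner_Integration.integrable_bound[OF loc])
      show "AE x in lborel. norm (f x * h x) \<le> norm (m * (\<bar>f x\<bar> * indicator (cball 0 (R + 1)) x))"
        unfolding real_norm_def by (rule AE_I2, rule order_trans[OF dom(1)[OF h] abs_ge_self])
    qed measurable
    show "integrable lborel (\<lambda>x. \<bar>h x\<bar> powr p)"
    proof (rule Bochner_Integration.integrable_bound[OF loc2])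
      show "AE x in lborel. norm (\<bar>h x\<bar> powr p) \<le> norm (m powr p * indicator (cball 0 (R + 1)) x)"
        unfolding real_norm_def abs_of_nonneg[OF powr_ge_zero]
        by (rule AE_I2, rule order_trans[OF dom(2)[OF h] abs_ge_self])
    qed measurable
  qed
  have g0: "R + 1 < norm x \<Longrightarrow> g x = 0" for x using g(3)[of x] by simp
  show "integrable lborel (\<lambda>x. f x * g x)" "integrable lborel (\<lambda>x. \<bar>g x\<bar> powr p)"
    using int[OF g(1,2) g0] by auto
  obtain h where h: "\<And>k. continuous_on UNIV (h k)" "\<And>k x. \<bar>h k x\<bar> \<le> m" "\<And>k x. R + 1 < norm x \<Longrightarrow> h k x = 0"
    and lim: "AE x in lborel. (\<lambda>k. h k x) \<longlonglongrightarrow> g x" using borel_limit_continuous[OF g] by blast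
  have hm[measurable]: "h k \<in> borel_measurable borel" for k by (rule borel_measurable_continuous_onI[OF h(1)])
  have le: "\<bar>LINT x|lborel. f x * h k x\<bar> \<le> B * (LINT x|lborel. \<bar>h k x\<bar> powr p) powr (1 / p)" for k
  proof (rule schwartz_dual_continuous[OF f dual p h])
    show "Lq_le p (h k) ((LINT x|lborel. \<bar>h k x\<bar> powr p) powr (1 / p))"
      by (rule Lq_le_of_integrable[OF int(2)[OF hm h(2,3)]]) (use p in auto)
  qed auto
  have "(\<lambda>k. LINT x|lborel. f x * h k x) \<longlonglongrightarrow> (LINT x|lborel. f x * g x)"
  proof (rule integral_dominated_convergence[OF _ _ loc])
    show "AE x in lborel. (\<lambda>k. f x * h k x) \<longlonglongrightarrow> f x * g x" using lim by eventually_elim (intro tendsto_intros)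
    show "AE x in lborel. norm (f x * h k x) \<le> m * (\<bar>f x\<bar> * indicator (cball 0 (R + 1)) x)" for k
      unfolding real_norm_def by (rule AE_I2, rule dom(1)) (use h in auto)
  qed measurable
  then have 1: "(\<lambda>k. \<bar>LINT x|lborel. f x * h k x\<bar>) \<longlonglongrightarrow> \<bar>LINT x|lborel. f x * g x\<bar>" by (rule tendsto_rabs)
  have "(\<lambda>k. LINT x|lborel. \<bar>h k x\<bar> powr p) \<longlonglongrightarrow> (LINT x|lborel. \<bar>g x\<bar> powr p)"
  proof (rule integral_dominated_convergence[OF _ _ loc2])
    show "AE x in lborel. (\<lambda>k. \<bar>h k x\<bar> powr p) \<longlonglongrightarrow> \<bar>g x\<bar> powr p"
      using lim by eventually_elim (intro tendsto_powr' tendsto_rabs tendsto_const, use p in auto)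
    show "AE x in lborel. norm (\<bar>h k x\<bar> powr p) \<le> m powr p * indicator (cball 0 (R + 1)) x" for k
      unfolding real_norm_def abs_of_nonneg[OF powr_ge_zero] by (rule AE_I2, rule dom(2)) (use h in auto)
  qed measurable
  then have "(\<lambda>k. B * (LINT x|lborel. \<bar>h k x\<bar> powr p) powr (1 / p)) \<longlonglongrightarrow> B * (LINT x|lborel. \<bar>g x\<bar> powr p) powr (1 / p)"
    by (intro tendsto_mult tendsto_powr' tendsto_const) (use p in auto)
  from LIMSEQ_le[OF 1 this] le
  show "\<bar>LINT x|lborel. f x * g x\<bar> \<le> B * (LINT x|lborel. \<bar>g x\<bar> powr p) powr (1 / p)" by blast
qed

text \<open>For \<open>B = 0\<close> this is the uniqueness of representing functions.\<close>

lemma Lq_duality: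
  fixes f :: "real ^ 'n \<Rightarrow> real"
  assumes f: "f \<in> borel_measurable borel" "\<And>\<phi>. \<phi> \<in> schwartz \<Longrightarrow> integrable lborel (\<lambda>x. f x * \<phi> x)"
    and q: "1 < q" and B: "0 \<le> B"
    and dual: "\<And>\<phi> b. \<phi> \<in> schwartz \<Longrightarrow> 0 \<le> b \<Longrightarrow> Lq_le (q / (q - 1)) \<phi> b \<Longrightarrow> \<bar>LINT x|lborel. f x * \<phi> x\<bar> \<le> B * b"
  shows "Lq_le q f B"
proof -
  define p where "p = q / (q - 1)"
  have p: "1 < p" using q by (simp add: p_def)
  have [measurable]: "f \<in> borel_measurable borel" by fact
  define A where "A k = {x. \<bar>f x\<bar> \<le> real k \<and> norm x \<le> real k}" for k
  have [measurable]: "A k \<in> sets borel" for k unfolding A_def by measurable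
  have le: "(\<integral>\<^sup>+x. ennreal (\<bar>f x\<bar> powr q) * indicator (A k) x \<partial>lborel) \<le> ennreal (B powr q)" for k
  proof -
    \<comment> \<open>The extremal function of Hoelder's inequality, cut off so that it is bounded
      with compact support.\<close>
    define g where "g x = sgn (f x) * \<bar>f x\<bar> powr (q - 1) * indicator (A k) x" for x
    have g: "g \<in> borel_measurable borel" "\<And>x. \<bar>g x\<bar> \<le> real k powr (q - 1)" "\<And>x. real k < norm x \<Longrightarrow> g x = 0"
    proof -
      show "g \<in> borel_measurable borel" unfolding g_def by measurable
      show "\<bar>g x\<bar> \<le> real k powr (q - 1)" for x
        using q powr_mono2[of "q - 1" "\<bar>f x\<bar>" "real k"] by (auto simp: g_def indicator_def A_def abs_mult abs_sgn_eq)
      show "real k < norm x \<Longrightarrow> g x = 0" for x by (auto simp: g_def A_def)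
    qed
    have gp: "\<bar>g x\<bar> powr p = \<bar>f x\<bar> powr q * indicator (A k) x" for x
      using q by (auto simp: g_def indicator_def abs_mult abs_sgn_eq powr_powr p_def)
    have fg: "f x * g x = \<bar>f x\<bar> powr q * indicator (A k) x" for x
    proof -
      have "f x * sgn (f x) = \<bar>f x\<bar>" by (simp add: abs_sgn)
      then have "f x * g x = \<bar>f x\<bar> * \<bar>f x\<bar> powr (q - 1) * indicator (A k) x" by (simp add: g_def mult.assoc[symmetric])
      then show ?thesis using q by (cases "f x = 0") (auto simp: powr_mult_base)
    qed
    note D = schwartz_dual_measurable[OF f dual[folded p_def] less_imp_le[OF p] g]
    define J where "J = (LINT x|lborel. \<bar>f x\<bar> powr q * indicator (A k) x)"
    have J0: "0 \<le> J" unfolding J_def by (intro integral_nonneg_AE) auto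
    have "\<bar>J\<bar> \<le> B * J powr (1 / p)" using D(3) unfolding gp fg J_def .
    then have "J \<le> B * J powr (1 / p)" by linarith
    moreover have "1 / p = 1 - 1 / q" using q by (simp add: p_def field_simps)
    ultimately have J1: "J \<le> B * J powr (1 - 1 / q)" by simp
    \<comment> \<open>The cutoff guarantees that J is finite, which permits division by J^(1-1/q).
      Monotone convergence in k removes the cutoff afterwards.\<close>
    have "J \<le> B powr q"
    proof (cases "J = 0")
      case False
      then have J: "J > 0" using J0 by simp
      have Je: "J powr (1 / q) * J powr (1 - 1 / q) = J" using J by (simp add: powr_add[symmetric])
      have "J powr (1 / q) * J powr (1 - 1 / q) \<le> B * J powr (1 - 1 / q)" unfolding Je by (rule J1)
      then have "J powr (1 / q) \<le> B" by (rule mult_right_le_imp_le) (use J in simp)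
      then have "(J powr (1 / q)) powr q \<le> B powr q" using q by (intro powr_mono2) auto
      then show ?thesis using J q by (simp add: powr_powr)
    qed auto
    moreover have "(\<integral>\<^sup>+x. ennreal (\<bar>f x\<bar> powr q) * indicator (A k) x \<partial>lborel) = ennreal J"
    proof -
      have "(\<integral>\<^sup>+x. ennreal (\<bar>f x\<bar> powr q) * indicator (A k) x \<partial>lborel) = (\<integral>\<^sup>+x. ennreal (\<bar>f x\<bar> powr q * indicator (A k) x) \<partial>lborel)"
        by (intro nn_integral_cong) (auto simp: indicator_def)
      also have "\<dots> = ennreal J" unfolding J_def using D(1)[unfolded fg] by (rule nn_integral_eq_integral) auto
      finally show ?thesis .
    qed
    ultimately show ?thesis by (simp add: ennreal_leI)
  qed
  have inc: "incseq (\<lambda>k x. ennreal (\<bar>f x\<bar> powr q) * indicator (A k) x)"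
    by (auto simp: incseq_def le_fun_def indicator_def A_def intro: order_trans)
  have sup: "(SUP k. ennreal (\<bar>f x\<bar> powr q) * indicator (A k) x) = ennreal (\<bar>f x\<bar> powr q)" for x
  proof (rule antisym)
    obtain k :: nat where "max \<bar>f x\<bar> (norm x) \<le> real k" using real_arch_simple by blast
    then have "ennreal (\<bar>f x\<bar> powr q) = ennreal (\<bar>f x\<bar> powr q) * indicator (A k) x" by (simp add: A_def)
    also have "\<dots> \<le> (SUP k. ennreal (\<bar>f x\<bar> powr q) * indicator (A k) x)" by (rule SUP_upper) simp
    finally show "ennreal (\<bar>f x\<bar> powr q) \<le> (SUP k. ennreal (\<bar>f x\<bar> powr q) * indicator (A k) x)" .
  qed (auto intro!: SUP_least simp: indicator_def)
  have "(\<integral>\<^sup>+x. ennreal (\<bar>f x\<bar> powr q) \<partial>lborel)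
     = (\<integral>\<^sup>+x. (SUP k. ennreal (\<bar>f x\<bar> powr q) * indicator (A k) x) \<partial>lborel)" by (simp only: sup)
  also have "\<dots> = (SUP k. \<integral>\<^sup>+x. ennreal (\<bar>f x\<bar> powr q) * indicator (A k) x \<partial>lborel)"
    by (rule nn_integral_monotone_convergence_SUP[OF inc]) measurable
  also have "\<dots> \<le> ennreal (B powr q)" by (intro SUP_least le)
  finally show ?thesis by (simp add: Lq_le_def)
qed

lemma represents_unique:
  assumes "represents f T" "represents g T"
  shows "AE x in lborel. f x = g x"
proof -
  have m: "f \<in> borel_measurable borel" "g \<in> borel_measurable borel" using assms by (auto simp: represents_def)
  have i: "integrable lborel (\<lambda>x. f x * \<phi> x)" "integrable lborel (\<lambda>x. g x * \<phi> x)" if "\<phi> \<in> schwartz" for \<phi>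
    using assms that by (auto simp: represents_def)
  \<comment> \<open>Any exponent above 1 would do, as the dual bound is 0.\<close>
  have "Lq_le 2 (\<lambda>x. f x - g x) 0"
  proof (rule Lq_duality)
    show "integrable lborel (\<lambda>x. (f x - g x) * \<phi> x)" if "\<phi> \<in> schwartz" for \<phi>
      using i[OF that] by (simp add: left_diff_distrib)
    fix \<phi> :: "real ^ 'a \<Rightarrow> real" and b :: real assume \<phi>: "\<phi> \<in> schwartz"
    have "distr_of f \<phi> = distr_of g \<phi>" using assms by (simp add: represents_def)
    then have "(LINT x|lborel. f x * \<phi> x) = (LINT x|lborel. g x * \<phi> x)" using \<phi> by (simp add: distr_of_def)
    then show "\<bar>LINT x|lborel. (f x - g x) * \<phi> x\<bar> \<le> 0 * b" using i[OF \<phi>] by (simp add: left_diff_distrib)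
  qed (use m in auto)
  from Lq_le_zeroD[OF this] show ?thesis by simp
qed

section \<open>L^q norms of distributions\<close>

lemma Lp_norm_le_iff:
  assumes "f \<in> borel_measurable borel" "0 \<le> A" "0 < q"
  shows "Lp_norm q f \<le> ennreal A \<longleftrightarrow> Lq_le q f A"
proof -
  define I where "I = (\<integral>\<^sup>+x. ennreal (\<bar>f x\<bar> powr q) \<partial>lborel)"
  show ?thesis
  proof (cases "I = \<infinity>")
    case True
    then show ?thesis using assms by (simp add: Lp_norm_def Lq_le_def I_def[symmetric] top_unique)
  next
    case False
    then obtain r where r: "0 \<le> r" "I = ennreal r" by (cases I) auto
    have "r powr (1 / q) \<le> A \<longleftrightarrow> r \<le> A powr q"
    proof
      assume "r powr (1 / q) \<le> A"
      then have "(r powr (1 / q)) powr q \<le> A powr q" using assms by (intro powr_mono2) auto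
      then show "r \<le> A powr q" using r assms by (simp add: powr_powr)
    next
      assume "r \<le> A powr q"
      then have "r powr (1 / q) \<le> (A powr q) powr (1 / q)" using assms r by (intro powr_mono2) auto
      then show "r powr (1 / q) \<le> A" using assms by (simp add: powr_powr)
    qed
    then show ?thesis using assms r by (simp add: Lp_norm_def Lq_le_def I_def[symmetric])
  qed
qed

lemma Lp_norm_cong_AE:
  assumes "AE x in lborel. f x = g x"
  shows "Lp_norm q f = Lp_norm q g"
proof -
  have "(\<integral>\<^sup>+x. ennreal (\<bar>f x\<bar> powr q) \<partial>lborel) = (\<integral>\<^sup>+x. ennreal (\<bar>g x\<bar> powr q) \<partial>lborel)"
    by (rule nn_integral_cong_AE) (use assms in eventually_elim, simp)
  then show ?thesis by (simp add: Lp_norm_def)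
qed

lemma distr_Lp_norm_eq:
  assumes "represents f T"
  shows "distr_Lp_norm q T = Lp_norm q f"
proof -
  have "Lp_norm q f \<le> Lp_norm q g" if "represents g T" for g
    by (rule eq_refl, rule Lp_norm_cong_AE[OF represents_unique[OF assms that]])
  then show ?thesis unfolding distr_Lp_norm_def
    by (intro antisym INF_greatest INF_lower) (use assms in auto)
qed

lemma represents_fun_of: "represents f T \<Longrightarrow> represents (fun_of T) T"
  unfolding fun_of_def by (rule someI[of "\<lambda>f. represents f T"])

lemma fun_of_AE: "represents f T \<Longrightarrow> AE x in lborel. fun_of T x = f x"
  using represents_unique[OF represents_fun_of] by blast

lemma distr_Lp_norm_leD:
  assumes "distr_Lp_norm q T \<le> ennreal A" "0 \<le> A" "0 < q"
  shows "represents (fun_of T) T" "Lq_le q (fun_of T) A"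
proof -
  have "{f. represents f T} \<noteq> {}"
  proof
    assume "{f. represents f T} = {}"
    then have "distr_Lp_norm q T = \<infinity>"
      unfolding distr_Lp_norm_def by (simp only: image_empty Inf_empty infinity_ennreal_def)
    then show False using assms by (simp add: top_unique)
  qed
  then show r: "represents (fun_of T) T" using represents_fun_of by blast
  then show "Lq_le q (fun_of T) A"
    using assms by (subst Lp_norm_le_iff[symmetric]) (auto simp: represents_def distr_Lp_norm_eq[OF r, symmetric])
qed

lemma le_one_add_powr: "0 \<le> x \<Longrightarrow> 1 \<le> q \<Longrightarrow> x \<le> 1 + x powr q" for x q :: real
proof (cases "x \<le> 1")
  case False
  assume "1 \<le> q"
  then have "x powr 1 \<le> x powr q" using False by (intro powr_mono) auto
  then show ?thesis using False by simp
qed (simp add: add_increasing2)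

lemma Lq_le_integrable_powr: "Lq_le q f A \<Longrightarrow> integrable lborel (\<lambda>x. \<bar>f x\<bar> powr q)"
  by (rule integrableI_bounded) (auto simp: Lq_le_def intro: le_less_trans)

text \<open>The inequality |f| \<le> 1 + |f|^q splits the product into an integrable and a bounded
  multiple, so a factor that is both bounded and integrable suffices and no dual norm has to be
  computed.\<close>

lemma Lq_le_mult_integrable:
  assumes f: "Lq_le q f A" and q: "1 \<le> q"
    and w: "integrable lborel w" "\<And>x. \<bar>w x\<bar> \<le> C"
  shows "integrable lborel (\<lambda>x. f x * w x)"
proof (rule Bochner_Integration.integrable_bound)
  have [measurable]: "f \<in> borel_measurable borel" using f by (simp add: Lq_le_def)
  have [measurable]: "w \<in> borel_measurable borel" using borel_measurable_integrable[OF w(1)] by simp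
  show "integrable lborel (\<lambda>x. \<bar>w x\<bar> + C * \<bar>f x\<bar> powr q)"
    by (intro Bochner_Integration.integrable_add integrable_abs integrable_mult_right w Lq_le_integrable_powr[OF f])
  have "\<bar>f x\<bar> * \<bar>w x\<bar> \<le> \<bar>w x\<bar> + C * \<bar>f x\<bar> powr q" for x
  proof -
    have "\<bar>f x\<bar> * \<bar>w x\<bar> \<le> (1 + \<bar>f x\<bar> powr q) * \<bar>w x\<bar>" using q by (intro mult_right_mono le_one_add_powr) auto
    also have "\<dots> = \<bar>w x\<bar> + \<bar>w x\<bar> * \<bar>f x\<bar> powr q" by (simp add: algebra_simps)
    also have "\<dots> \<le> \<bar>w x\<bar> + C * \<bar>f x\<bar> powr q" by (intro add_left_mono mult_right_mono w) auto
    finally show ?thesis .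
  qed
  then show "AE x in lborel. norm (f x * w x) \<le> norm (\<bar>w x\<bar> + C * \<bar>f x\<bar> powr q)"
    by (auto simp: abs_mult intro!: order_trans[OF _ abs_ge_self])
  show "(\<lambda>x. f x * w x) \<in> borel_measurable lborel" by measurable
qed

lemma schwartz_integrable: "\<phi> \<in> schwartz \<Longrightarrow> integrable lborel \<phi>"
  by (rule rapid_integrable[OF schwartz_rapid])

lemma Lq_le_schwartz_integrable:
  assumes "Lq_le q f A" "1 \<le> q" "\<phi> \<in> schwartz"
  shows "integrable lborel (\<lambda>x. f x * \<phi> x)"
proof -
  obtain C where "\<And>x. \<bar>partials [] \<phi> x\<bar> \<le> C" using schwartz_bounded[OF assms(3)] by blast
  then show ?thesis by (intro Lq_le_mult_integrable[OF assms(1,2) schwartz_integrable[OF assms(3)], where C = C]) simp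
qed

lemma represents_distr_of:
  assumes "Lq_le q f A" "1 \<le> q"
  shows "represents f (distr_of f)"
  using Lq_le_schwartz_integrable[OF assms] Lq_le_measurable[OF assms(1)] by (simp add: represents_def)

lemma seminorm_ge:
  assumes \<phi>: "\<phi> \<in> schwartz"
  shows "(1 + norm x) ^ N * \<bar>\<phi> x\<bar> \<le> schwartz_seminorm N \<phi>"
proof -
  have sup: "(1 + norm x) ^ N * \<bar>partials is \<phi> x\<bar> \<le> (SUP x. (1 + norm x) ^ N * \<bar>partials is \<phi> x\<bar>)" for "is" x
  proof -
    obtain C where "\<And>x. (1 + norm x) ^ N * \<bar>partials is \<phi> x\<bar> \<le> C" using schwartz_bound[OF \<phi>] by blast
    then show ?thesis by (intro cSUP_upper) (auto intro!: bdd_aboveI2)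
  qed
  have fin: "finite {is :: 'a list. length is \<le> N}"
    using finite_lists_length_le[of "UNIV :: 'a set" N] by simp
  have "(1 + norm x) ^ N * \<bar>\<phi> x\<bar> \<le> (SUP x. (1 + norm x) ^ N * \<bar>partials [] \<phi> x\<bar>)" using sup[of x "[]"] by simp
  also have "\<dots> \<le> schwartz_seminorm N \<phi>"
    unfolding schwartz_seminorm_def
    by (rule member_le_sum[OF _ _ fin, of "[]"]) (auto intro!: order_trans[OF _ sup[of 0]])
  finally show ?thesis .
qed

lemma tempered_distr_of:
  fixes f :: "real ^ 'n \<Rightarrow> real"
  assumes f: "Lq_le q f A" and q: "1 \<le> q"
  shows "tempered (distr_of f)"
  unfolding tempered_def
proof (intro conjI)
  note i = Lq_le_schwartz_integrable[OF f q]
  show "\<forall>\<phi>\<in>schwartz. \<forall>\<psi>\<in>schwartz. distr_of f (\<lambda>x. \<phi> x + \<psi> x) = distr_of f \<phi> + distr_of f \<psi>"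
    using i by (simp add: distr_of_def schwartz_add distrib_left)
  show "\<forall>c. \<forall>\<phi>\<in>schwartz. distr_of f (\<lambda>x. c * \<phi> x) = c * distr_of f \<phi>"
    by (simp add: distr_of_def schwartz_cmult mult.left_commute)
  show "\<forall>\<phi>. \<phi> \<notin> schwartz \<longrightarrow> distr_of f \<phi> = 0" by (simp add: distr_of_def)
  \<comment> \<open>The order of the seminorm is dictated by the weight (1+|x|)^(-2n), which is both
    bounded and integrable.\<close>
  let ?N = "2 * CARD('n)" and ?w = "\<lambda>x :: real ^ 'n. 1 / (1 + norm x) ^ (2 * CARD('n))"
  have iw: "integrable lborel (\<lambda>x. f x * ?w x)"
    by (rule Lq_le_mult_integrable[OF f q integrable_one_plus_norm, where C = 1]) (simp add: one_le_power divide_le_eq_1 add_pos_nonneg)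
  have "\<bar>distr_of f \<phi>\<bar> \<le> (LINT x|lborel. \<bar>f x * ?w x\<bar>) * schwartz_seminorm ?N \<phi>" if \<phi>: "\<phi> \<in> schwartz" for \<phi>
  proof -
    have "\<bar>distr_of f \<phi>\<bar> \<le> (LINT x|lborel. \<bar>f x * \<phi> x\<bar>)"
      using \<phi> by (simp add: distr_of_def del: abs_mult)
    also have "\<dots> \<le> (LINT x|lborel. \<bar>f x * ?w x\<bar> * schwartz_seminorm ?N \<phi>)"
    proof (rule integral_mono)
      show "integrable lborel (\<lambda>x. \<bar>f x * \<phi> x\<bar>)" using i[OF \<phi>] by simp
      show "integrable lborel (\<lambda>x. \<bar>f x * ?w x\<bar> * schwartz_seminorm ?N \<phi>)" by (intro integrable_mult_left integrable_abs iw)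
      fix x :: "real ^ 'n"
      have p: "0 < (1 + norm x) ^ ?N" by (simp add: add_pos_nonneg)
      have "\<bar>\<phi> x\<bar> \<le> ?w x * schwartz_seminorm ?N \<phi>" using seminorm_ge[OF \<phi>, of x ?N] p by (simp add: field_simps)
      then have "\<bar>f x\<bar> * \<bar>\<phi> x\<bar> \<le> \<bar>f x\<bar> * (?w x * schwartz_seminorm ?N \<phi>)" by (intro mult_left_mono) auto
      then show "\<bar>f x * \<phi> x\<bar> \<le> \<bar>f x * ?w x\<bar> * schwartz_seminorm ?N \<phi>" by (simp add: abs_mult mult.assoc)
    qed
    finally show ?thesis unfolding integral_mult_left_zero .
  qed
  then show "\<exists>C N. \<forall>\<phi>\<in>schwartz. \<bar>distr_of f \<phi>\<bar> \<le> C * schwartz_seminorm N \<phi>" by blast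
qed

subsection \<open>The Duhamel term\<close>

text \<open>Stands for the nonlinearity along a trajectory, or for a difference of two. Both the
  self-map and the contraction estimate are then instances of one linear bound for the Duhamel
  operator, with different A.\<close>

definition source :: "real \<Rightarrow> real \<Rightarrow> (real \<Rightarrow> real ^ 'n \<Rightarrow> real) \<Rightarrow> bool" where
  "source \<sigma> A F \<longleftrightarrow> (\<lambda>m. F (fst m) (snd m)) \<in> borel_measurable borel \<and>
     (\<forall>\<tau>>0. Lq_le 1 (F \<tau>) (A * \<tau> powr (- \<sigma>)))"

text \<open>The time \<open>r\<close> at which the kernel is evaluated may lie beyond the interval of integration \<open>S\<close>:
  for \<open>S = (0,t)\<close> and \<open>r > t\<close> one gets \<open>e\<^bsup>(r-t)\<Delta>\<^esup>\<close> of the Duhamel term at time \<open>t\<close>.\<close>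

definition duh :: "real ^ 'n \<Rightarrow> real set \<Rightarrow> real \<Rightarrow> (real \<Rightarrow> real ^ 'n \<Rightarrow> real) \<Rightarrow> real ^ 'n \<Rightarrow> real" where
  "duh a S r F x = (LINT m|lborel. indicator S (fst m) * (heat_grad a (r - fst m) (x - snd m) * F (fst m) (snd m)))"

lemma measurable_uncurried:
  fixes U :: "real \<Rightarrow> real ^ 'n \<Rightarrow> real"
  assumes "(\<lambda>m. U (fst m) (snd m)) \<in> borel_measurable borel"
    and "f \<in> borel_measurable M" "g \<in> borel_measurable M"
  shows "(\<lambda>p. U (f p) (g p)) \<in> borel_measurable M"
  using measurable_compose[OF borel_measurable_Pair[OF assms(2,3)] assms(1)] by simp

lemma source_measurable:
  assumes "source \<sigma> A F" "f \<in> borel_measurable M" "g \<in> borel_measurable M"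
  shows "(\<lambda>p. F (f p) (g p)) \<in> borel_measurable M"
  by (rule measurable_uncurried[OF _ assms(2,3)]) (use assms(1) in \<open>simp add: source_def\<close>)

lemma source_L1:
  assumes "source \<sigma> A F" "0 < \<tau>" "0 \<le> A"
  shows "(\<integral>\<^sup>+y. ennreal \<bar>F \<tau> y\<bar> \<partial>lborel) \<le> ennreal (A * \<tau> powr (- \<sigma>))"
  using assms unfolding source_def Lq_le_def by simp

lemma source_integrable: "source \<sigma> A F \<Longrightarrow> 0 < \<tau> \<Longrightarrow> integrable lborel (F \<tau>)"
  using Lq_le_integrable_powr[of 1 "F \<tau>"] integrable_abs_iff[of "F \<tau>" lborel]
  by (auto simp: source_def Lq_le_def)

lemma nn_integral_lborel_pair:
  fixes f :: "real \<times> (real ^ 'n) \<Rightarrow> ennreal"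
  assumes "f \<in> borel_measurable borel"
  shows "(\<integral>\<^sup>+m. f m \<partial>lborel) = (\<integral>\<^sup>+\<tau>. \<integral>\<^sup>+y. f (\<tau>, y) \<partial>lborel \<partial>lborel)"
proof -
  have "f \<in> borel_measurable (lborel \<Otimes>\<^sub>M lborel)" using assms by (simp add: lborel_prod)
  from lborel.nn_integral_fst[OF this] show ?thesis by (simp add: lborel_prod)
qed

lemma nn_integral_kernel_source:
  fixes F :: "real \<Rightarrow> real ^ 'n \<Rightarrow> real"
  assumes F: "source \<sigma> A F" and A: "0 \<le> A" and S: "S \<in> sets borel" "S \<subseteq> {0<..}"
    and k: "k \<in> borel_measurable borel" "\<And>\<tau>. 0 \<le> k \<tau>" and C: "0 \<le> C"
    and I: "(\<integral>\<^sup>+\<tau>. ennreal (k \<tau> * \<tau> powr (- \<sigma>)) * indicator S \<tau> \<partial>lborel) \<le> ennreal I" "0 \<le> I"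
  shows "(\<integral>\<^sup>+m. ennreal (indicator S (fst m) * (C * k (fst m) * \<bar>F (fst m) (snd m)\<bar>)) \<partial>lborel) \<le> ennreal (C * A * I)"
proof -
  note [measurable] = source_measurable[OF F]
  have [measurable]: "k \<in> borel_measurable borel" "S \<in> sets borel" by fact+
  have "(\<integral>\<^sup>+m. ennreal (indicator S (fst m) * (C * k (fst m) * \<bar>F (fst m) (snd m)\<bar>)) \<partial>lborel)
     = (\<integral>\<^sup>+\<tau>. \<integral>\<^sup>+y. ennreal (indicator S \<tau> * (C * k \<tau> * \<bar>F \<tau> y\<bar>)) \<partial>lborel \<partial>lborel)"
    by (subst nn_integral_lborel_pair) (auto simp: borel_prod[symmetric])
  also have "\<dots> \<le> (\<integral>\<^sup>+\<tau>. ennreal (C * A) * (ennreal (k \<tau> * \<tau> powr (- \<sigma>)) * indicator S \<tau>) \<partial>lborel)"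
  proof (rule nn_integral_mono)
    fix \<tau> :: real
    show "(\<integral>\<^sup>+y. ennreal (indicator S \<tau> * (C * k \<tau> * \<bar>F \<tau> y\<bar>)) \<partial>lborel) \<le> ennreal (C * A) * (ennreal (k \<tau> * \<tau> powr (- \<sigma>)) * indicator S \<tau>)"
    proof (cases "\<tau> \<in> S")
      case True
      then have \<tau>: "0 < \<tau>" using S by auto
      have "(\<integral>\<^sup>+y. ennreal (C * k \<tau> * \<bar>F \<tau> y\<bar>) \<partial>lborel) = ennreal (C * k \<tau>) * (\<integral>\<^sup>+y. ennreal \<bar>F \<tau> y\<bar> \<partial>lborel)"
        using k C by (subst nn_integral_cmult[symmetric]) (auto simp: ennreal_mult[symmetric])
      also have "\<dots> \<le> ennreal (C * k \<tau>) * ennreal (A * \<tau> powr (- \<sigma>))"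
        by (intro mult_left_mono source_L1[OF F \<tau> A]) auto
      also have "\<dots> = ennreal (C * A) * ennreal (k \<tau> * \<tau> powr (- \<sigma>))"
        using k C A by (simp add: ennreal_mult[symmetric] mult_ac)
      finally show ?thesis using True by simp
    qed simp
  qed
  also have "\<dots> = ennreal (C * A) * (\<integral>\<^sup>+\<tau>. ennreal (k \<tau> * \<tau> powr (- \<sigma>)) * indicator S \<tau> \<partial>lborel)"
    by (subst nn_integral_cmult) auto
  also have "\<dots> \<le> ennreal (C * A) * ennreal I" by (intro mult_left_mono I) auto
  finally show ?thesis using A C I by (simp add: ennreal_mult)
qed

text \<open>Minkowski's inequality over space-time: every point m = (\<tau>,y) contributes a
  translated gradient kernel multiplied by the number F \<tau> y. The time integral stays a
  hypothesis because S, r and p vary between the applications.\<close>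

lemma duh_Lq:
  fixes F :: "real \<Rightarrow> real ^ 'n \<Rightarrow> real"
  assumes F: "source \<sigma> A F" and A: "0 \<le> A" and p: "1 \<le> p" and S: "S \<in> sets borel" "S \<subseteq> {0<..<r}"
    and I: "(\<integral>\<^sup>+\<tau>. ennreal ((r - \<tau>) powr (- (1 / 2 + real CARD('n) / 2 * (1 - 1 / p))) * \<tau> powr (- \<sigma>)) * indicator S \<tau> \<partial>lborel) \<le> ennreal I" "0 \<le> I"
  shows "AE x in lborel. integrable lborel (\<lambda>m. indicator S (fst m) * (heat_grad a (r - fst m) (x - snd m) * F (fst m) (snd m)))"
    and "Lq_le p (duh a S r F) (grad_const a * A * I)"
proof -
  define k where "k \<tau> = (r - \<tau>) powr (- (1 / 2 + real CARD('n) / 2 * (1 - 1 / p)))" for \<tau>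
  define \<kappa> where "\<kappa> m = indicator S (fst m) * (grad_const a * k (fst m) * \<bar>F (fst m) (snd m)\<bar>)" for m :: "real \<times> (real ^ 'n)"
  note [measurable] = source_measurable[OF F]
  have [measurable]: "S \<in> sets borel" by fact
  have [measurable]: "k \<in> borel_measurable borel" unfolding k_def by measurable
  have \<kappa>I: "(\<integral>\<^sup>+m. ennreal (\<kappa> m) \<partial>lborel) \<le> ennreal (grad_const a * A * I)"
    unfolding \<kappa>_def by (rule nn_integral_kernel_source[OF F A S(1)]) (use S I in \<open>auto simp: k_def\<close>)
  have km: "\<kappa> \<in> borel_measurable lborel" unfolding \<kappa>_def lborel_prod[symmetric] by measurable
  have Km: "(\<lambda>(m, x). indicator S (fst m) * (heat_grad a (r - fst m) (x - snd m) * F (fst m) (snd m)))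
     \<in> borel_measurable ((lborel :: (real \<times> (real ^ 'n)) measure) \<Otimes>\<^sub>M borel)"
    unfolding lborel_prod[symmetric] split_beta' by measurable
  have bd: "(\<integral>\<^sup>+x. ennreal (\<bar>indicator S (fst m) * (heat_grad a (r - fst m) (x - snd m) * F (fst m) (snd m))\<bar> powr p) \<partial>lborel) \<le> ennreal (\<kappa> m powr p)" for m
  proof (cases "fst m \<in> S")
    case True
    then have "0 < r - fst m" using S by auto
    from heat_grad_Lq[OF this p, of a "snd m"]
    have "Lq_le p (\<lambda>x. heat_grad a (r - fst m) (x - snd m)) (grad_const a * k (fst m))" unfolding k_def .
    from Lq_le_cmult[OF this, of "F (fst m) (snd m)"]
    have "Lq_le p (\<lambda>x. F (fst m) (snd m) * heat_grad a (r - fst m) (x - snd m)) (\<kappa> m)"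
      using True by (simp add: \<kappa>_def k_def mult.commute)
    then show ?thesis using True by (simp add: Lq_le_def mult.commute)
  qed (use p in simp)
  note * = lborel.sigma_finite_measure_axioms p Km km _ _ \<kappa>I AE_I2[OF bd]
  show "AE x in lborel. integrable lborel (\<lambda>m. indicator S (fst m) * (heat_grad a (r - fst m) (x - snd m) * F (fst m) (snd m)))"
    by (rule minkowski_integral(1)[OF *]) (use A I in \<open>auto simp: \<kappa>_def k_def\<close>)
  show "Lq_le p (duh a S r F) (grad_const a * A * I)"
    unfolding duh_def[abs_def]
    by (rule minkowski_integral(3)[OF *]) (use A I in \<open>auto simp: \<kappa>_def k_def\<close>)
qed

text \<open>For r > t the kernel is bounded on the interval of integration, so the integral
  converges at every x and not just almost everywhere. This makes \<open>duh_split\<close> a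
  pointwise identity.\<close>

lemma duh_integrable_later:
  fixes F :: "real \<Rightarrow> real ^ 'n \<Rightarrow> real"
  assumes F: "source \<sigma> A F" and A: "0 \<le> A" and \<sigma>: "0 \<le> \<sigma>" "\<sigma> < 1" and t: "0 < t" "t < r"
  shows "integrable lborel (\<lambda>m. indicator {0<..<t} (fst m) * (heat_grad a (r - fst m) (x - snd m) * F (fst m) (snd m)))"
proof (rule Bochner_Integration.integrable_bound)
  note [measurable] = source_measurable[OF F]
  let ?C = "grad_const a * (r - t) powr (- (1 / 2)) * (4 * pi * (2 * (r - t))) powr (- real CARD('n) / 2)"
  have "(\<integral>\<^sup>+m. ennreal (indicator {0<..<t} (fst m) * (?C * 1 * \<bar>F (fst m) (snd m)\<bar>)) \<partial>lborel) \<le> ennreal (?C * A * (t powr (1 - \<sigma>) / (1 - \<sigma>)))"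
    by (rule nn_integral_kernel_source[OF F A, of _ "\<lambda>_. 1"]) (use \<sigma> t nn_integral_powr_left[of \<sigma> t] in auto)
  then have "(\<integral>\<^sup>+m. ennreal (norm (indicator {0<..<t} (fst m) * (?C * \<bar>F (fst m) (snd m)\<bar>))) \<partial>lborel) < \<infinity>"
    by (simp add: le_less_trans)
  then show "integrable lborel (\<lambda>m. indicator {0<..<t} (fst m) * (?C * \<bar>F (fst m) (snd m)\<bar>))"
    by (intro integrableI_bounded) (simp_all add: lborel_prod[symmetric])
  have "\<bar>heat_grad a (r - fst m) (x - snd m)\<bar> \<le> ?C" if "fst m < t" for m
  proof -
    have "\<bar>heat_grad a (r - fst m) (x - snd m)\<bar> \<le> grad_const a * (r - fst m) powr (- (1 / 2)) * heat_kernel (2 * (r - fst m)) (x - snd m)"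
      using that t by (intro heat_grad_le) auto
    also have "\<dots> \<le> ?C"
    proof (intro mult_mono mult_left_mono)
      show "(r - fst m) powr (- (1 / 2)) \<le> (r - t) powr (- (1 / 2))" using that t by (intro powr_mono2') auto
      have "heat_kernel (2 * (r - fst m)) (x - snd m) \<le> (4 * pi * (2 * (r - fst m))) powr (- real CARD('n) / 2)"
        using that t by (intro heat_kernel_le_peak) auto
      also have "\<dots> \<le> (4 * pi * (2 * (r - t))) powr (- real CARD('n) / 2)" using that t by (intro powr_mono2') auto
      finally show "heat_kernel (2 * (r - fst m)) (x - snd m) \<le> (4 * pi * (2 * (r - t))) powr (- real CARD('n) / 2)" .
    qed auto
    finally show ?thesis .
  qed
  then have "norm (indicator {0<..<t} (fst m) * (heat_grad a (r - fst m) (x - snd m) * F (fst m) (snd m)))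
     \<le> norm (indicator {0<..<t} (fst m) * (?C * \<bar>F (fst m) (snd m)\<bar>))" for m
    by (auto simp: indicator_def abs_mult intro!: mult_right_mono)
  then show "AE m in lborel. norm (indicator {0<..<t} (fst m) * (heat_grad a (r - fst m) (x - snd m) * F (fst m) (snd m)))
     \<le> norm (indicator {0<..<t} (fst m) * (?C * \<bar>F (fst m) (snd m)\<bar>))" by simp
  show "(\<lambda>m. indicator {0<..<t} (fst m) * (heat_grad a (r - fst m) (x - snd m) * F (fst m) (snd m))) \<in> borel_measurable lborel"
    unfolding lborel_prod[symmetric] by measurable
qed

lemma duh_split:
  fixes F :: "real \<Rightarrow> real ^ 'n \<Rightarrow> real"
  assumes F: "source \<sigma> A F" "0 \<le> A" "0 \<le> \<sigma>" "\<sigma> < 1" and t: "0 < c" "c \<le> t" "t < r"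
  shows "duh a {0<..<t} r F x = duh a {0<..<c} r F x + duh a {c..<t} r F x"
proof -
  let ?f = "\<lambda>S m. indicator S (fst m) * (heat_grad a (r - fst m) (x - snd m) * F (fst m) (snd m))"
  have i: "integrable lborel (?f {0<..<t})" "integrable lborel (?f {0<..<c})"
    using t by (auto intro!: duh_integrable_later[OF F])
  have eq: "?f {c..<t} m = ?f {0<..<t} m - ?f {0<..<c} m" for m
    using t by (auto simp: indicator_def)
  show ?thesis unfolding duh_def eq using i by simp
qed

text \<open>Fubini's theorem. A bounded test function meets only the L^1 norm of the gradient
  kernel, of order (t-\<tau>)^(-1/2), so absolute convergence is a beta integral. The cases used are
  \<phi> = a heat kernel and \<phi> a Schwartz function.\<close>

lemma duh_pairing:
  fixes a :: "real ^ 'n" and F :: "real \<Rightarrow> real ^ 'n \<Rightarrow> real"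
  assumes F: "source \<sigma> A F" and A: "0 \<le> A" and \<sigma>: "0 \<le> \<sigma>" "\<sigma> < 1" and t: "0 < t"
    and \<phi>: "\<phi> \<in> borel_measurable borel" "\<And>x. \<bar>\<phi> x\<bar> \<le> C"
  defines "P \<equiv> \<lambda>s y. LINT x|lborel. heat_grad a s (x - y) * \<phi> x"
  shows "integrable lborel (\<lambda>x. duh a {0<..<t} t F x * \<phi> x)"
    and "integrable lborel (\<lambda>m. indicator {0<..<t} (fst m) * (F (fst m) (snd m) * P (t - fst m) (snd m)))"
    and "(LINT x|lborel. duh a {0<..<t} t F x * \<phi> x)
      = (LINT m|lborel. indicator {0<..<t} (fst m) * (F (fst m) (snd m) * P (t - fst m) (snd m)))"
proof -
  note [measurable] = source_measurable[OF F]
  have [measurable]: "\<phi> \<in> borel_measurable borel" by fact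
  have C: "0 \<le> C" using \<phi>(2)[of 0] by linarith
  define H where "H m x = indicator {0<..<t} (fst m) * (heat_grad a (t - fst m) (x - snd m) * F (fst m) (snd m)) * \<phi> x" for m x
  have Hm[measurable]: "(\<lambda>(m, x). H m x) \<in> borel_measurable ((lborel :: (real \<times> (real ^ 'n)) measure) \<Otimes>\<^sub>M (lborel :: (real ^ 'n) measure))"
    unfolding lborel_prod[symmetric] split_beta' H_def by measurable
  have "(\<integral>\<^sup>+m. \<integral>\<^sup>+x. ennreal \<bar>H m x\<bar> \<partial>lborel \<partial>lborel)
     \<le> (\<integral>\<^sup>+m. ennreal (indicator {0<..<t} (fst m) * ((grad_const a * C) * (t - fst m) powr (- (1 / 2)) * \<bar>F (fst m) (snd m)\<bar>)) \<partial>lborel)"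
  proof (rule nn_integral_mono)
    fix m :: "real \<times> (real ^ 'n)"
    show "(\<integral>\<^sup>+x. ennreal \<bar>H m x\<bar> \<partial>lborel) \<le> ennreal (indicator {0<..<t} (fst m) * ((grad_const a * C) * (t - fst m) powr (- (1 / 2)) * \<bar>F (fst m) (snd m)\<bar>))"
    proof (cases "fst m \<in> {0<..<t}")
      case True
      have "(\<integral>\<^sup>+x. ennreal \<bar>H m x\<bar> \<partial>lborel) \<le> (\<integral>\<^sup>+x. ennreal (C * \<bar>F (fst m) (snd m)\<bar>) * ennreal \<bar>heat_grad a (t - fst m) (x - snd m)\<bar> \<partial>lborel)"
      proof (rule nn_integral_mono)
        fix x
        have "\<bar>H m x\<bar> = (\<bar>F (fst m) (snd m)\<bar> * \<bar>heat_grad a (t - fst m) (x - snd m)\<bar>) * \<bar>\<phi> x\<bar>" using True by (simp add: H_def abs_mult)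
        also have "\<dots> \<le> (\<bar>F (fst m) (snd m)\<bar> * \<bar>heat_grad a (t - fst m) (x - snd m)\<bar>) * C" by (intro mult_left_mono \<phi>) auto
        finally show "ennreal \<bar>H m x\<bar> \<le> ennreal (C * \<bar>F (fst m) (snd m)\<bar>) * ennreal \<bar>heat_grad a (t - fst m) (x - snd m)\<bar>"
          using C by (simp add: ennreal_mult[symmetric] ennreal_leI mult_ac)
      qed
      also have "\<dots> = ennreal (C * \<bar>F (fst m) (snd m)\<bar>) * (\<integral>\<^sup>+x. ennreal \<bar>heat_grad a (t - fst m) (x - snd m)\<bar> \<partial>lborel)"
        by (subst nn_integral_cmult) auto
      also have "\<dots> \<le> ennreal (C * \<bar>F (fst m) (snd m)\<bar>) * ennreal (grad_const a * (t - fst m) powr (- (1 / 2)))"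
        using True by (intro mult_left_mono heat_grad_L1) auto
      finally show ?thesis using True C by (simp add: ennreal_mult[symmetric] mult_ac)
    qed (simp add: H_def)
  qed
  also have "\<dots> \<le> ennreal ((grad_const a * C) * A * (beta_bound (1 / 2) \<sigma> * t powr (1 - 1 / 2 - \<sigma>)))"
    using \<sigma> t C nn_integral_beta_bound[of "1/2" \<sigma> t] beta_bound_pos[of "1/2" \<sigma>]
    by (intro nn_integral_kernel_source[OF F A]) (auto intro!: mult_nonneg_nonneg)
  also have "\<dots> < \<infinity>" by simp
  finally have fin: "(\<integral>\<^sup>+m. \<integral>\<^sup>+x. ennreal \<bar>H m x\<bar> \<partial>lborel \<partial>lborel) < \<infinity>" .
  have iH: "integrable (lborel \<Otimes>\<^sub>M lborel) (\<lambda>(m, x). H m x)"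
  proof (rule integrableI_bounded)
    have "(\<integral>\<^sup>+z. ennreal (norm (case z of (m, x) \<Rightarrow> H m x)) \<partial>(lborel \<Otimes>\<^sub>M lborel))
       = (\<integral>\<^sup>+m. \<integral>\<^sup>+x. ennreal \<bar>H m x\<bar> \<partial>lborel \<partial>lborel)"
      by (subst lborel.nn_integral_fst[symmetric]) auto
    with fin show "(\<integral>\<^sup>+z. ennreal (norm (case z of (m, x) \<Rightarrow> H m x)) \<partial>(lborel \<Otimes>\<^sub>M lborel)) < \<infinity>" by simp
  qed measurable
  have Hx: "(LINT m|lborel. H m x) = duh a {0<..<t} t F x * \<phi> x" for x
    unfolding duh_def H_def by (rule integral_mult_left_zero)
  have Hm': "(LINT x|lborel. H m x) = indicator {0<..<t} (fst m) * (F (fst m) (snd m) * P (t - fst m) (snd m))" for m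
  proof -
    have "H m x = (indicator {0<..<t} (fst m) * F (fst m) (snd m)) * (heat_grad a (t - fst m) (x - snd m) * \<phi> x)" for x
      by (simp add: H_def mult_ac)
    then show ?thesis unfolding P_def by (simp only: integral_mult_right_zero mult.assoc)
  qed
  show "integrable lborel (\<lambda>x. duh a {0<..<t} t F x * \<phi> x)"
    using lborel_pair.integrable_snd[OF iH] by (simp add: Hx)
  show "integrable lborel (\<lambda>m. indicator {0<..<t} (fst m) * (F (fst m) (snd m) * P (t - fst m) (snd m)))"
    using lborel_pair.integrable_fst'[OF iH] by (simp add: Hm')
  have "(LINT x|lborel. LINT m|lborel. H m x) = (LINT m|lborel. LINT x|lborel. H m x)"
    by (rule lborel_pair.Fubini_integral[OF iH])
  then show "(LINT x|lborel. duh a {0<..<t} t F x * \<phi> x)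
      = (LINT m|lborel. indicator {0<..<t} (fst m) * (F (fst m) (snd m) * P (t - fst m) (snd m)))"
    by (simp only: Hx Hm')
qed

lemma heat_grad_pair_heat_kernel:
  fixes y z :: "real ^ 'n"
  assumes "0 < r" "0 < s"
  shows "(LINT x|lborel. heat_grad a r (x - y) * heat_kernel s (z - x)) = heat_grad a (r + s) (z - y)"
proof -
  have "(LINT x|lborel. heat_grad a r (x - y) * heat_kernel s (z - x)) = (LINT w|lborel. heat_grad a r ((z - w) - y) * heat_kernel s (z - (z - w)))"
    by (rule integral_lborel_reflect[of "\<lambda>x. heat_grad a r (x - y) * heat_kernel s (z - x)" z, symmetric]) measurable
  also have "\<dots> = conv (heat_kernel s) (heat_grad a r) (z - y)"
    unfolding conv_def by (intro Bochner_Integration.integral_cong) (auto simp: algebra_simps)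
  also have "\<dots> = heat_grad a (r + s) (z - y)" using assms by (simp add: heat_grad_semigroup add.commute)
  finally show ?thesis .
qed

lemma duh_heat:
  fixes F :: "real \<Rightarrow> real ^ 'n \<Rightarrow> real"
  assumes F: "source \<sigma> A F" "0 \<le> A" "0 \<le> \<sigma>" "\<sigma> < 1" and t: "0 < t" and s: "0 < s"
  shows "(LINT x|lborel. duh a {0<..<t} t F x * heat_kernel s (z - x)) = duh a {0<..<t} (t + s) F z"
proof -
  have b: "\<bar>heat_kernel s (z - x)\<bar> \<le> (4 * pi * s) powr (- real CARD('n) / 2)" for x
    using heat_kernel_le_peak[OF s, of "z - x"] by simp
  have "(LINT x|lborel. duh a {0<..<t} t F x * heat_kernel s (z - x))
     = (LINT m|lborel. indicator {0<..<t} (fst m) * (F (fst m) (snd m) * (LINT x|lborel. heat_grad a (t - fst m) (x - snd m) * heat_kernel s (z - x))))"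
    by (rule duh_pairing(3)[OF F t _ b]) measurable
  also have "\<dots> = duh a {0<..<t} (t + s) F z"
    unfolding duh_def
  proof (intro Bochner_Integration.integral_cong refl)
    fix m :: "real \<times> (real ^ 'n)"
    have e: "t + s - fst m = t - fst m + s" by simp
    show "indicator {0<..<t} (fst m) * (F (fst m) (snd m) * (LINT x|lborel. heat_grad a (t - fst m) (x - snd m) * heat_kernel s (z - x)))
      = indicator {0<..<t} (fst m) * (heat_grad a (t + s - fst m) (z - snd m) * F (fst m) (snd m))"
      unfolding e using s by (cases "fst m \<in> {0<..<t}") (simp_all add: heat_grad_pair_heat_kernel)
  qed
  finally show ?thesis .
qed

text \<open>Integration by parts in the form of commuting convolutions: the derivative in direction
  a may fall on either factor. The sign comes from the oddness of the gradient kernel.\<close>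

lemma heat_grad_pair_schwartz:
  fixes y :: "real ^ 'n"
  assumes \<phi>: "\<phi> \<in> schwartz" and s: "0 < s"
  shows "(LINT x|lborel. heat_grad a s (x - y) * \<phi> x) = - conv (heat_kernel s) (dir_deriv a \<phi>) y"
proof -
  have "conv \<phi> (heat_kernel s) = conv (heat_kernel s) \<phi>"
    by (rule conv_commute) (use schwartz_measurable0[OF \<phi>] in auto)
  then have "conv \<phi> (heat_grad a s) y = conv (heat_kernel s) (dir_deriv a \<phi>) y"
    using conv_dir_deriv[OF schwartz_integrable[OF \<phi>] heat_kernel_schwartz[OF s], of a y]
      conv_dir_deriv[OF heat_kernel_integrable[OF s] \<phi>, of a y] by (simp add: dir_deriv_heat_kernel s)
  moreover have "conv \<phi> (heat_grad a s) y = - (LINT x|lborel. heat_grad a s (x - y) * \<phi> x)"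
  proof -
    have "heat_grad a s (y - x) = - heat_grad a s (x - y)" for x using heat_grad_minus[of a s "x - y"] by simp
    then show ?thesis by (simp add: conv_def mult.commute)
  qed
  ultimately show ?thesis by simp
qed

lemma schwartz_dir_deriv_bounded:
  assumes \<phi>: "\<phi> \<in> schwartz"
  obtains D where "0 \<le> D" "\<And>x. \<bar>dir_deriv a \<phi> x\<bar> \<le> D"
proof -
  obtain L where L: "0 \<le> L" "\<And>x y. \<bar>partials [] \<phi> x - partials [] \<phi> y\<bar> \<le> L * norm (x - y)"
    using schwartz_lipschitz[OF \<phi>] by blast
  have "\<exists>C. \<forall>i. 0 \<le> C i \<and> (\<forall>x. \<bar>partials [i] \<phi> x\<bar> \<le> C i)"
    using schwartz_bounded[OF \<phi>] by (intro choice) metis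
  then obtain C where C: "\<And>i. 0 \<le> C i" "\<And>i x. \<bar>partials [i] \<phi> x\<bar> \<le> C i" by blast
  have "\<bar>dir_deriv a \<phi> x\<bar> \<le> norm a * (\<Sum>i\<in>UNIV. C i)" for x
  proof -
    have "dir_deriv a \<phi> x = (\<Sum>i\<in>UNIV. a $ i * partials [i] \<phi> x)"
      using dir_deriv_eq[OF schwartz_has_derivative[OF \<phi>, of "[]" x], of a] by simp
    also have "\<bar>\<dots>\<bar> \<le> norm a * (\<Sum>i\<in>UNIV. \<bar>partials [i] \<phi> x\<bar>)" by (rule abs_sum_coord_le)
    also have "\<dots> \<le> norm a * (\<Sum>i\<in>UNIV. C i)" by (intro mult_left_mono sum_mono C) auto
    finally show ?thesis .
  qed
  then show ?thesis using C by (intro that[of "norm a * (\<Sum>i\<in>UNIV. C i)"]) (auto intro!: mult_nonneg_nonneg sum_nonneg)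
qed

text \<open>The gradient is moved onto \<open>\<phi>\<close>: left on the kernel, it would give only a bound of order
  \<open>t\<^bsup>1/2-\<sigma>\<^esup>\<close>, and later \<open>\<sigma> > 1/2\<close>.\<close>

lemma duh_initial:
  fixes F :: "real \<Rightarrow> real ^ 'n \<Rightarrow> real"
  assumes F: "source \<sigma> A F" "0 \<le> A" "0 \<le> \<sigma>" "\<sigma> < 1" and \<phi>: "\<phi> \<in> schwartz"
  shows "((\<lambda>t. LINT x|lborel. duh a {0<..<t} t F x * \<phi> x) \<longlongrightarrow> 0) (at_right 0)"
proof -
  obtain C where C: "\<And>x. \<bar>partials [] \<phi> x\<bar> \<le> C" using schwartz_bounded[OF \<phi>] by blast
  obtain D where D: "0 \<le> D" "\<And>x. \<bar>dir_deriv a \<phi> x\<bar> \<le> D" using schwartz_dir_deriv_bounded[OF \<phi>] by blast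
  have bound: "\<bar>LINT x|lborel. duh a {0<..<t} t F x * \<phi> x\<bar> \<le> D * A * (t powr (1 - \<sigma>) / (1 - \<sigma>))" if t: "0 < t" for t
  proof -
    let ?P = "\<lambda>s y. LINT x|lborel. heat_grad a s (x - y) * \<phi> x"
    have P: "\<bar>?P s y\<bar> \<le> D" if s: "0 < s" for s y
    proof -
      have "\<bar>?P s y\<bar> \<le> (LINT w|lborel. \<bar>heat_kernel s w * dir_deriv a \<phi> (y - w)\<bar>)"
        unfolding heat_grad_pair_schwartz[OF \<phi> s] conv_def by (simp del: abs_mult)
      also have "\<dots> \<le> (LINT w|lborel. heat_kernel s (w :: real ^ 'n) * D)"
        by (rule Bochner_Integration.integral_mono')
          (use D s in \<open>auto simp: abs_mult intro!: mult_left_mono integrable_mult_left heat_kernel_integrable\<close>)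
      also have "\<dots> = D" using s by (simp add: integral_heat_kernel)
      finally show ?thesis .
    qed
    let ?f = "\<lambda>m :: real \<times> (real ^ 'n). indicator {0<..<t} (fst m) * (F (fst m) (snd m) * ?P (t - fst m) (snd m))"
    have \<phi>C: "\<bar>\<phi> x\<bar> \<le> C" for x using C[of x] by simp
    note pair = duh_pairing[OF F t schwartz_measurable0[OF \<phi>] \<phi>C, of a]
    have "ennreal \<bar>LINT x|lborel. duh a {0<..<t} t F x * \<phi> x\<bar> \<le> (\<integral>\<^sup>+m. ennreal \<bar>?f m\<bar> \<partial>lborel)"
      unfolding pair(3) using integral_norm_bound_ennreal[OF pair(2)] by simp
    also have "\<dots> \<le> (\<integral>\<^sup>+m. ennreal (indicator {0<..<t} (fst m) * (D * 1 * \<bar>F (fst m) (snd m)\<bar>)) \<partial>lborel)"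
    proof (intro nn_integral_mono ennreal_leI)
      fix m :: "real \<times> (real ^ 'n)"
      show "\<bar>?f m\<bar> \<le> indicator {0<..<t} (fst m) * (D * 1 * \<bar>F (fst m) (snd m)\<bar>)"
      proof (cases "fst m \<in> {0<..<t}")
        case True
        then have "\<bar>F (fst m) (snd m)\<bar> * \<bar>?P (t - fst m) (snd m)\<bar> \<le> \<bar>F (fst m) (snd m)\<bar> * D"
          by (intro mult_left_mono P) auto
        then show ?thesis using True by (simp add: abs_mult mult.commute)
      qed simp
    qed
    also have "\<dots> \<le> ennreal (D * A * (t powr (1 - \<sigma>) / (1 - \<sigma>)))"
      by (rule nn_integral_kernel_source[OF F(1,2), of _ "\<lambda>_. 1"]) (use D F t nn_integral_powr_left[of \<sigma> t] in auto)
    finally show ?thesis using D F t by (subst (asm) ennreal_le_iff) auto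
  qed
  show ?thesis
  proof (rule Lim_null_comparison)
    show "\<forall>\<^sub>F t in at_right 0. norm (LINT x|lborel. duh a {0<..<t} t F x * \<phi> x) \<le> D * A * (t powr (1 - \<sigma>) / (1 - \<sigma>))"
      using bound by (auto simp: eventually_at_filter)
    have "((\<lambda>t::real. D * A * (t powr (1 - \<sigma>) / (1 - \<sigma>))) \<longlongrightarrow> D * A * (0 powr (1 - \<sigma>) / (1 - \<sigma>))) (at_right 0)"
      using F by (intro tendsto_intros) (auto simp: eventually_at_filter)
    then show "((\<lambda>t::real. D * A * (t powr (1 - \<sigma>) / (1 - \<sigma>))) \<longlongrightarrow> 0) (at_right 0)" by simp
  qed
qed

subsection \<open>The fixed point\<close>

locale critical_exponent =
  fixes a :: "real ^ 'n" and \<beta> q :: real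
  assumes \<beta>: "0 < \<beta>" "\<beta> < 1" and q_eq: "q = 1 + 1 / (real CARD('n) + \<beta>)"
begin

text \<open>If \<open>\<parallel>u(t)\<parallel>\<^sub>q\<close> is of order \<open>t\<^bsup>-\<gamma>\<^esup>\<close>, then \<open>\<parallel>u|u|\<^bsup>q-1\<^esup>(t)\<parallel>\<^sub>1\<close> is of order \<open>t\<^bsup>-\<gamma>q\<^esup> = t\<^bsup>-\<sigma>\<^esup>\<close>; the operator
  \<open>a \<cdot> \<nabla>e\<^bsup>s\<Delta>\<^esup> : L\<^sup>1 \<rightarrow> L\<^sup>q\<close> has norm of order \<open>s\<^bsup>-\<alpha>\<^esup>\<close>. The exponent \<open>q\<close> is critical in that the time
  integral of the product returns the weight \<open>t\<^bsup>-\<gamma>\<^esup>\<close>.\<close>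

definition \<nu> :: real where "\<nu> = real CARD('n) / 2 * (1 - 1 / q)"
definition \<sigma> :: real where "\<sigma> = (1 + \<beta>) / 2"
definition \<gamma> :: real where "\<gamma> = \<nu> + \<beta> / 2"
definition \<alpha> :: real where "\<alpha> = 1 / 2 + \<nu>"
definition K :: real where "K = grad_const a * beta_bound \<alpha> \<sigma>"

lemma q1: "1 < q"
  using \<beta> by (simp add: q_eq add_nonneg_pos)

lemma \<sigma>_bounds: "0 < \<sigma>" "\<sigma> < 1"
  using \<beta> by (auto simp: \<sigma>_def)

lemma \<nu>_eq: "\<nu> = real CARD('n) / (2 * (real CARD('n) + \<beta> + 1))"
proof -
  define N where "N = real CARD('n) + \<beta>"
  have N: "0 < N" using \<beta> by (simp add: N_def add_nonneg_pos)
  have "1 - 1 / q = 1 / (N + 1)" unfolding q_eq N_def[symmetric] using N by (simp add: field_simps)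
  then show ?thesis unfolding \<nu>_def by (simp add: N_def)
qed

lemma \<nu>_bounds: "0 \<le> \<nu>" "\<nu> < 1 / 2"
  unfolding \<nu>_eq using \<beta> by (auto simp: divide_less_eq add_nonneg_pos)

lemma \<alpha>_bounds: "0 \<le> \<alpha>" "\<alpha> < 1"
  using \<nu>_bounds by (auto simp: \<alpha>_def)

text \<open>The place where the value of q matters. With N = n + \<beta> one has \<gamma> =
  N(1+\<beta>)/(2(N+1)) and q = (N+1)/N. The companion identity \<open>\<alpha>\<sigma>\<close>
  follows from the definitions for any value of \<nu>.\<close>

lemma \<gamma>q: "\<gamma> * q = \<sigma>"
proof -
  define N where "N = real CARD('n) + \<beta>"
  have N: "0 < N" using \<beta> by (simp add: N_def add_nonneg_pos)
  have "\<gamma> = (N - \<beta>) / (2 * (N + 1)) + \<beta> / 2" unfolding \<gamma>_def \<nu>_eq by (simp add: N_def)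
  also have "\<dots> = N * (1 + \<beta>) / (2 * (N + 1))" using N by (simp add: field_simps)
  finally have "\<gamma> * q = N * (1 + \<beta>) / (2 * (N + 1)) * (1 + 1 / N)" unfolding q_eq N_def[symmetric] by simp
  also have "1 + 1 / N = (N + 1) / N" using N by (simp add: add_divide_distrib)
  also have "N * (1 + \<beta>) / (2 * (N + 1)) * ((N + 1) / N) = \<sigma>"
  proof -
    have "x * (1 + \<beta>) / (2 * y) * (y / x) = (1 + \<beta>) / 2" if "x \<noteq> 0" "y \<noteq> 0" for x y :: real
      using that by simp
    from this[of N "N + 1"] show ?thesis unfolding \<sigma>_def using N by simp
  qed
  finally show ?thesis .
qed

lemma \<alpha>\<sigma>: "1 - \<alpha> - \<sigma> = - \<gamma>"
  by (simp add: \<alpha>_def \<sigma>_def \<gamma>_def field_simps)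

lemma K_nonneg: "0 \<le> K"
  using beta_bound_pos[OF \<alpha>_bounds(2) \<sigma>_bounds(2)] by (simp add: K_def)

section \<open>The nonlinearity in weighted norms\<close>

definition pw :: "real \<Rightarrow> real" where "pw z = z * \<bar>z\<bar> powr (q - 1)"

lemma pw_measurable [measurable]: "pw \<in> borel_measurable borel"
  unfolding pw_def by measurable

lemma abs_pw: "\<bar>pw z\<bar> = \<bar>z\<bar> powr q"
  using q1 by (cases "z = 0") (auto simp: pw_def abs_mult powr_mult_base)

lemma pw_L1:
  assumes "Lq_le q f B" "0 \<le> B"
  shows "Lq_le 1 (\<lambda>x. pw (f x)) (B powr q)"
proof -
  note [measurable] = Lq_le_measurable[OF assms(1)]
  show ?thesis using assms by (simp add: Lq_le_def abs_pw)
qed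

text \<open>The pointwise bound for \<open>signed_power_diff\<close> has two terms, each estimated
  by Hoelder's inequality with the difference as first factor; hence the factor 2q.\<close>

lemma pw_diff_L1:
  assumes f: "Lq_le q f B" and g: "Lq_le q g B" and d: "Lq_le q (\<lambda>x. f x - g x) D" and B: "0 \<le> B" "0 \<le> D"
  shows "Lq_le 1 (\<lambda>x. pw (f x) - pw (g x)) (2 * q * D * B powr (q - 1))"
proof -
  note [measurable] = Lq_le_measurable[OF f] Lq_le_measurable[OF g]
  have q: "1 \<le> q" using q1 by simp
  have "(\<integral>\<^sup>+x. ennreal \<bar>pw (f x) - pw (g x)\<bar> \<partial>lborel)
     \<le> (\<integral>\<^sup>+x. ennreal q * (ennreal (\<bar>f x - g x\<bar> * \<bar>f x\<bar> powr (q - 1)) + ennreal (\<bar>f x - g x\<bar> * \<bar>g x\<bar> powr (q - 1))) \<partial>lborel)"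
  proof (rule nn_integral_mono)
    fix x
    have "ennreal \<bar>pw (f x) - pw (g x)\<bar> \<le> ennreal (q * (\<bar>f x - g x\<bar> * \<bar>f x\<bar> powr (q - 1) + \<bar>f x - g x\<bar> * \<bar>g x\<bar> powr (q - 1)))"
      unfolding pw_def using signed_power_diff[OF q, of "f x" "g x"] by (intro ennreal_leI) (simp add: distrib_left)
    then show "ennreal \<bar>pw (f x) - pw (g x)\<bar> \<le> ennreal q * (ennreal (\<bar>f x - g x\<bar> * \<bar>f x\<bar> powr (q - 1)) + ennreal (\<bar>f x - g x\<bar> * \<bar>g x\<bar> powr (q - 1)))"
      using q by (simp add: ennreal_mult[symmetric] ennreal_plus[symmetric] del: ennreal_plus)
  qed
  also have "\<dots> = ennreal q * ((\<integral>\<^sup>+x. ennreal (\<bar>f x - g x\<bar> * \<bar>f x\<bar> powr (q - 1)) \<partial>lborel) + (\<integral>\<^sup>+x. ennreal (\<bar>f x - g x\<bar> * \<bar>g x\<bar> powr (q - 1)) \<partial>lborel))"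
    by (subst nn_integral_cmult) (auto simp: nn_integral_add)
  also have "\<dots> \<le> ennreal q * (ennreal (D * B powr (q - 1)) + ennreal (D * B powr (q - 1)))"
    by (intro mult_left_mono add_mono nn_integral_holder[OF d f] nn_integral_holder[OF d g] B q) auto
  also have "\<dots> = ennreal (2 * q * D * B powr (q - 1))"
    using B q by (simp add: ennreal_mult[symmetric] ennreal_plus[symmetric] del: ennreal_plus)
  finally show ?thesis using B q by (simp add: Lq_le_def)
qed

text \<open>The ball of radius M in the weighted space, restricted to jointly measurable functions
  so that space-time integrals make sense.\<close>

definition bnd :: "real \<Rightarrow> (real \<Rightarrow> real ^ 'n \<Rightarrow> real) \<Rightarrow> bool" where
  "bnd M U \<longleftrightarrow> (\<lambda>m. U (fst m) (snd m)) \<in> borel_measurable borel \<and> (\<forall>t>0. Lq_le q (U t) (M * t powr (- \<gamma>)))"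

lemma bnd_measurable: "bnd M U \<Longrightarrow> (\<lambda>m. U (fst m) (snd m)) \<in> borel_measurable borel"
  by (simp add: bnd_def)

lemma bnd_Lq: "bnd M U \<Longrightarrow> 0 < t \<Longrightarrow> Lq_le q (U t) (M * t powr (- \<gamma>))"
  by (simp add: bnd_def)

lemma bnd_mono: "bnd M U \<Longrightarrow> 0 \<le> M \<Longrightarrow> M \<le> M' \<Longrightarrow> bnd M' U"
  using q1 by (auto simp: bnd_def intro!: mult_right_mono elim!: Lq_le_mono)

lemma bnd_diff: "bnd M U \<Longrightarrow> bnd M' V \<Longrightarrow> 0 \<le> M \<Longrightarrow> 0 \<le> M' \<Longrightarrow> bnd (M + M') (\<lambda>t x. U t x - V t x)"
  using q1 by (auto simp: bnd_def distrib_right intro!: Lq_le_diff)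

lemma source_pw:
  assumes U: "bnd M U" and M: "0 \<le> M"
  shows "source \<sigma> (M powr q) (\<lambda>t x. pw (U t x))"
  unfolding source_def
proof (intro conjI allI impI)
  show "(\<lambda>m. pw (U (fst m) (snd m))) \<in> borel_measurable borel"
    using measurable_compose[OF bnd_measurable[OF U] pw_measurable] .
  fix t :: real assume t: "0 < t"
  have "Lq_le 1 (\<lambda>x. pw (U t x)) ((M * t powr (- \<gamma>)) powr q)" using M by (intro pw_L1 bnd_Lq[OF U t]) auto
  also have "(M * t powr (- \<gamma>)) powr q = M powr q * t powr (- \<sigma>)"
    using M by (simp add: powr_mult powr_powr \<gamma>q)
  finally show "Lq_le 1 (\<lambda>x. pw (U t x)) (M powr q * t powr (- \<sigma>))" .
qed

lemma source_pw_diff: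
  assumes U: "bnd M U" and V: "bnd M V" and D: "bnd D (\<lambda>t x. U t x - V t x)" and M: "0 \<le> M" "0 \<le> D"
  shows "source \<sigma> (2 * q * D * M powr (q - 1)) (\<lambda>t x. pw (U t x) - pw (V t x))"
  unfolding source_def
proof (intro conjI allI impI)
  show "(\<lambda>m. pw (U (fst m) (snd m)) - pw (V (fst m) (snd m))) \<in> borel_measurable borel"
    using measurable_compose[OF bnd_measurable[OF U] pw_measurable] measurable_compose[OF bnd_measurable[OF V] pw_measurable]
    by (rule borel_measurable_diff)
  fix t :: real assume t: "0 < t"
  have "Lq_le 1 (\<lambda>x. pw (U t x) - pw (V t x)) (2 * q * (D * t powr (- \<gamma>)) * (M * t powr (- \<gamma>)) powr (q - 1))"
    using M by (intro pw_diff_L1 bnd_Lq[OF U t] bnd_Lq[OF V t] bnd_Lq[OF D t]) auto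
  also have "2 * q * (D * t powr (- \<gamma>)) * (M * t powr (- \<gamma>)) powr (q - 1) = 2 * q * D * M powr (q - 1) * t powr (- \<sigma>)"
  proof -
    have "t powr (- \<gamma>) * t powr (- \<gamma> * (q - 1)) = t powr (- \<sigma>)"
      unfolding powr_add[symmetric] \<gamma>q[symmetric] by (simp add: algebra_simps)
    then show ?thesis using M by (simp add: powr_mult powr_powr mult_ac)
  qed
  finally show "Lq_le 1 (\<lambda>x. pw (U t x) - pw (V t x)) (2 * q * D * M powr (q - 1) * t powr (- \<sigma>))" .
qed

lemma duh_bound:
  assumes F: "source \<sigma> A F" and A: "0 \<le> A" and t: "0 < t"
  shows "AE x in lborel. integrable lborel (\<lambda>m. indicator {0<..<t} (fst m) * (heat_grad a (t - fst m) (x - snd m) * F (fst m) (snd m)))"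
    and "Lq_le q (duh a {0<..<t} t F) (K * A * t powr (- \<gamma>))"
proof -
  have I: "(\<integral>\<^sup>+\<tau>. ennreal ((t - \<tau>) powr (- (1 / 2 + real CARD('n) / 2 * (1 - 1 / q))) * \<tau> powr (- \<sigma>)) * indicator {0<..<t} \<tau> \<partial>lborel)
      \<le> ennreal (beta_bound \<alpha> \<sigma> * t powr (- \<gamma>))"
    using nn_integral_beta_bound[OF \<alpha>_bounds less_imp_le[OF \<sigma>_bounds(1)] \<sigma>_bounds(2) t]
    unfolding \<alpha>\<sigma> by (simp add: \<alpha>_def \<nu>_def)
  have I0: "0 \<le> beta_bound \<alpha> \<sigma> * t powr (- \<gamma>)" using beta_bound_pos[OF \<alpha>_bounds(2) \<sigma>_bounds(2)] by simp
  note D = duh_Lq[OF F A less_imp_le[OF q1] _ _ I I0, of a]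
  show "AE x in lborel. integrable lborel (\<lambda>m. indicator {0<..<t} (fst m) * (heat_grad a (t - fst m) (x - snd m) * F (fst m) (snd m)))"
    by (rule D(1)) auto
  have "Lq_le q (duh a {0<..<t} t F) (grad_const a * A * (beta_bound \<alpha> \<sigma> * t powr (- \<gamma>)))" by (rule D(2)) auto
  then show "Lq_le q (duh a {0<..<t} t F) (K * A * t powr (- \<gamma>))" by (simp add: K_def mult_ac)
qed

lemma duh_jointly_measurable:
  assumes F: "source \<sigma> A F"
  shows "(\<lambda>m. duh a {0<..<fst m} (fst m) F (snd m)) \<in> borel_measurable borel"
proof -
  note [measurable] = source_measurable[OF F]
  have "(\<lambda>p. LINT m|lborel. (if 0 < fst m \<and> fst m < fst p then heat_grad a (fst p - fst m) (snd p - snd m) * F (fst m) (snd m) else 0))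
     \<in> borel_measurable (borel :: (real \<times> (real ^ 'n)) measure)"
    unfolding borel_prod[symmetric] by (rule lborel.borel_measurable_lebesgue_integral) (simp add: lborel_prod[symmetric] split_beta')
  moreover have "indicator {0<..<fst p} (fst m) * (heat_grad a (fst p - fst m) (snd p - snd m) * F (fst m) (snd m))
     = (if 0 < fst m \<and> fst m < fst p then heat_grad a (fst p - fst m) (snd p - snd m) * F (fst m) (snd m) else 0)" for p m
    by (auto simp: indicator_def)
  ultimately show ?thesis unfolding duh_def by simp
qed

section \<open>Picard iteration\<close>

definition picard :: "(real \<Rightarrow> real ^ 'n \<Rightarrow> real) \<Rightarrow> (real \<Rightarrow> real ^ 'n \<Rightarrow> real) \<Rightarrow> real \<Rightarrow> real ^ 'n \<Rightarrow> real" where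
  "picard H U t x = H t x - duh a {0<..<t} t (\<lambda>\<tau> y. pw (U \<tau> y)) x"

lemma picard_bnd:
  assumes H: "bnd E H" "0 \<le> E" and U: "bnd M U" "0 \<le> M"
  shows "bnd (E + K * M powr q) (picard H U)"
proof -
  note S = source_pw[OF U]
  have "bnd (K * M powr q) (\<lambda>t. duh a {0<..<t} t (\<lambda>\<tau> y. pw (U \<tau> y)))"
    unfolding bnd_def using duh_jointly_measurable[OF S] duh_bound(2)[OF S] by auto
  from bnd_diff[OF H(1) this] show ?thesis using H U K_nonneg by (simp add: picard_def[abs_def])
qed

lemma picard_diff_bnd:
  assumes H: "bnd E H" "0 \<le> E" and U: "bnd M U" and V: "bnd M V" and D: "bnd D (\<lambda>t x. U t x - V t x)" and M: "0 \<le> M" "0 \<le> D"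
  shows "bnd (K * (2 * q * M powr (q - 1)) * D) (\<lambda>t x. picard H U t x - picard H V t x)"
  unfolding bnd_def
proof (intro conjI allI impI)
  note S = source_pw_diff[OF U V D M]
  have A: "0 \<le> 2 * q * D * M powr (q - 1)" using M q1 by simp
  show "(\<lambda>m. picard H U (fst m) (snd m) - picard H V (fst m) (snd m)) \<in> borel_measurable borel"
    by (rule borel_measurable_diff[OF bnd_measurable[OF picard_bnd[OF H U M(1)]] bnd_measurable[OF picard_bnd[OF H V M(1)]]])
  fix t :: real assume t: "0 < t"
  have "Lq_le q (\<lambda>x. (- 1) * duh a {0<..<t} t (\<lambda>t x. pw (U t x) - pw (V t x)) x) (\<bar>- 1\<bar> * (K * (2 * q * D * M powr (q - 1)) * t powr (- \<gamma>)))"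
    using A K_nonneg by (intro Lq_le_cmult duh_bound(2)[OF S A t]) auto
  then have L: "Lq_le q (\<lambda>x. - duh a {0<..<t} t (\<lambda>t x. pw (U t x) - pw (V t x)) x) (K * (2 * q * M powr (q - 1)) * D * t powr (- \<gamma>))"
    by (simp add: mult_ac)
  show "Lq_le q (\<lambda>x. picard H U t x - picard H V t x) (K * (2 * q * M powr (q - 1)) * D * t powr (- \<gamma>))"
  proof (rule Lq_le_cong[OF L])
    show "(\<lambda>x. picard H U t x - picard H V t x) \<in> borel_measurable borel"
      using Lq_le_measurable[OF bnd_Lq[OF picard_bnd[OF H U M(1)] t]] Lq_le_measurable[OF bnd_Lq[OF picard_bnd[OF H V M(1)] t]]
      by (rule borel_measurable_diff)
    \<comment> \<open>The difference of the two Duhamel integrals is the integral of the difference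
      only where both converge, that is for almost every x.\<close>
    show "AE x in lborel. picard H U t x - picard H V t x = - duh a {0<..<t} t (\<lambda>t x. pw (U t x) - pw (V t x)) x"
      using duh_bound(1)[OF source_pw[OF U M(1)] powr_ge_zero t] duh_bound(1)[OF source_pw[OF V M(1)] powr_ge_zero t]
    proof eventually_elim
      case (elim x)
      have "duh a {0<..<t} t (\<lambda>t x. pw (U t x) - pw (V t x)) x = duh a {0<..<t} t (\<lambda>t x. pw (U t x)) x - duh a {0<..<t} t (\<lambda>t x. pw (V t x)) x"
        unfolding duh_def right_diff_distrib by (rule Bochner_Integration.integral_diff[OF elim])
      then show ?case by (simp add: picard_def)
    qed
  qed (use q1 in simp)
qed

lemma picard_fixed_point:
  assumes H: "bnd E H" "0 \<le> E" and M: "0 < M" "E + K * M powr q \<le> M" "K * (2 * q * M powr (q - 1)) \<le> 1 / 2"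
  shows "\<exists>U. bnd M U \<and> (\<forall>t>0. AE x in lborel. U t x = picard H U t x)"
proof -
  have M0: "0 \<le> M" and q: "1 \<le> q" using M q1 by auto
  define u where "u k = (picard H ^^ k) H" for k
  have uS: "u (Suc k) = picard H (u k)" for k by (simp add: u_def)
  have EM: "E \<le> M" using M(2) K_nonneg by (smt (verit) mult_nonneg_nonneg powr_ge_zero)
  have uB: "bnd M (u k)" for k
  proof (induction k)
    case 0 then show ?case using bnd_mono[OF H EM] by (simp add: u_def)
  next
    case (Suc k)
    then show ?case unfolding uS using H M K_nonneg by (intro bnd_mono[OF picard_bnd[OF H Suc M0]]) auto
  qed
  have contract: "bnd (1 / 2 * D) (\<lambda>t x. picard H U t x - picard H V t x)"
    if "bnd M U" "bnd M V" "bnd D (\<lambda>t x. U t x - V t x)" "0 \<le> D" for U V D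
    using that M K_nonneg q by (intro bnd_mono[OF picard_diff_bnd[OF H that(1-3) M0 that(4)]] mult_right_mono) auto
  \<comment> \<open>Two elements of the ball are at distance at most 2M, and every step halves the
    distance.\<close>
  have dB: "bnd (2 * M * (1 / 2) ^ k) (\<lambda>t x. u (Suc k) t x - u k t x)" for k
  proof (induction k)
    case 0
    show ?case using bnd_diff[OF uB[of 1] uB[of 0] M0 M0] by simp
  next
    case (Suc k)
    have "bnd (1 / 2 * (2 * M * (1 / 2) ^ k)) (\<lambda>t x. picard H (u (Suc k)) t x - picard H (u k) t x)"
      using M0 by (intro contract uB Suc) auto
    then show ?case unfolding uS[symmetric] by (simp add: mult_ac)
  qed
  \<comment> \<open>The operator \<open>lim\<close> has some value even where the iterates diverge,
    which keeps U total and jointly measurable; the exceptional set is null for each t > 0.\<close>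
  define U where "U t x = lim (\<lambda>k. u k t x)" for t x
  have U_meas: "(\<lambda>m. U (fst m) (snd m)) \<in> borel_measurable borel"
    unfolding U_def by (intro borel_measurable_lim_metric bnd_measurable[OF uB])
  \<comment> \<open>U - u_k is the sum of the later increments, and the geometric series 2M
    (1/2)^(j+k) over j sums to 4M (1/2)^k.\<close>
  have tail: "Lq_le q (\<lambda>x. U t x - u k t x) (4 * M * (1 / 2) ^ k * t powr (- \<gamma>))" if t: "0 < t" for t k
  proof -
    let ?d = "\<lambda>j x. u (Suc (j + k)) t x - u (j + k) t x"
    let ?e = "\<lambda>j. 2 * M * (1 / 2) ^ (j + k) * t powr (- \<gamma>)"
    have eS: "?e sums (4 * M * (1 / 2) ^ k * t powr (- \<gamma>))"
    proof -
      have "(\<lambda>j. (2 * M * (1 / 2) ^ k * t powr (- \<gamma>)) * (1 / 2) ^ j) sums ((2 * M * (1 / 2) ^ k * t powr (- \<gamma>)) * (1 / (1 - 1 / 2)))"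
        by (intro sums_mult geometric_sums) auto
      then show ?thesis by (simp add: power_add mult_ac)
    qed
    have dL: "Lq_le q (?d j) (?e j)" for j using bnd_Lq[OF dB t, of "j + k"] by simp
    have e0: "0 \<le> ?e j" for j using M0 by simp
    note S = Lq_le_suminf[OF dL e0 sums_summable[OF eS] q]
    have S2: "Lq_le q (\<lambda>x. \<Sum>j. \<bar>?d j x\<bar>) (4 * M * (1 / 2) ^ k * t powr (- \<gamma>))"
      using S(2) unfolding sums_unique[OF eS, symmetric] .
    show ?thesis
    proof (rule Lq_le_dominated[OF S2])
      show "(\<lambda>x. U t x - u k t x) \<in> borel_measurable borel"
        using measurable_uncurried[OF U_meas, of "\<lambda>x. t" borel "\<lambda>x. x"] Lq_le_measurable[OF bnd_Lq[OF uB t]]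
        by (intro borel_measurable_diff) auto
      show "AE x in lborel. \<bar>U t x - u k t x\<bar> \<le> \<bar>\<Sum>j. \<bar>?d j x\<bar>\<bar>"
        using S(1)
      proof eventually_elim
        case (elim x)
        have sd: "summable (\<lambda>j. ?d j x)" by (rule summable_rabs_cancel[OF elim])
        have "(\<lambda>j. \<Sum>i<j. ?d i x) = (\<lambda>j. u (j + k) t x - u k t x)"
        proof
          fix j show "(\<Sum>i<j. ?d i x) = u (j + k) t x - u k t x" by (induction j) auto
        qed
        with sd have "(\<lambda>j. u (j + k) t x - u k t x) \<longlonglongrightarrow> (\<Sum>j. ?d j x)" using summable_LIMSEQ[OF sd] by simp
        then have "(\<lambda>j. (u (j + k) t x - u k t x) + u k t x) \<longlonglongrightarrow> (\<Sum>j. ?d j x) + u k t x" by (intro tendsto_intros)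
        then have "(\<lambda>j. u (j + k) t x) \<longlonglongrightarrow> (\<Sum>j. ?d j x) + u k t x" by simp
        then have "(\<lambda>j. u j t x) \<longlonglongrightarrow> (\<Sum>j. ?d j x) + u k t x" by (rule LIMSEQ_offset)
        then have "U t x = (\<Sum>j. ?d j x) + u k t x" unfolding U_def by (rule limI)
        then have "\<bar>U t x - u k t x\<bar> \<le> (\<Sum>j. \<bar>?d j x\<bar>)" using summable_rabs[OF elim] by simp
        then show ?case by linarith
      qed
    qed (use q in simp)
  qed
  have lim0: "(\<lambda>k. 4 * M * (1 / 2) ^ k * c) \<longlonglongrightarrow> 0" for c :: real
    by (intro tendsto_mult_left_zero tendsto_mult_right_zero LIMSEQ_power_zero) auto
  have UB: "bnd M U"
    unfolding bnd_def
  proof (intro conjI allI impI U_meas)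
    fix t :: real assume t: "0 < t"
    show "Lq_le q (U t) (M * t powr (- \<gamma>))"
    proof (rule Lq_le_limit)
      fix B assume B: "M * t powr (- \<gamma>) < B"
      have "\<forall>\<^sub>F k in sequentially. 4 * M * (1 / 2) ^ k * t powr (- \<gamma>) < B - M * t powr (- \<gamma>)"
        by (rule order_tendstoD(2)[OF lim0]) (use B in simp)
      then obtain k where k: "4 * M * (1 / 2) ^ k * t powr (- \<gamma>) < B - M * t powr (- \<gamma>)" by (auto simp: eventually_sequentially)
      have "Lq_le q (\<lambda>x. (U t x - u k t x) + u k t x) (4 * M * (1 / 2) ^ k * t powr (- \<gamma>) + M * t powr (- \<gamma>))"
        using M0 q by (intro Lq_le_add tail[OF t] bnd_Lq[OF uB t]) auto
      then have "Lq_le q (U t) (4 * M * (1 / 2) ^ k * t powr (- \<gamma>) + M * t powr (- \<gamma>))" by simp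
      then show "Lq_le q (U t) B" by (rule Lq_le_mono) (use k M0 q in auto)
    qed (use M0 q in auto)
  qed
  have "AE x in lborel. U t x = picard H U t x" if t: "0 < t" for t
  proof -
    \<comment> \<open>Compare both functions with the iterate u_(k+1): the first distance is a tail,
      the second is the contracted tail of u_k. Each is at most 2M (1/2)^k t^(-\<gamma>).\<close>
    have "Lq_le q (\<lambda>x. U t x - picard H U t x) 0"
    proof (rule Lq_le_limit)
      fix B :: real assume B: "0 < B"
      have "\<forall>\<^sub>F k in sequentially. 4 * M * (1 / 2) ^ k * t powr (- \<gamma>) < B"
        by (rule order_tendstoD(2)[OF lim0 B])
      then obtain k where k: "4 * M * (1 / 2) ^ k * t powr (- \<gamma>) < B" by (auto simp: eventually_sequentially)
      have "bnd (4 * M * (1 / 2) ^ k) (\<lambda>t x. U t x - u k t x)"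
        unfolding bnd_def using tail borel_measurable_diff[OF U_meas bnd_measurable[OF uB[of k]]] by auto
      then have "bnd (1 / 2 * (4 * M * (1 / 2) ^ k)) (\<lambda>t x. picard H U t x - picard H (u k) t x)"
        using M0 by (intro contract UB uB) auto
      from bnd_Lq[OF this t]
      have "Lq_le q (\<lambda>x. picard H U t x - u (Suc k) t x) (2 * M * (1 / 2) ^ k * t powr (- \<gamma>))" by (simp add: uS mult.assoc)
      from Lq_le_diff[OF tail[OF t, of "Suc k"] this]
      have "Lq_le q (\<lambda>x. U t x - picard H U t x) (4 * M * (1 / 2) ^ Suc k * t powr (- \<gamma>) + 2 * M * (1 / 2) ^ k * t powr (- \<gamma>))"
        using M0 q by simp
      then show "Lq_le q (\<lambda>x. U t x - picard H U t x) B" by (rule Lq_le_mono) (use k M0 q in \<open>auto simp: mult_ac\<close>)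
    qed (use q in auto)
    from Lq_le_zeroD[OF this] q show ?thesis by simp
  qed
  with UB show ?thesis by blast
qed

end

subsection \<open>Uniqueness\<close>

text \<open>The earlier form of Hoelder's inequality, applied to |g|^(1/(q-1)), whose power q-1 is
  |g| and whose power q is |g|^(q/(q-1)).\<close>

lemma holder_pairing:
  assumes f: "Lq_le q f A" and g: "Lq_le (q / (q - 1)) g b" and AB: "0 \<le> A" "0 \<le> b" and q: "1 < q"
  shows "\<bar>LINT x|lborel. f x * g x\<bar> \<le> A * b"
proof -
  have [measurable]: "f \<in> borel_measurable borel" "g \<in> borel_measurable borel" using f g by (auto simp: Lq_le_def)
  have "Lq_le q (\<lambda>x. \<bar>g x\<bar> powr (1 / (q - 1))) (b powr (1 / (q - 1)))"
    using g q AB by (simp add: Lq_le_def powr_powr)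
  from nn_integral_holder[OF f this AB(1) powr_ge_zero less_imp_le[OF q]]
  have "(\<integral>\<^sup>+x. ennreal (\<bar>f x\<bar> * \<bar>g x\<bar>) \<partial>lborel) \<le> ennreal (A * b)"
    using q AB by (simp add: powr_powr)
  then have le: "(\<integral>\<^sup>+x. ennreal (norm (f x * g x)) \<partial>lborel) \<le> ennreal (A * b)" by (simp add: abs_mult)
  then have i: "integrable lborel (\<lambda>x. f x * g x)"
    by (intro integrableI_bounded) (auto intro: le_less_trans)
  have "ennreal (norm (LINT x|lborel. f x * g x)) \<le> ennreal (A * b)"
    by (rule order_trans[OF integral_norm_bound_ennreal[OF i] le])
  then show ?thesis using AB by simp
qed

lemma heat_grad_bounded: "0 < s \<Longrightarrow> \<exists>C. \<forall>x. \<bar>heat_grad a s x\<bar> \<le> C"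
  using schwartz_dir_deriv_bounded[OF heat_kernel_schwartz, of s a] by (metis dir_deriv_heat_kernel)

lemma conv_heat_grad_integrable:
  assumes f: "integrable lborel f" and s: "0 < s"
  shows "integrable lborel (\<lambda>y. f y * heat_grad a s (x - y))"
proof -
  obtain C where C: "\<And>x. \<bar>heat_grad a s x\<bar> \<le> C" using heat_grad_bounded[OF s] by blast
  show ?thesis by (rule integrable_mult_bounded[OF f _ C]) measurable
qed

lemma conv_heat_grad_pairing:
  fixes f :: "real ^ 'n \<Rightarrow> real"
  assumes f: "integrable lborel f" and s: "0 < s" and \<phi>: "\<phi> \<in> borel_measurable borel" "\<And>x. \<bar>\<phi> x\<bar> \<le> C"
  shows "integrable lborel (\<lambda>x. conv f (heat_grad a s) x * \<phi> x)"
    and "(LINT y|lborel. f y * (LINT x|lborel. heat_grad a s (x - y) * \<phi> x)) = (LINT x|lborel. conv f (heat_grad a s) x * \<phi> x)"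
proof -
  have [measurable]: "f \<in> borel_measurable borel" using borel_measurable_integrable[OF f] by simp
  have [measurable]: "\<phi> \<in> borel_measurable borel" by fact
  have C: "0 \<le> C" using \<phi>(2)[of 0] by linarith
  let ?H = "\<lambda>y x. f y * (heat_grad a s (x - y) * \<phi> x)"
  have i: "integrable (lborel \<Otimes>\<^sub>M lborel) (\<lambda>(y, x). ?H y x)"
  proof (rule integrableI_bounded)
    have "(\<integral>\<^sup>+z. ennreal (norm (case z of (y, x) \<Rightarrow> ?H y x)) \<partial>(lborel \<Otimes>\<^sub>M lborel)) = (\<integral>\<^sup>+y. \<integral>\<^sup>+x. ennreal \<bar>?H y x\<bar> \<partial>lborel \<partial>lborel)"
      by (subst lborel.nn_integral_fst[symmetric]) auto
    also have "\<dots> \<le> (\<integral>\<^sup>+y. ennreal (grad_const a * s powr (- (1 / 2)) * C) * ennreal \<bar>f y\<bar> \<partial>lborel)"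
    proof (rule nn_integral_mono)
      fix y
      have "(\<integral>\<^sup>+x. ennreal \<bar>?H y x\<bar> \<partial>lborel) \<le> (\<integral>\<^sup>+x. ennreal (C * \<bar>f y\<bar>) * ennreal \<bar>heat_grad a s (x - y)\<bar> \<partial>lborel)"
      proof (rule nn_integral_mono)
        fix x
        have "\<bar>?H y x\<bar> \<le> \<bar>f y\<bar> * (\<bar>heat_grad a s (x - y)\<bar> * C)"
          unfolding abs_mult by (intro mult_left_mono \<phi>) auto
        then show "ennreal \<bar>?H y x\<bar> \<le> ennreal (C * \<bar>f y\<bar>) * ennreal \<bar>heat_grad a s (x - y)\<bar>"
          using C by (simp add: ennreal_mult[symmetric] ennreal_leI mult_ac)
      qed
      also have "\<dots> = ennreal (C * \<bar>f y\<bar>) * (\<integral>\<^sup>+x. ennreal \<bar>heat_grad a s (x - y)\<bar> \<partial>lborel)"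
        by (subst nn_integral_cmult) auto
      also have "\<dots> \<le> ennreal (C * \<bar>f y\<bar>) * ennreal (grad_const a * s powr (- (1 / 2)))"
        by (intro mult_left_mono heat_grad_L1 s) auto
      finally show "(\<integral>\<^sup>+x. ennreal \<bar>?H y x\<bar> \<partial>lborel) \<le> ennreal (grad_const a * s powr (- (1 / 2)) * C) * ennreal \<bar>f y\<bar>"
        using C by (simp add: ennreal_mult[symmetric] mult_ac)
    qed
    also have "\<dots> = ennreal (grad_const a * s powr (- (1 / 2)) * C) * (\<integral>\<^sup>+y. ennreal \<bar>f y\<bar> \<partial>lborel)"
      by (subst nn_integral_cmult) auto
    also have "\<dots> < \<infinity>" using f by (simp add: integrable_iff_bounded ennreal_mult_less_top)
    finally show "(\<integral>\<^sup>+z. ennreal (norm (case z of (y, x) \<Rightarrow> ?H y x)) \<partial>(lborel \<Otimes>\<^sub>M lborel)) < \<infinity>" .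
  qed measurable
  have x: "(LINT y|lborel. ?H y x) = conv f (heat_grad a s) x * \<phi> x" for x
    unfolding conv_def mult.assoc[symmetric] by (rule integral_mult_left_zero)
  show "integrable lborel (\<lambda>x. conv f (heat_grad a s) x * \<phi> x)"
    using lborel_pair.integrable_snd[OF i] unfolding x .
  show "(LINT y|lborel. f y * (LINT x|lborel. heat_grad a s (x - y) * \<phi> x)) = (LINT x|lborel. conv f (heat_grad a s) x * \<phi> x)"
    using lborel_pair.Fubini_integral[OF i] unfolding x integral_mult_right_zero by simp
qed

section \<open>From norms of distributions to bounds for functions\<close>

lemma besov_norm_leI:
  assumes "\<And>s. 0 < s \<Longrightarrow> Lq_le 1 (heat s v) (B * s powr (- (\<beta> / 2)))" "0 \<le> B"
  shows "besov_norm \<beta> v \<le> ennreal B"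
  unfolding besov_norm_def
proof (rule SUP_least)
  fix s :: real assume "s \<in> {0<..}"
  then have s: "0 < s" by simp
  have "Lp_norm 1 (heat s v) \<le> ennreal (B * s powr (- (\<beta> / 2)))"
    using assms s by (subst Lp_norm_le_iff) (auto dest: Lq_le_measurable)
  then have "ennreal (s powr (\<beta> / 2)) * Lp_norm 1 (heat s v) \<le> ennreal (s powr (\<beta> / 2)) * ennreal (B * s powr (- (\<beta> / 2)))"
    by (intro mult_left_mono) auto
  also have "\<dots> = ennreal (B * (s powr (\<beta> / 2) * s powr (- (\<beta> / 2))))"
    using assms by (simp add: ennreal_mult[symmetric] mult_ac)
  also have "s powr (\<beta> / 2) * s powr (- (\<beta> / 2)) = 1" using s by (simp add: powr_add[symmetric])
  finally show "ennreal (s powr (\<beta> / 2)) * Lp_norm 1 (heat s v) \<le> ennreal B" by simp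
qed

lemma ennreal_weight_leD:
  assumes "ennreal (s powr c) * X \<le> ennreal B" "0 < s" "0 \<le> B"
  shows "X \<le> ennreal (B * s powr (- c))"
proof -
  have "ennreal (s powr (- c)) * (ennreal (s powr c) * X) = ennreal (s powr (- c) * s powr c) * X"
    by (simp add: ennreal_mult mult.assoc)
  also have "s powr (- c) * s powr c = 1" using assms by (simp add: powr_add[symmetric])
  finally have "X = ennreal (s powr (- c)) * (ennreal (s powr c) * X)" by simp
  also have "\<dots> \<le> ennreal (s powr (- c)) * ennreal B" by (intro mult_left_mono assms) auto
  finally show ?thesis using assms by (simp add: ennreal_mult[symmetric] mult.commute)
qed

lemma besov_norm_leD:
  assumes "besov_norm \<beta> v \<le> ennreal B" "0 \<le> B" "tempered v" "0 < s"
  shows "Lq_le 1 (heat s v) (B * s powr (- (\<beta> / 2)))"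
proof -
  have "ennreal (s powr (\<beta> / 2)) * Lp_norm 1 (heat s v) \<le> besov_norm \<beta> v"
    unfolding besov_norm_def using assms by (intro SUP_upper) auto
  from ennreal_weight_leD[OF order_trans[OF this assms(1)]] assms
  have "Lp_norm 1 (heat s v) \<le> ennreal (B * s powr (- (\<beta> / 2)))" by simp
  then show ?thesis using assms by (subst (asm) Lp_norm_le_iff) (auto intro: heat_borel)
qed

lemma distr_of_cong_AE:
  assumes "f \<in> borel_measurable borel" "g \<in> borel_measurable borel" "AE x in lborel. f x = g x"
  shows "distr_of f = distr_of g"
proof
  fix \<phi>
  show "distr_of f \<phi> = distr_of g \<phi>"
  proof (cases "\<phi> \<in> schwartz")
    case True
    then have [measurable]: "\<phi> \<in> borel_measurable borel" by (rule schwartz_measurable0)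
    have [measurable]: "f \<in> borel_measurable borel" "g \<in> borel_measurable borel" by fact+
    have "(LINT x|lborel. f x * \<phi> x) = (LINT x|lborel. g x * \<phi> x)"
      by (rule integral_cong_AE) (measurable, use assms(3) in eventually_elim, simp)
    then show ?thesis by (simp add: distr_of_def)
  qed (simp add: distr_of_def)
qed

lemma heat_distr_of:
  assumes "0 < s"
  shows "heat s (distr_of f) = conv f (heat_kernel s)"
  by (rule ext) (simp add: heat_def distr_of_def conv_def heat_kernel_translate_schwartz(2)[OF assms])

context critical_exponent
begin

lemma nonlin_eq_pw: "nonlin q T = (\<lambda>x. pw (fun_of T x))"
  by (simp add: nonlin_def pw_def)

text \<open>The integrand is built from the representative chosen by \<open>fun_of\<close>.
  Convolution does not see null sets, so any representative gives the same value; moreover the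
  derivative passes onto the kernel.\<close>

lemma duhamel_integrand_eq:
  assumes r: "represents f (v \<tau>)" and f: "Lq_le q f B" "0 \<le> B" and t: "\<tau> < t" and \<phi>: "\<phi> \<in> schwartz"
  shows "duhamel_integrand a q v t \<tau> \<phi> = (LINT x|lborel. conv (\<lambda>y. pw (f y)) (heat_grad a (t - \<tau>)) x * \<phi> x)"
proof -
  note [measurable] = Lq_le_measurable[OF f(1)]
  let ?g = "nonlin q (v \<tau>)"
  have fm[measurable]: "fun_of (v \<tau>) \<in> borel_measurable borel"
    using represents_fun_of[OF r] by (simp add: represents_def)
  have gm[measurable]: "?g \<in> borel_measurable borel" unfolding nonlin_eq_pw by measurable
  have ae: "AE x in lborel. ?g x = pw (f x)"
    using fun_of_AE[OF r] by eventually_elim (simp add: nonlin_eq_pw)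
  have "integrable lborel (\<lambda>x. pw (f x))"
    using Lq_le_integrable_powr[OF pw_L1[OF f]] by (simp add: integrable_abs_iff)
  then have gi: "integrable lborel ?g"
    using integrable_cong_AE[of ?g lborel "\<lambda>x. pw (f x)"] ae by auto
  have s: "0 < t - \<tau>" using t by simp
  have "conv ?g (heat_grad a (t - \<tau>)) x = conv (\<lambda>y. pw (f y)) (heat_grad a (t - \<tau>)) x" for x
    unfolding conv_def by (rule integral_cong_AE) (measurable, use ae in eventually_elim, simp)
  then have "dir_deriv a (heat (t - \<tau>) (distr_of ?g)) x = conv (\<lambda>y. pw (f y)) (heat_grad a (t - \<tau>)) x" for x
    using conv_dir_deriv[OF gi heat_kernel_schwartz[OF s], of a x]
    by (simp add: heat_distr_of[OF s] dir_deriv_heat_kernel[OF s])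
  then show ?thesis using \<phi> by (simp add: duhamel_integrand_def distr_of_def)
qed

text \<open>Links the two readings of the Duhamel term: \<open>duh\<close> is one integral over
  space-time for fixed x, while a mild solution integrates over time after pairing with
  \<phi>.\<close>

lemma duh_time_integral:
  assumes F: "source \<sigma> A F" "0 \<le> A" and t: "0 < t" and \<phi>: "\<phi> \<in> schwartz"
  shows "integrable lborel (\<lambda>x. duh a {0<..<t} t F x * \<phi> x)"
    and "set_integrable lborel {0<..<t} (\<lambda>\<tau>. LINT x|lborel. conv (F \<tau>) (heat_grad a (t - \<tau>)) x * \<phi> x)"
    and "(LINT x|lborel. duh a {0<..<t} t F x * \<phi> x)
      = (LINT \<tau>:{0<..<t}|lborel. LINT x|lborel. conv (F \<tau>) (heat_grad a (t - \<tau>)) x * \<phi> x)"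
proof -
  obtain C where C: "\<And>x. \<bar>partials [] \<phi> x\<bar> \<le> C" using schwartz_bounded[OF \<phi>] by blast
  have \<phi>C: "\<bar>\<phi> x\<bar> \<le> C" for x using C[of x] by simp
  note D = duh_pairing[OF F less_imp_le[OF \<sigma>_bounds(1)] \<sigma>_bounds(2) t schwartz_measurable0[OF \<phi>] \<phi>C, of a]
  show "integrable lborel (\<lambda>x. duh a {0<..<t} t F x * \<phi> x)" by (rule D(1))
  let ?P = "\<lambda>s y. LINT x|lborel. heat_grad a s (x - y) * \<phi> x"
  let ?h = "\<lambda>m :: real \<times> (real ^ 'n). indicator {0<..<t} (fst m) * (F (fst m) (snd m) * ?P (t - fst m) (snd m))"
  have i: "integrable (lborel \<Otimes>\<^sub>M lborel) ?h" using D(2) by (simp add: lborel_prod)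
  have eq: "(LINT y|lborel. ?h (\<tau>, y)) = indicator {0<..<t} \<tau> *\<^sub>R (LINT x|lborel. conv (F \<tau>) (heat_grad a (t - \<tau>)) x * \<phi> x)" for \<tau>
  proof (cases "\<tau> \<in> {0<..<t}")
    case True
    then show ?thesis
      using conv_heat_grad_pairing(2)[OF source_integrable[OF F(1)] _ schwartz_measurable0[OF \<phi>] \<phi>C, of \<tau> "t - \<tau>" a] by simp
  qed simp
  show "set_integrable lborel {0<..<t} (\<lambda>\<tau>. LINT x|lborel. conv (F \<tau>) (heat_grad a (t - \<tau>)) x * \<phi> x)"
    using lborel_pair.integrable_fst'[OF i] unfolding eq set_integrable_def .
  show "(LINT x|lborel. duh a {0<..<t} t F x * \<phi> x)
      = (LINT \<tau>:{0<..<t}|lborel. LINT x|lborel. conv (F \<tau>) (heat_grad a (t - \<tau>)) x * \<phi> x)"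
    using lborel_pair.integral_fst'[OF i] unfolding D(3) eq set_lebesgue_integral_def by (simp add: lborel_prod)
qed

lemma weighted_norm_le_iff:
  fixes v :: "real \<Rightarrow> 'n distr"
  assumes M: "0 \<le> M"
  shows "weighted_norm \<beta> q v \<le> ennreal M \<longleftrightarrow> (\<forall>t>0. distr_Lp_norm q (v t) \<le> ennreal (M * t powr (- \<gamma>)))"
proof
  assume L: "weighted_norm \<beta> q v \<le> ennreal M"
  show "\<forall>t>0. distr_Lp_norm q (v t) \<le> ennreal (M * t powr (- \<gamma>))"
  proof (intro allI impI)
    fix t :: real assume t: "0 < t"
    have "ennreal (t powr \<gamma>) * distr_Lp_norm q (v t) \<le> weighted_norm \<beta> q v"
      unfolding weighted_norm_def \<gamma>_def \<nu>_def using t by (intro SUP_upper) auto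
    from ennreal_weight_leD[OF order_trans[OF this L] t M] show "distr_Lp_norm q (v t) \<le> ennreal (M * t powr (- \<gamma>))" .
  qed
next
  assume R: "\<forall>t>0. distr_Lp_norm q (v t) \<le> ennreal (M * t powr (- \<gamma>))"
  show "weighted_norm \<beta> q v \<le> ennreal M"
    unfolding weighted_norm_def \<nu>_def[symmetric] \<gamma>_def[symmetric]
  proof (rule SUP_least)
    fix t :: real assume "t \<in> {0<..}"
    then have t: "0 < t" by simp
    have "ennreal (t powr \<gamma>) * distr_Lp_norm q (v t) \<le> ennreal (t powr \<gamma>) * ennreal (M * t powr (- \<gamma>))"
      using R t by (intro mult_left_mono) auto
    also have "\<dots> = ennreal (M * (t powr \<gamma> * t powr (- \<gamma>)))" using M by (simp add: ennreal_mult[symmetric] mult_ac)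
    also have "t powr \<gamma> * t powr (- \<gamma>) = 1" using t by (simp add: powr_add[symmetric])
    finally show "ennreal (t powr \<gamma>) * distr_Lp_norm q (v t) \<le> ennreal M" by simp
  qed
qed

text \<open>Solutions need not be measurable in time as maps into \<open>L\<^sup>q\<close>, only after pairing with test
  functions; hence the detour through duality.\<close>

lemma difference_contraction:
  assumes v: "mild_solution a q u0 v" "weighted_norm \<beta> q v \<le> ennreal M"
    and w: "mild_solution a q u0 w" "weighted_norm \<beta> q w \<le> ennreal M" and M: "0 \<le> M" and D: "0 \<le> D"
    and diff: "\<And>t. 0 < t \<Longrightarrow> Lq_le q (\<lambda>x. fun_of (v t) x - fun_of (w t) x) (D * t powr (- \<gamma>))"
    and t: "0 < t"
  shows "Lq_le q (\<lambda>x. fun_of (v t) x - fun_of (w t) x) (K * (2 * q * M powr (q - 1)) * D * t powr (- \<gamma>))"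
proof (rule Lq_duality)
  have q: "1 \<le> q" using q1 by simp
  have vL: "represents (fun_of (v t)) (v t)" "Lq_le q (fun_of (v t)) (M * t powr (- \<gamma>))"
    and wL: "represents (fun_of (w t)) (w t)" "Lq_le q (fun_of (w t)) (M * t powr (- \<gamma>))" if "0 < t" for t
    using distr_Lp_norm_leD[of q "v t" "M * t powr (- \<gamma>)"] distr_Lp_norm_leD[of q "w t" "M * t powr (- \<gamma>)"]
      v(2) w(2) that M q1 unfolding weighted_norm_le_iff[OF M] by auto
  show "(\<lambda>x. fun_of (v t) x - fun_of (w t) x) \<in> borel_measurable borel" using Lq_le_measurable[OF diff[OF t]] .
  show "1 < q" by (rule q1)
  show "0 \<le> K * (2 * q * M powr (q - 1)) * D * t powr (- \<gamma>)" using K_nonneg D q by simp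
  show "integrable lborel (\<lambda>x. (fun_of (v t) x - fun_of (w t) x) * \<phi> x)" if "\<phi> \<in> schwartz" for \<phi>
    by (rule Lq_le_schwartz_integrable[OF diff[OF t] q that])
  fix \<phi> :: "real ^ 'n \<Rightarrow> real" and b :: real
  assume \<phi>: "\<phi> \<in> schwartz" and b: "0 \<le> b" "Lq_le (q / (q - 1)) \<phi> b"
  define c where "c = 2 * q * D * M powr (q - 1)"
  have c0: "0 \<le> c" using D q by (simp add: c_def)
  obtain C where C: "\<And>x. \<bar>partials [] \<phi> x\<bar> \<le> C" using schwartz_bounded[OF \<phi>] by blast
  have \<phi>C: "\<bar>\<phi> x\<bar> \<le> C" for x using C[of x] by simp
  have set_int: "set_integrable lborel {0<..<t} (\<lambda>\<tau>. duhamel_integrand a q v t \<tau> \<phi>)" "set_integrable lborel {0<..<t} (\<lambda>\<tau>. duhamel_integrand a q w t \<tau> \<phi>)"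
    using v(1) w(1) t \<phi> by (auto simp: mild_solution_def)
  define I where "I \<tau> = duhamel_integrand a q v t \<tau> \<phi> - duhamel_integrand a q w t \<tau> \<phi>" for \<tau>
  have iI: "set_integrable lborel {0<..<t} I" unfolding I_def by (rule set_integral_diff(1)[OF set_int])
  \<comment> \<open>An estimate at one fixed \<tau>: Young's inequality for L^1 and L^q, then
    Hoelder's inequality against \<phi>. Only the scalar function I is integrated over time
    afterwards, and its integrability is part of the notion of a mild solution.\<close>
  have I_le: "\<bar>I \<tau>\<bar> \<le> (grad_const a * c * b) * ((t - \<tau>) powr (- \<alpha>) * \<tau> powr (- \<sigma>))" if \<tau>: "0 < \<tau>" "\<tau> < t" for \<tau>
  proof -
    let ?f = "\<lambda>x. pw (fun_of (v \<tau>) x)" and ?g = "\<lambda>x. pw (fun_of (w \<tau>) x)" and ?k = "heat_grad a (t - \<tau>)"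
    have s: "0 < t - \<tau>" using \<tau> by simp
    have fi: "integrable lborel ?f" "integrable lborel ?g"
      using Lq_le_integrable_powr[OF pw_L1[OF vL(2)]] Lq_le_integrable_powr[OF pw_L1[OF wL(2)]]
        Lq_le_measurable[OF vL(2)] Lq_le_measurable[OF wL(2)] \<tau> M
      by (auto simp: integrable_abs_iff measurable_compose[OF _ pw_measurable])
    have dL: "Lq_le 1 (\<lambda>x. ?f x - ?g x) (c * \<tau> powr (- \<sigma>))"
    proof -
      have "Lq_le 1 (\<lambda>x. ?f x - ?g x) (2 * q * (D * \<tau> powr (- \<gamma>)) * (M * \<tau> powr (- \<gamma>)) powr (q - 1))"
        using M D \<tau> by (intro pw_diff_L1 vL wL diff) auto
      also have "2 * q * (D * \<tau> powr (- \<gamma>)) * (M * \<tau> powr (- \<gamma>)) powr (q - 1) = c * (\<tau> powr (- \<gamma>) * \<tau> powr (- \<gamma> * (q - 1)))"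
        using M by (simp add: c_def powr_mult powr_powr mult_ac)
      also have "\<tau> powr (- \<gamma>) * \<tau> powr (- \<gamma> * (q - 1)) = \<tau> powr (- \<sigma>)"
        unfolding powr_add[symmetric] \<gamma>q[symmetric] by (simp add: algebra_simps)
      finally show ?thesis .
    qed
    have kL: "Lq_le q ?k (grad_const a * (t - \<tau>) powr (- \<alpha>))"
      using heat_grad_Lq[OF s q, of a 0] by (simp add: \<alpha>_def \<nu>_def)
    have "Lq_le q (conv (\<lambda>x. ?f x - ?g x) ?k) (c * \<tau> powr (- \<sigma>) * (grad_const a * (t - \<tau>) powr (- \<alpha>)))"
      using dL c0 by (intro Lq_le_conv kL q) (auto simp: Lq_le_def)
    moreover have "conv (\<lambda>x. ?f x - ?g x) ?k = (\<lambda>x. conv ?f ?k x - conv ?g ?k x)"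
      unfolding conv_def left_diff_distrib
      by (intro ext Bochner_Integration.integral_diff conv_heat_grad_integrable fi s)
    ultimately have cL: "Lq_le q (\<lambda>x. conv ?f ?k x - conv ?g ?k x) (c * \<tau> powr (- \<sigma>) * (grad_const a * (t - \<tau>) powr (- \<alpha>)))" by simp
    have "I \<tau> = (LINT x|lborel. conv ?f ?k x * \<phi> x) - (LINT x|lborel. conv ?g ?k x * \<phi> x)"
      unfolding I_def using duhamel_integrand_eq[where v = v and \<tau> = \<tau>, OF vL[OF \<tau>(1)] _ \<tau>(2) \<phi>] duhamel_integrand_eq[where v = w and \<tau> = \<tau>, OF wL[OF \<tau>(1)] _ \<tau>(2) \<phi>] M by simp
    also have "\<dots> = (LINT x|lborel. conv ?f ?k x * \<phi> x - conv ?g ?k x * \<phi> x)"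
      by (intro Bochner_Integration.integral_diff[symmetric] conv_heat_grad_pairing(1)[OF fi(1) s _ \<phi>C]
          conv_heat_grad_pairing(1)[OF fi(2) s _ \<phi>C] schwartz_measurable0 \<phi>)
    also have "\<dots> = (LINT x|lborel. (conv ?f ?k x - conv ?g ?k x) * \<phi> x)" by (simp add: left_diff_distrib)
    also have "\<bar>\<dots>\<bar> \<le> (c * \<tau> powr (- \<sigma>) * (grad_const a * (t - \<tau>) powr (- \<alpha>))) * b"
      using c0 by (intro holder_pairing[OF cL b(2) _ b(1) q1]) auto
    finally show ?thesis by (simp add: mult_ac)
  qed
  have "(LINT x|lborel. (fun_of (v t) x - fun_of (w t) x) * \<phi> x) = v t \<phi> - w t \<phi>"
  proof -
    have "v t \<phi> = (LINT x|lborel. fun_of (v t) x * \<phi> x)" "w t \<phi> = (LINT x|lborel. fun_of (w t) x * \<phi> x)"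
      using vL(1)[OF t] wL(1)[OF t] \<phi> unfolding represents_def distr_of_def by metis+
    then show ?thesis
      using Lq_le_schwartz_integrable[OF vL(2)[OF t] q \<phi>] Lq_le_schwartz_integrable[OF wL(2)[OF t] q \<phi>]
      by (simp add: left_diff_distrib)
  qed
  also have "\<dots> = - (LINT \<tau>:{0<..<t}|lborel. I \<tau>)"
    unfolding I_def set_integral_diff(2)[OF set_int] using v(1) w(1) t \<phi> by (simp add: mild_solution_def)
  finally have eq: "(LINT x|lborel. (fun_of (v t) x - fun_of (w t) x) * \<phi> x) = - (LINT \<tau>:{0<..<t}|lborel. I \<tau>)" .
  have "ennreal \<bar>LINT \<tau>:{0<..<t}|lborel. I \<tau>\<bar> \<le> (\<integral>\<^sup>+\<tau>. ennreal (norm (indicator {0<..<t} \<tau> *\<^sub>R I \<tau>)) \<partial>lborel)"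
    unfolding set_lebesgue_integral_def real_norm_def[symmetric]
    using iI by (intro integral_norm_bound_ennreal) (simp add: set_integrable_def)
  also have "\<dots> \<le> (\<integral>\<^sup>+\<tau>. ennreal (grad_const a * c * b) * (ennreal ((t - \<tau>) powr (- \<alpha>) * \<tau> powr (- \<sigma>)) * indicator {0<..<t} \<tau>) \<partial>lborel)"
    using I_le c0 b by (intro nn_integral_mono) (auto simp: indicator_def ennreal_mult[symmetric] intro!: ennreal_leI)
  also have "\<dots> = ennreal (grad_const a * c * b) * (\<integral>\<^sup>+\<tau>. ennreal ((t - \<tau>) powr (- \<alpha>) * \<tau> powr (- \<sigma>)) * indicator {0<..<t} \<tau> \<partial>lborel)"
    by (subst nn_integral_cmult) auto
  also have "\<dots> \<le> ennreal (grad_const a * c * b) * ennreal (beta_bound \<alpha> \<sigma> * t powr (1 - \<alpha> - \<sigma>))"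
    using \<sigma>_bounds \<alpha>_bounds t by (intro mult_left_mono nn_integral_beta_bound) auto
  also have "\<dots> = ennreal ((grad_const a * c * b) * (beta_bound \<alpha> \<sigma> * t powr (1 - \<alpha> - \<sigma>)))"
    using c0 b beta_bound_pos[OF \<alpha>_bounds(2) \<sigma>_bounds(2)] by (intro ennreal_mult[symmetric]) auto
  also have "(grad_const a * c * b) * (beta_bound \<alpha> \<sigma> * t powr (1 - \<alpha> - \<sigma>)) = K * (2 * q * M powr (q - 1)) * D * t powr (- \<gamma>) * b"
    unfolding \<alpha>\<sigma> by (simp add: K_def c_def mult_ac)
  finally have "\<bar>LINT \<tau>:{0<..<t}|lborel. I \<tau>\<bar> \<le> K * (2 * q * M powr (q - 1)) * D * t powr (- \<gamma>) * b"
    using K_nonneg D q b by (subst (asm) ennreal_le_iff) auto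
  then show "\<bar>LINT x|lborel. (fun_of (v t) x - fun_of (w t) x) * \<phi> x\<bar> \<le> K * (2 * q * M powr (q - 1)) * D * t powr (- \<gamma>) * b"
    unfolding eq by simp
qed

text \<open>The weighted bounds supply the finite initial distance 2M; the contraction is then
  iterated at all times at once, giving 2M (1/2)^k for every k. The functions therefore agree almost
  everywhere, which means equality as distributions.\<close>

lemma mild_solution_unique:
  assumes v: "mild_solution a q u0 v" "weighted_norm \<beta> q v \<le> ennreal M"
    and w: "mild_solution a q u0 w" "weighted_norm \<beta> q w \<le> ennreal M" and M: "0 \<le> M"
    and small: "K * (2 * q * M powr (q - 1)) \<le> 1 / 2" and t: "0 \<le> t"
  shows "v t = w t"
proof (cases "t = 0")
  case True
  then show ?thesis using v(1) w(1) by (simp add: mild_solution_def)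
next
  case False
  then have t: "0 < t" using t by simp
  have q: "1 \<le> q" using q1 by simp
  have vL: "represents (fun_of (v t)) (v t)" "Lq_le q (fun_of (v t)) (M * t powr (- \<gamma>))"
    and wL: "represents (fun_of (w t)) (w t)" "Lq_le q (fun_of (w t)) (M * t powr (- \<gamma>))" if "0 < t" for t
    using distr_Lp_norm_leD[of q "v t" "M * t powr (- \<gamma>)"] distr_Lp_norm_leD[of q "w t" "M * t powr (- \<gamma>)"]
      v(2) w(2) that M q1 unfolding weighted_norm_le_iff[OF M] by auto
  have diff: "Lq_le q (\<lambda>x. fun_of (v t) x - fun_of (w t) x) (2 * M * (1 / 2) ^ k * t powr (- \<gamma>))" if "0 < t" for k t
    using that
  proof (induction k arbitrary: t)
    case 0
    then show ?case using Lq_le_diff[OF vL(2)[OF 0] wL(2)[OF 0]] M q by (simp add: mult.assoc)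
  next
    case (Suc k)
    let ?D = "2 * M * (1 / 2) ^ k"
    have "Lq_le q (\<lambda>x. fun_of (v t) x - fun_of (w t) x) (K * (2 * q * M powr (q - 1)) * ?D * t powr (- \<gamma>))"
      using M Suc by (intro difference_contraction[OF v w]) auto
    moreover have "K * (2 * q * M powr (q - 1)) * ?D * t powr (- \<gamma>) \<le> 1 / 2 * ?D * t powr (- \<gamma>)"
      using M small by (intro mult_right_mono) auto
    ultimately have "Lq_le q (\<lambda>x. fun_of (v t) x - fun_of (w t) x) (1 / 2 * ?D * t powr (- \<gamma>))"
      using K_nonneg M q by (elim Lq_le_mono) auto
    then show ?case by (simp add: mult_ac)
  qed
  have "Lq_le q (\<lambda>x. fun_of (v t) x - fun_of (w t) x) 0"
  proof (rule Lq_le_limit)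
    fix B :: real assume B: "0 < B"
    have "(\<lambda>k. 2 * M * (1 / 2) ^ k * t powr (- \<gamma>)) \<longlonglongrightarrow> 0"
      by (intro tendsto_mult_left_zero tendsto_mult_right_zero LIMSEQ_power_zero) auto
    then have "\<forall>\<^sub>F k in sequentially. 2 * M * (1 / 2) ^ k * t powr (- \<gamma>) < B" using B by (rule order_tendstoD(2))
    then obtain k where "2 * M * (1 / 2) ^ k * t powr (- \<gamma>) < B" by (auto simp: eventually_sequentially)
    then show "Lq_le q (\<lambda>x. fun_of (v t) x - fun_of (w t) x) B" by (intro Lq_le_mono[OF diff[OF t, of k]]) (use M q in auto)
  qed (use q in auto)
  from Lq_le_zeroD[OF this] q1 have "AE x in lborel. fun_of (v t) x = fun_of (w t) x" by simp
  then have "distr_of (fun_of (v t)) = distr_of (fun_of (w t))"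
    by (intro distr_of_cong_AE Lq_le_measurable[OF vL(2)[OF t]] Lq_le_measurable[OF wL(2)[OF t]])
  then show ?thesis using vL(1)[OF t] wL(1)[OF t] by (simp add: represents_def)
qed

end

subsection \<open>Existence\<close>

context critical_exponent
begin

text \<open>The value 0 for t \<le> 0, where \<open>heat\<close> is meaningless, makes joint
  measurability hold on the whole time axis.\<close>

definition free :: "'n distr \<Rightarrow> real \<Rightarrow> real ^ 'n \<Rightarrow> real" where
  "free u0 t x = indicator {0<..} t * heat t u0 x"

text \<open>The factor \<open>2\<^bsup>\<beta>/2\<^esup> \<le> 3/2\<close> comes from spending half of the time on smoothing from \<open>L\<^sup>1\<close> to \<open>L\<^sup>q\<close>;
  that it is below 2 makes the ball of radius \<open>2\<epsilon>\<close> invariant.\<close>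

lemma free_bnd:
  assumes u0: "tempered u0" and E: "0 \<le> E" "\<And>s. 0 < s \<Longrightarrow> Lq_le 1 (heat s u0) (E * s powr (- (\<beta> / 2)))"
  shows "bnd (3 / 2 * E) (free u0)"
  unfolding bnd_def
proof (intro conjI allI impI)
  show "(\<lambda>m. free u0 (fst m) (snd m)) \<in> borel_measurable borel"
    unfolding free_def by (rule heat_jointly_measurable[OF u0])
  fix t :: real assume t: "0 < t"
  have q: "1 \<le> q" using q1 by simp
  let ?b = "(4 * pi * (t / 2)) powr (- \<nu>)"
  have hk: "Lq_le q (heat_kernel (t / 2) :: real ^ 'n \<Rightarrow> real) ?b"
    using heat_kernel_Lq[of "t / 2" q "0 :: real ^ 'n"] t q by (simp add: \<nu>_def)
  have "Lq_le q (conv (heat (t / 2) u0) (heat_kernel (t / 2))) (E * (t / 2) powr (- (\<beta> / 2)) * ?b)"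
    using E(2)[of "t / 2"] E(1) t by (intro Lq_le_conv hk q) (auto simp: Lq_le_def)
  moreover have "conv (heat (t / 2) u0) (heat_kernel (t / 2)) = free u0 t"
    using heat_semigroup(2)[OF u0, of "t / 2" "t / 2"] t by (auto simp: conv_def free_def)
  ultimately have L: "Lq_le q (free u0 t) (E * (t / 2) powr (- (\<beta> / 2)) * ?b)" by simp
  have "2 powr (\<beta> / 2) \<le> 2 powr (1 / 2 :: real)" using \<beta> by (intro powr_mono) auto
  also have "\<dots> = sqrt 2" by (simp add: powr_half_sqrt)
  also have "\<dots> \<le> 3 / 2" by (rule real_le_lsqrt) (auto simp: power2_eq_square)
  finally have two: "2 powr (\<beta> / 2) \<le> 3 / (2 :: real)" .
  have "?b \<le> t powr (- \<nu>)"
  proof (rule powr_mono2')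
    have "1 * t \<le> (2 * pi) * t" using t pi_gt3 by (intro mult_right_mono) auto
    then show "t \<le> 4 * pi * (t / 2)" by simp
  qed (use t \<nu>_bounds in auto)
  moreover have "(t / 2) powr (- (\<beta> / 2)) = 2 powr (\<beta> / 2) * t powr (- (\<beta> / 2))"
    using t by (simp add: powr_divide powr_minus field_simps)
  moreover have "2 powr (\<beta> / 2) * t powr (- (\<beta> / 2)) \<le> 3 / 2 * t powr (- (\<beta> / 2))"
    by (rule mult_right_mono[OF two]) simp
  ultimately have "E * (t / 2) powr (- (\<beta> / 2)) * ?b \<le> E * (3 / 2 * t powr (- (\<beta> / 2))) * t powr (- \<nu>)"
    using E(1) by (intro mult_mono mult_left_mono) auto
  also have "\<dots> = 3 / 2 * E * t powr (- \<gamma>)"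
  proof -
    have e: "- \<gamma> = - (\<beta> / 2) + - \<nu>" by (simp add: \<gamma>_def)
    show ?thesis unfolding e powr_add by simp
  qed
  finally show "Lq_le q (free u0 t) (3 / 2 * E * t powr (- \<gamma>))"
    using E q by (intro Lq_le_mono[OF L]) auto
qed

text \<open>Since t + s - \<tau> exceeds both s and t - \<tau>, the power -1/2 of it may be
  distributed as -\<beta>/2 on s and -(1-\<beta>)/2 on t - \<tau>. The first factor is the Besov
  weight, the second keeps an integrable singularity. It is \<open>duh_Lq\<close> with p = 1 and r =
  t + s.\<close>

lemma duh_besov:
  assumes F: "source \<sigma> A F" "0 \<le> A" and S: "S \<in> sets borel" "S \<subseteq> {0<..<t}" and s: "0 < s"
    and J: "(\<integral>\<^sup>+\<tau>. ennreal ((t - \<tau>) powr (- ((1 - \<beta>) / 2)) * \<tau> powr (- \<sigma>)) * indicator S \<tau> \<partial>lborel) \<le> ennreal J" "0 \<le> J"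
  shows "Lq_le 1 (duh a S (t + s) F) (grad_const a * A * J * s powr (- (\<beta> / 2)))"
proof -
  have [measurable]: "S \<in> sets borel" by fact
  have "(\<integral>\<^sup>+\<tau>. ennreal ((t + s - \<tau>) powr (- (1 / 2 + real CARD('n) / 2 * (1 - 1 / 1))) * \<tau> powr (- \<sigma>)) * indicator S \<tau> \<partial>lborel)
     \<le> (\<integral>\<^sup>+\<tau>. ennreal (s powr (- (\<beta> / 2))) * (ennreal ((t - \<tau>) powr (- ((1 - \<beta>) / 2)) * \<tau> powr (- \<sigma>)) * indicator S \<tau>) \<partial>lborel)"
  proof (rule nn_integral_mono)
    fix \<tau> :: real
    show "ennreal ((t + s - \<tau>) powr (- (1 / 2 + real CARD('n) / 2 * (1 - 1 / 1))) * \<tau> powr (- \<sigma>)) * indicator S \<tau>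
       \<le> ennreal (s powr (- (\<beta> / 2))) * (ennreal ((t - \<tau>) powr (- ((1 - \<beta>) / 2)) * \<tau> powr (- \<sigma>)) * indicator S \<tau>)"
    proof (cases "\<tau> \<in> S")
      case True
      then have \<tau>: "\<tau> < t" using S by auto
      have "(t + s - \<tau>) powr (- (1 / 2)) = (t + s - \<tau>) powr (- (\<beta> / 2)) * (t + s - \<tau>) powr (- ((1 - \<beta>) / 2))"
        unfolding powr_add[symmetric] by (simp add: field_simps)
      also have "\<dots> \<le> s powr (- (\<beta> / 2)) * (t - \<tau>) powr (- ((1 - \<beta>) / 2))"
        using \<tau> s \<beta> by (intro mult_mono powr_mono2') auto
      finally have "(t + s - \<tau>) powr (- (1 / 2)) * \<tau> powr (- \<sigma>) \<le> s powr (- (\<beta> / 2)) * (t - \<tau>) powr (- ((1 - \<beta>) / 2)) * \<tau> powr (- \<sigma>)"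
        by (rule mult_right_mono) simp
      then show ?thesis using True by (simp add: ennreal_mult[symmetric] mult.assoc ennreal_leI)
    qed simp
  qed
  also have "\<dots> = ennreal (s powr (- (\<beta> / 2))) * (\<integral>\<^sup>+\<tau>. ennreal ((t - \<tau>) powr (- ((1 - \<beta>) / 2)) * \<tau> powr (- \<sigma>)) * indicator S \<tau> \<partial>lborel)"
    by (subst nn_integral_cmult) auto
  also have "\<dots> \<le> ennreal (s powr (- (\<beta> / 2))) * ennreal J" by (intro mult_left_mono J) auto
  also have "\<dots> = ennreal (s powr (- (\<beta> / 2)) * J)" using J by (simp add: ennreal_mult)
  finally have "(\<integral>\<^sup>+\<tau>. ennreal ((t + s - \<tau>) powr (- (1 / 2 + real CARD('n) / 2 * (1 - 1 / 1))) * \<tau> powr (- \<sigma>)) * indicator S \<tau> \<partial>lborel)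
     \<le> ennreal (s powr (- (\<beta> / 2)) * J)" .
  moreover have "S \<subseteq> {0<..<t + s}" using S s by auto
  ultimately have "Lq_le 1 (duh a S (t + s) F) (grad_const a * A * (s powr (- (\<beta> / 2)) * J))"
    using J by (intro duh_Lq(2)[OF F _ S(1)]) auto
  then show ?thesis by (simp add: mult_ac)
qed

text \<open>On (c,t) the factor \<tau>^(-\<sigma>) is at most c^(-\<sigma>), and 1 - (1-\<beta>)/2 =
  \<sigma> gives the power of t - c. It tends to 0 as c approaches t, which makes the tail
  small.\<close>

lemma tail_integral:
  assumes c: "0 < c" "c < t"
  shows "(\<integral>\<^sup>+\<tau>. ennreal ((t - \<tau>) powr (- ((1 - \<beta>) / 2)) * \<tau> powr (- \<sigma>)) * indicator {c..<t} \<tau> \<partial>lborel)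
    \<le> ennreal (c powr (- \<sigma>) * ((t - c) powr \<sigma> / \<sigma>))"
proof -
  have "(\<integral>\<^sup>+\<tau>. ennreal ((t - \<tau>) powr (- ((1 - \<beta>) / 2)) * \<tau> powr (- \<sigma>)) * indicator {c..<t} \<tau> \<partial>lborel)
     \<le> (\<integral>\<^sup>+\<tau>. ennreal (c powr (- \<sigma>)) * (ennreal ((t - \<tau>) powr (- ((1 - \<beta>) / 2))) * indicator {c<..<t} \<tau>) \<partial>lborel)"
  proof (rule nn_integral_mono_AE, use AE_lborel_singleton[of c] in eventually_elim)
    case (elim \<tau>)
    show ?case
    proof (cases "c < \<tau> \<and> \<tau> < t")
      case True
      then have "\<tau> powr (- \<sigma>) \<le> c powr (- \<sigma>)" using c \<sigma>_bounds by (intro powr_mono2') auto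
      then have "(t - \<tau>) powr (- ((1 - \<beta>) / 2)) * \<tau> powr (- \<sigma>) \<le> (t - \<tau>) powr (- ((1 - \<beta>) / 2)) * c powr (- \<sigma>)"
        by (intro mult_left_mono) auto
      then show ?thesis using True by (simp add: ennreal_mult[symmetric] ennreal_leI mult.commute)
    qed (use elim in \<open>auto simp: indicator_def\<close>)
  qed
  also have "\<dots> = ennreal (c powr (- \<sigma>)) * (\<integral>\<^sup>+\<tau>. ennreal ((t - \<tau>) powr (- ((1 - \<beta>) / 2))) * indicator {c<..<t} \<tau> \<partial>lborel)"
    by (subst nn_integral_cmult) auto
  also have "\<dots> \<le> ennreal (c powr (- \<sigma>)) * ennreal ((t - c) powr (1 - (1 - \<beta>) / 2) / (1 - (1 - \<beta>) / 2))"
    using c \<beta> by (intro mult_left_mono nn_integral_powr_right) auto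
  also have "1 - (1 - \<beta>) / 2 = \<sigma>" by (simp add: \<sigma>_def field_simps)
  also have "ennreal (c powr (- \<sigma>)) * ennreal ((t - c) powr \<sigma> / \<sigma>) = ennreal (c powr (- \<sigma>) * ((t - c) powr \<sigma> / \<sigma>))"
    using \<sigma>_bounds by (intro ennreal_mult[symmetric]) auto
  finally show ?thesis .
qed

end

text \<open>Separates the study of a fixed point from its construction: E measures the data, M the
  trajectory, and the equation is known only almost everywhere in x for each t.\<close>

locale fixed_point = critical_exponent a \<beta> q for a :: "real ^ 'n" and \<beta> q :: real +
  fixes u0 :: "'n distr" and U :: "real \<Rightarrow> real ^ 'n \<Rightarrow> real" and E M :: real
  assumes u0: "tempered u0" and E: "0 \<le> E" "\<And>s. 0 < s \<Longrightarrow> Lq_le 1 (heat s u0) (E * s powr (- (\<beta> / 2)))"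
    and U: "bnd M U" and M: "0 \<le> M"
    and fixed: "\<And>t. 0 < t \<Longrightarrow> AE x in lborel. U t x = picard (free u0) U t x"
begin

text \<open>The time 0 is treated apart because u0 need not be a function.\<close>

definition u :: "real \<Rightarrow> 'n distr" where "u t = (if 0 < t then distr_of (U t) else u0)"
definition F :: "real \<Rightarrow> real ^ 'n \<Rightarrow> real" where "F \<tau> y = pw (U \<tau> y)"

lemma q_ge1: "1 \<le> q"
  using q1 by simp

lemma F_source: "source \<sigma> (M powr q) F"
  using source_pw[OF U M] by (simp add: F_def[abs_def])

lemma u_represents: "0 < t \<Longrightarrow> represents (U t) (u t)"
  using represents_distr_of[OF bnd_Lq[OF U] q_ge1] by (simp add: u_def)

lemma u_tempered: "tempered (u t)"
  using tempered_distr_of[OF bnd_Lq[OF U] q_ge1] u0 by (simp add: u_def)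

lemma u_pairing:
  assumes t: "0 < t" and \<phi>: "\<phi> \<in> schwartz"
  shows "u t \<phi> = (LINT x|lborel. heat t u0 x * \<phi> x) - (LINT x|lborel. duh a {0<..<t} t F x * \<phi> x)"
proof -
  have [measurable]: "\<phi> \<in> borel_measurable borel" "U t \<in> borel_measurable borel" "picard (free u0) U t \<in> borel_measurable borel"
    using schwartz_measurable0[OF \<phi>] Lq_le_measurable[OF bnd_Lq[OF U t]]
      Lq_le_measurable[OF bnd_Lq[OF picard_bnd[OF free_bnd[OF u0 E] _ U M] t]] E by auto
  have "u t \<phi> = (LINT x|lborel. U t x * \<phi> x)" using t \<phi> by (simp add: u_def distr_of_def)
  also have "\<dots> = (LINT x|lborel. picard (free u0) U t x * \<phi> x)"
    by (rule integral_cong_AE) (measurable, use fixed[OF t] in eventually_elim, simp)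
  also have "\<dots> = (LINT x|lborel. heat t u0 x * \<phi> x - duh a {0<..<t} t F x * \<phi> x)"
    using t by (intro Bochner_Integration.integral_cong) (auto simp: picard_def free_def F_def[abs_def] left_diff_distrib)
  also have "\<dots> = (LINT x|lborel. heat t u0 x * \<phi> x) - (LINT x|lborel. duh a {0<..<t} t F x * \<phi> x)"
    using M by (intro Bochner_Integration.integral_diff tempered_conv_heat_kernel(1)[OF u0 t \<phi>] duh_time_integral(1)[OF F_source _ t \<phi>]) auto
  finally show ?thesis .
qed

text \<open>Testing the equation with a translated heat kernel moves both terms forward by s: the
  free part by the semigroup law, the Duhamel part by \<open>duh_heat\<close>, which leaves its
  interval of integration at (0,t). The identity holds at every x.\<close>

lemma heat_u:
  assumes t: "0 < t" and s: "0 < s"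
  shows "heat s (u t) x = heat (t + s) u0 x - duh a {0<..<t} (t + s) F x"
proof -
  have "heat s (u t) x = (LINT y|lborel. heat t u0 y * heat_kernel s (x - y)) - (LINT y|lborel. duh a {0<..<t} t F y * heat_kernel s (x - y))"
    unfolding heat_def[of s "u t"] by (rule u_pairing[OF t heat_kernel_translate_schwartz(2)[OF s]])
  then show ?thesis
    using heat_semigroup(2)[OF u0 s t, of x] duh_heat[OF F_source _ less_imp_le[OF \<sigma>_bounds(1)] \<sigma>_bounds(2) t s, of a x] M
    by (simp add: add.commute)
qed

lemma u_weighted: "distr_Lp_norm q (u t) \<le> ennreal (M * t powr (- \<gamma>))" if "0 < t"
  unfolding distr_Lp_norm_eq[OF u_represents[OF that]]
  using bnd_Lq[OF U that] M q1 by (subst Lp_norm_le_iff) (auto dest: Lq_le_measurable)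

lemma u_mild: "mild_solution a q u0 u"
  unfolding mild_solution_def
proof (intro conjI allI impI ballI)
  show "tempered (u t)" for t by (rule u_tempered)
  show "u 0 = u0" by (simp add: u_def)
  fix t :: real assume t: "0 < t"
  show "distr_Lp_norm q (u t) < \<infinity>" using le_less_trans[OF u_weighted[OF t]] by simp
  fix \<phi> :: "real ^ 'n \<Rightarrow> real" assume \<phi>: "\<phi> \<in> schwartz"
  have eq: "duhamel_integrand a q u t \<tau> \<phi> = (LINT x|lborel. conv (F \<tau>) (heat_grad a (t - \<tau>)) x * \<phi> x)"
    if "\<tau> \<in> {0<..<t}" for \<tau>
    unfolding F_def[abs_def] using that M
    by (intro duhamel_integrand_eq[OF u_represents bnd_Lq[OF U] _ _ \<phi>]) auto
  note D = duh_time_integral[OF F_source powr_ge_zero t \<phi>]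
  show "set_integrable lborel {0<..<t} (\<lambda>\<tau>. duhamel_integrand a q u t \<tau> \<phi>)"
    using D(2) unfolding set_integrable_def
    by (rule Bochner_Integration.integrable_cong[THEN iffD1, rotated -1]) (use eq in \<open>auto simp: indicator_def\<close>)
  have "(LINT \<tau>:{0<..<t}|lborel. duhamel_integrand a q u t \<tau> \<phi>) = (LINT x|lborel. duh a {0<..<t} t F x * \<phi> x)"
    unfolding D(3) by (rule set_lebesgue_integral_cong) (use eq in auto)
  then show "u t \<phi> = distr_of (heat t u0) \<phi> - (LINT \<tau>:{0<..<t}|lborel. duhamel_integrand a q u t \<tau> \<phi>)"
    using u_pairing[OF t \<phi>] \<phi> by (simp add: distr_of_def)
qed

section \<open>Besov bounds and continuity in time\<close>

definition besov_const :: real where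
  "besov_const = E + grad_const a * M powr q * beta_bound ((1 - \<beta>) / 2) \<sigma>"

lemma besov_const_nonneg: "0 \<le> besov_const"
  using E beta_bound_pos[of "(1 - \<beta>) / 2" \<sigma>] \<sigma>_bounds \<beta> by (simp add: besov_const_def)

lemma u_besov:
  assumes t: "0 \<le> t" and s: "0 < s"
  shows "Lq_le 1 (heat s (u t)) (besov_const * s powr (- (\<beta> / 2)))"
proof (cases "t = 0")
  case True
  have "0 \<le> grad_const a * M powr q * beta_bound ((1 - \<beta>) / 2) \<sigma>"
    using beta_bound_pos[of "(1 - \<beta>) / 2" \<sigma>] \<sigma>_bounds \<beta> by simp
  then have "E \<le> besov_const" by (simp add: besov_const_def)
  then have "E * s powr (- (\<beta> / 2)) \<le> besov_const * s powr (- (\<beta> / 2))" by (intro mult_right_mono) auto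
  with Lq_le_mono[OF E(2)[OF s] _ this] show ?thesis using True E(1) by (simp add: u_def)
next
  case False
  then have t: "0 < t" using t by simp
  let ?J = "beta_bound ((1 - \<beta>) / 2) \<sigma>"
  have J0: "0 \<le> ?J" using beta_bound_pos[of "(1 - \<beta>) / 2" \<sigma>] \<sigma>_bounds \<beta> by simp
  \<comment> \<open>The time integral therefore scales like t^0, and the Besov bound is uniform in
    t.\<close>
  have e: "1 - (1 - \<beta>) / 2 - \<sigma> = 0" by (simp add: \<sigma>_def field_simps)
  have J: "(\<integral>\<^sup>+\<tau>. ennreal ((t - \<tau>) powr (- ((1 - \<beta>) / 2)) * \<tau> powr (- \<sigma>)) * indicator {0<..<t} \<tau> \<partial>lborel) \<le> ennreal ?J"
    using nn_integral_beta_bound[of "(1 - \<beta>) / 2" \<sigma> t] \<sigma>_bounds \<beta> t unfolding e by simp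
  have 1: "Lq_le 1 (duh a {0<..<t} (t + s) F) (grad_const a * M powr q * ?J * s powr (- (\<beta> / 2)))"
    by (rule duh_besov[OF F_source _ _ _ s J J0]) auto
  have "Lq_le 1 (heat (t + s) u0) (E * s powr (- (\<beta> / 2)))"
  proof (rule Lq_le_mono[OF E(2)])
    show "E * (t + s) powr (- (\<beta> / 2)) \<le> E * s powr (- (\<beta> / 2))"
      using E t s \<beta> by (intro mult_left_mono powr_mono2') auto
  qed (use E t s in auto)
  from Lq_le_diff[OF this 1] show ?thesis
    using E J0 unfolding besov_const_def heat_u[OF t s, abs_def] by (simp add: distrib_right)
qed

lemma u_in_besov: "0 \<le> t \<Longrightarrow> u t \<in> besov \<beta>" "0 \<le> t \<Longrightarrow> besov_norm \<beta> (u t) \<le> ennreal besov_const"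
proof -
  show 1: "besov_norm \<beta> (u t) \<le> ennreal besov_const" if "0 \<le> t"
    by (rule besov_norm_leI[OF u_besov[OF that] besov_const_nonneg])
  show "u t \<in> besov \<beta>" if "0 \<le> t"
    using le_less_trans[OF 1[OF that]] u_tempered by (simp add: besov_def)
qed

definition tail_const :: "real \<Rightarrow> real" where
  "tail_const c = grad_const a * M powr q * (c powr (- \<sigma>) / \<sigma>)"

text \<open>The heat semigroup is not strongly continuous at \<open>0\<close> in the Besov norm. Continuity at \<open>t > 0\<close>
  is obtained by restarting at a time \<open>c < t\<close> close to \<open>t\<close>: \<open>G(\<cdot>,t-c)\<close> depends continuously on
  \<open>t > c\<close> in \<open>L\<^sup>1\<close>, and the Duhamel integral over \<open>(c,t)\<close> is small.\<close>

lemma u_restart: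
  assumes c: "0 < c" "c < t" and s: "0 < s"
  shows "heat s (u t) x = conv (heat s (u c)) (heat_kernel (t - c)) x - duh a {c..<t} (t + s) F x"
    and "integrable lborel (\<lambda>y. heat s (u c) y * heat_kernel (t - c) (x - y))"
    and "Lq_le 1 (duh a {c..<t} (t + s) F) (tail_const c * (t - c) powr \<sigma> * s powr (- (\<beta> / 2)))"
proof -
  have tc: "0 < t - c" using c by simp
  show "integrable lborel (\<lambda>y. heat s (u c) y * heat_kernel (t - c) (x - y))"
    by (rule heat_semigroup(1)[OF u_tempered tc s])
  have "conv (heat s (u c)) (heat_kernel (t - c)) x = heat (t - c + s) (u c) x"
    unfolding conv_def by (rule heat_semigroup(2)[OF u_tempered tc s])
  also have "\<dots> = heat (t + s) u0 x - duh a {0<..<c} (t + s) F x"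
    using heat_u[OF c(1), of "t - c + s" x] c s by (simp add: algebra_simps)
  finally show "heat s (u t) x = conv (heat s (u c)) (heat_kernel (t - c)) x - duh a {c..<t} (t + s) F x"
    using heat_u[of t s x] duh_split[OF F_source powr_ge_zero less_imp_le[OF \<sigma>_bounds(1)] \<sigma>_bounds(2), of c t "t + s" a x] c s by simp
  have "Lq_le 1 (duh a {c..<t} (t + s) F) (grad_const a * M powr q * (c powr (- \<sigma>) * ((t - c) powr \<sigma> / \<sigma>)) * s powr (- (\<beta> / 2)))"
    using c \<sigma>_bounds by (intro duh_besov[OF F_source _ _ _ s tail_integral]) auto
  then show "Lq_le 1 (duh a {c..<t} (t + s) F) (tail_const c * (t - c) powr \<sigma> * s powr (- (\<beta> / 2)))"
    by (simp add: tail_const_def mult.assoc)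
qed

text \<open>Both times are restarted from the same c, so the free parts differ by a convolution of
  \<open>heat s (u c)\<close> with a difference of kernels. The Besov norm at time c bounds the
  first factor by a multiple of s^(-\<beta>/2) in L^1, and the two short Duhamel tails carry the
  same weight.\<close>

lemma u_increment:
  assumes c: "0 < c" "c < t" "c < t'"
  shows "besov_norm \<beta> (\<lambda>\<phi>. u t' \<phi> - u t \<phi>) \<le>
    ennreal (besov_const * (LINT x|lborel. \<bar>heat_kernel (t' - c) x - heat_kernel (t - c) (x :: real ^ 'n)\<bar>)
      + tail_const c * ((t' - c) powr \<sigma> + (t - c) powr \<sigma>))"
proof (rule besov_norm_leI)
  let ?\<delta> = "LINT x|lborel. \<bar>heat_kernel (t' - c) x - heat_kernel (t - c) (x :: real ^ 'n)\<bar>"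
  have \<delta>: "0 \<le> ?\<delta>" by (intro integral_nonneg_AE) auto
  have tail: "0 \<le> tail_const c" using \<sigma>_bounds by (simp add: tail_const_def)
  show "0 \<le> besov_const * ?\<delta> + tail_const c * ((t' - c) powr \<sigma> + (t - c) powr \<sigma>)"
    using besov_const_nonneg \<delta> tail by simp
  fix s :: real assume s: "0 < s"
  let ?g = "\<lambda>x :: real ^ 'n. heat_kernel (t' - c) x - heat_kernel (t - c) x"
  have gi: "integrable lborel ?g" using c by (intro Bochner_Integration.integrable_diff heat_kernel_integrable) auto
  have gL: "Lq_le 1 ?g ?\<delta>"
    using Lq_le_of_integrable[of ?g 1] gi \<delta> by simp
  note uc = u_besov[OF less_imp_le[OF c(1)] s]
  have 1: "Lq_le 1 (conv (heat s (u c)) ?g) (besov_const * s powr (- (\<beta> / 2)) * ?\<delta>)"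
    using uc besov_const_nonneg \<delta> by (intro Lq_le_conv gL) (auto simp: Lq_le_def)
  have split: "conv (heat s (u c)) ?g x = conv (heat s (u c)) (heat_kernel (t' - c)) x - conv (heat s (u c)) (heat_kernel (t - c)) x" for x
    unfolding conv_def right_diff_distrib
    by (rule Bochner_Integration.integral_diff[OF u_restart(2)[OF c(1,3) s] u_restart(2)[OF c(1,2) s]])
  have eq: "heat s (\<lambda>\<phi>. u t' \<phi> - u t \<phi>) = (\<lambda>x. conv (heat s (u c)) ?g x - (duh a {c..<t'} (t' + s) F x - duh a {c..<t} (t + s) F x))"
  proof
    fix x
    have "heat s (\<lambda>\<phi>. u t' \<phi> - u t \<phi>) x = heat s (u t') x - heat s (u t) x" by (simp add: heat_def)
    then show "heat s (\<lambda>\<phi>. u t' \<phi> - u t \<phi>) x = conv (heat s (u c)) ?g x - (duh a {c..<t'} (t' + s) F x - duh a {c..<t} (t + s) F x)"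
      by (simp add: split u_restart(1)[OF c(1,3) s] u_restart(1)[OF c(1,2) s])
  qed
  have "Lq_le 1 (heat s (\<lambda>\<phi>. u t' \<phi> - u t \<phi>)) (besov_const * s powr (- (\<beta> / 2)) * ?\<delta>
      + (tail_const c * (t' - c) powr \<sigma> * s powr (- (\<beta> / 2)) + tail_const c * (t - c) powr \<sigma> * s powr (- (\<beta> / 2))))"
    unfolding eq using besov_const_nonneg \<delta> tail
    by (intro Lq_le_diff 1 u_restart(3) c s) auto
  then show "Lq_le 1 (heat s (\<lambda>\<phi>. u t' \<phi> - u t \<phi>))
     ((besov_const * ?\<delta> + tail_const c * ((t' - c) powr \<sigma> + (t - c) powr \<sigma>)) * s powr (- (\<beta> / 2)))"
    by (simp add: algebra_simps)
qed

lemma u_continuous: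
  assumes t: "0 < t"
  shows "((\<lambda>t'. besov_norm \<beta> (\<lambda>\<phi>. u t' \<phi> - u t \<phi>)) \<longlongrightarrow> 0) (at t)"
proof (rule order_tendstoI)
  fix y :: ennreal assume "0 < y"
  then obtain y' where y': "0 < y'" "y' < y" using dense by blast
  then obtain e where e: "0 < e" "y' = ennreal e" by (cases y') (auto simp: top_unique)
  \<comment> \<open>A bound for \<open>tail_const c\<close> uniform in c > t/2. It allows h to be
    fixed first and c = t - h afterwards.\<close>
  let ?L = "grad_const a * M powr q * ((t / 2) powr (- \<sigma>) / \<sigma>)"
  have "((\<lambda>h. ?L * ((2 * h) powr \<sigma> + h powr \<sigma>)) \<longlongrightarrow> ?L * ((2 * 0) powr \<sigma> + 0 powr \<sigma>)) (at_right 0)"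
    using \<sigma>_bounds by (intro tendsto_intros) (auto simp: eventually_at_filter)
  then have "\<forall>\<^sub>F h in at_right 0. ?L * ((2 * h) powr \<sigma> + h powr \<sigma>) < e / 2"
    by (rule order_tendstoD(2)) (use e in simp)
  moreover have "\<forall>\<^sub>F h in at_right 0. 0 < h \<and> h < t / 2"
    using t by (auto simp: eventually_at_right_field intro: exI[of _ "t / 2"])
  ultimately have "\<forall>\<^sub>F h in at_right 0. ?L * ((2 * h) powr \<sigma> + h powr \<sigma>) < e / 2 \<and> 0 < h \<and> h < t / 2"
    by eventually_elim simp
  then obtain h where h: "?L * ((2 * h) powr \<sigma> + h powr \<sigma>) < e / 2" "0 < h" "h < t / 2"
    using eventually_happens' trivial_limit_at_right_real by blast
  define c where "c = t - h"
  have c: "0 < c" "c < t" "t / 2 < c" using h t by (auto simp: c_def)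
  have tL: "tail_const c \<le> ?L"
    unfolding tail_const_def using c t \<sigma>_bounds by (intro mult_left_mono divide_right_mono powr_mono2') auto
  have "((\<lambda>s. LINT x|lborel. \<bar>heat_kernel s x - heat_kernel (t - c) (x :: real ^ 'n)\<bar>) \<longlongrightarrow> 0) (at (t - c))"
    using c by (intro heat_kernel_continuous_L1) auto
  then have "((\<lambda>t'. LINT x|lborel. \<bar>heat_kernel (t' - c) x - heat_kernel (t - c) (x :: real ^ 'n)\<bar>) \<longlongrightarrow> 0) (at t)"
    using LIM_offset[of "\<lambda>s. LINT x|lborel. \<bar>heat_kernel s x - heat_kernel (t - c) (x :: real ^ 'n)\<bar>" 0 "t - c" "- c"] by simp
  then have "((\<lambda>t'. besov_const * (LINT x|lborel. \<bar>heat_kernel (t' - c) x - heat_kernel (t - c) (x :: real ^ 'n)\<bar>)) \<longlongrightarrow> 0) (at t)"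
    by (rule tendsto_mult_right_zero)
  then have "\<forall>\<^sub>F t' in at t. besov_const * (LINT x|lborel. \<bar>heat_kernel (t' - c) x - heat_kernel (t - c) (x :: real ^ 'n)\<bar>) < e / 2"
    by (rule order_tendstoD(2)) (use e in simp)
  moreover have "\<forall>\<^sub>F t' in at t. dist t' t < h" using h unfolding eventually_at by blast
  ultimately show "\<forall>\<^sub>F t' in at t. besov_norm \<beta> (\<lambda>\<phi>. u t' \<phi> - u t \<phi>) < y"
  proof eventually_elim
    case (elim t')
    then have t': "c < t'" "t' - c < 2 * h" by (auto simp: dist_real_def c_def)
    \<comment> \<open>The length 2h arises from |t' - t| < h and t - c = h.\<close>
    have "tail_const c * ((t' - c) powr \<sigma> + (t - c) powr \<sigma>) \<le> ?L * ((2 * h) powr \<sigma> + h powr \<sigma>)"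
      using t' tL \<sigma>_bounds by (intro mult_mono add_mono powr_mono2) (auto simp: c_def)
    then have "besov_const * (LINT x|lborel. \<bar>heat_kernel (t' - c) x - heat_kernel (t - c) (x :: real ^ 'n)\<bar>)
        + tail_const c * ((t' - c) powr \<sigma> + (t - c) powr \<sigma>) \<le> e" using elim(1) h(1) by linarith
    then have "besov_norm \<beta> (\<lambda>\<phi>. u t' \<phi> - u t \<phi>) \<le> ennreal e"
      by (intro order_trans[OF u_increment[OF c(1,2) t'(1)]] ennreal_leI)
    then show ?case using y' e by simp
  qed
qed simp

lemma u_initial:
  assumes \<phi>: "\<phi> \<in> schwartz"
  shows "((\<lambda>t. u t \<phi>) \<longlongrightarrow> u 0 \<phi>) (at_right 0)"
proof -
  have "((\<lambda>t. (LINT x|lborel. heat t u0 x * \<phi> x) - (LINT x|lborel. duh a {0<..<t} t F x * \<phi> x)) \<longlongrightarrow> u0 \<phi> - 0) (at_right 0)"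
    by (intro tendsto_diff tempered_heat_initial[OF u0 \<phi>]
        duh_initial[OF F_source powr_ge_zero less_imp_le[OF \<sigma>_bounds(1)] \<sigma>_bounds(2) \<phi>])
  moreover have "\<forall>\<^sub>F t in at_right 0. (LINT x|lborel. heat t u0 x * \<phi> x) - (LINT x|lborel. duh a {0<..<t} t F x * \<phi> x) = u t \<phi>"
    using u_pairing[OF _ \<phi>] by (auto simp: eventually_at_filter)
  ultimately have "((\<lambda>t. u t \<phi>) \<longlongrightarrow> u0 \<phi> - 0) (at_right 0)"
    by (rule Lim_transform_eventually)
  then show ?thesis by (simp add: u_def)
qed

lemma u_weighted_norm: "weighted_norm \<beta> q u \<le> ennreal M"
  unfolding weighted_norm_le_iff[OF M] using u_weighted by blast

lemma u_space_X: "u \<in> space_X \<beta> q"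
proof -
  have "(SUP t\<in>{0..T}. besov_norm \<beta> (u t)) < \<infinity>" for T
  proof -
    have "(SUP t\<in>{0..T}. besov_norm \<beta> (u t)) \<le> ennreal besov_const"
      by (intro SUP_least u_in_besov(2)) auto
    then show ?thesis by (rule le_less_trans) simp
  qed
  moreover have "weighted_norm \<beta> q u < \<infinity>" by (rule le_less_trans[OF u_weighted_norm]) simp
  ultimately show ?thesis
    using u_in_besov(1) u_continuous u_initial u_mild
    by (auto simp: space_X_def cont_besov_def mild_solution_def)
qed

end

theorem theorem2p2:
  fixes a :: "real ^ 'n" and \<beta> q :: real
  assumes "0 < \<beta>" and "\<beta> < 1"
    and "q = 1 + 1 / (real CARD('n) + \<beta>)"
  shows "\<exists>\<epsilon>>0. \<forall>u0 \<in> besov \<beta>. besov_norm \<beta> u0 < ennreal \<epsilon> \<longrightarrow>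
           (\<exists>u. mild_solution a q u0 u \<and> u \<in> space_X \<beta> q \<and>
                weighted_norm \<beta> q u \<le> ennreal (2 * \<epsilon>) \<and>
                (\<forall>v. mild_solution a q u0 v \<and> weighted_norm \<beta> q v \<le> ennreal (2 * \<epsilon>) \<longrightarrow>
                     (\<forall>t\<ge>0. v t = u t)))"
proof -
  interpret critical_exponent a \<beta> q by unfold_locales (use assms in auto)
  \<comment> \<open>M solves M^(q-1) = 1/(4q(K+1)), which makes 2qK M^(q-1) at most 1/2. The summand
    1 guards against K = 0, which occurs for a = 0.\<close>
  define M where "M = (1 / (4 * q * (K + 1))) powr (1 / (q - 1))"
  have pos: "0 < 4 * q * (K + 1)" using q1 K_nonneg by simp
  then have M: "0 < M" "M powr (q - 1) = 1 / (4 * q * (K + 1))"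
    using q1 by (auto simp: M_def powr_powr)
  then have M_nonneg: "0 \<le> M" by simp
  have small: "K * (2 * q * M powr (q - 1)) \<le> 1 / 2"
  proof -
    have "K * (2 * q * M powr (q - 1)) = K / (K + 1) / 2"
      unfolding M(2) using q1 pos by (simp add: divide_simps)
    also have "\<dots> \<le> 1 / 2" using K_nonneg by (intro divide_right_mono) (auto simp: divide_le_eq_1)
    finally show ?thesis .
  qed
  have "K * M powr (q - 1) \<le> 1 / 4"
  proof -
    have "1 * (K * M powr (q - 1)) \<le> q * (K * M powr (q - 1))" using q1 K_nonneg by (intro mult_right_mono) auto
    then show ?thesis using small by (simp add: mult_ac)
  qed
  then have "M * (K * M powr (q - 1)) \<le> M * (1 / 4)" using M by (intro mult_left_mono) auto
  moreover have "M * (K * M powr (q - 1)) = K * (M * M powr (q - 1))" by (rule mult.left_commute)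
  moreover have "M * M powr (q - 1) = M powr q" using powr_mult_base[of M "q - 1"] M(1) by simp
  \<comment> \<open>Here \<epsilon> = M/2: the free evolution takes 3M/4 of the radius, the Duhamel
    term at most M/4.\<close>
  ultimately have KM: "3 / 2 * (M / 2) + K * M powr q \<le> M" by simp
  show ?thesis
  proof (intro exI[of _ "M / 2"] conjI ballI impI)
    show "0 < M / 2" using M by simp
    fix u0 :: "'n distr" assume u0: "u0 \<in> besov \<beta>" "besov_norm \<beta> u0 < ennreal (M / 2)"
    then have T: "tempered u0" by (simp add: besov_def)
    have E: "Lq_le 1 (heat s u0) (M / 2 * s powr (- (\<beta> / 2)))" if "0 < s" for s
      using besov_norm_leD[OF less_imp_le[OF u0(2)] _ T that] M by simp
    have H: "bnd (3 / 2 * (M / 2)) (free u0)" using M by (intro free_bnd T E) auto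
    obtain U where U: "bnd M U" "\<And>t. 0 < t \<Longrightarrow> AE x in lborel. U t x = picard (free u0) U t x"
      using picard_fixed_point[OF H _ M(1) KM small] M by auto
    interpret fixed_point a \<beta> q u0 U "M / 2" M
      by unfold_locales (fact T E U M_nonneg | simp add: M_nonneg)+
    have "v t = u t" if "mild_solution a q u0 v" "weighted_norm \<beta> q v \<le> ennreal M" "0 \<le> t" for v t
      by (rule mild_solution_unique[OF that(1,2) u_mild u_weighted_norm M_nonneg small that(3)])
    moreover have "2 * (M / 2) = M" by simp
    ultimately show "\<exists>u. mild_solution a q u0 u \<and> u \<in> space_X \<beta> q \<and> weighted_norm \<beta> q u \<le> ennreal (2 * (M / 2)) \<and>
        (\<forall>v. mild_solution a q u0 v \<and> weighted_norm \<beta> q v \<le> ennreal (2 * (M / 2)) \<longrightarrow> (\<forall>t\<ge>0. v t = u t))"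
      using u_mild u_space_X u_weighted_norm by metis
  qed
qed


end
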